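(* Let $k\ge0$ be an integer, let $V_0,V_1,\dots,V_k\in\mathcal{L}_\infty(H)$ and let $0\le T_0,T_1,\dots,T_k\in\mathcal{L}_{1,\infty}$. If the operators $V_iT_i$, $0\le i\le k$, are all Dixmier-measurable (in $\mathcal{L}_{1,\infty}=\mathcal{I}_0$), then so is the operator $\bigotimes_{i=0}^kV_iT_i$ (in $\mathcal{I}_k(H^{\otimes(k+1)})$). In particular, if $A_0,A_1,\dots,A_k\in\mathcal{L}_{1,\infty}$ are Dixmier-measurable, then the operator $\bigotimes_{i=0}^kA_i$ is Dixmier-measurable.
   Context: $H$ is a complex separable infinite-dimensional Hilbert space, $H^{\otimes(k+1)}$ the Hilbert space tensor product of $k+1$ copies of $H$; $\mathcal{L}_\infty(\cdot)$ and $\mathcal{C}_0(\cdot)$ denote bounded and compact operators; $\mu(n,T)$, $n\ge0$, are the singular values of a compact operator $T$ in non-increasing order. $\mathcal{L}_{1,\infty}=\{T\in\mathcal{C}_0(H):\mu(n,T)=O((n+1)^{-1})\}$. For an integer $k\ge0$ and a Hilbert space $K$, put $g_k(t)=\frac{k^k}{e^k}\chi_{[0,e^k)}(t)+\frac{(\log t)^k}{t}\chi_{[e^k,\infty)}(t)$ (with $0^0=1$), $\mathcal{I}_k(K):=\{T\in\mathcal{C}_0(K):\mu(n,T)=O(g_k(n))\}$, and $G_k(t)=\frac{(\log t)^{k+1}}{k+1}$. Then $\mathcal{I}_0(H)=\mathcal{L}_{1,\infty}$, and the tensor product of $k+1$ operators from $\mathcal{L}_{1,\infty}$ belongs to $\mathcal{I}_k(H^{\otimes(k+1)})$.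 $EL(\mathbb{N})$ is the set of positive linear functionals on the real space $\ell_\infty$ which equal the limit on every convergent sequence. Dixmier traces on $\mathcal{I}_k$ are the linear extensions of the functionals $\mathrm{Tr}_\omega(T)=\omega\big(n\mapsto\frac{1}{G_k(n+1)}\sum_{j=0}^n\mu(j,T)\big)$, $0\le T\in\mathcal{I}_k$, where $\omega\in EL(\mathbb{N})$ (finitely many initial terms, where $G_k(n+1)$ vanishes, are irrelevant; on $\mathcal I_k$ it makes no difference whether $\omega$ is additionally required to be invariant under $(x_0,x_1,\dots)\mapsto(x_0,x_0,x_1,x_1,\dots)$). An operator $T\in\mathcal{I}_k$ is Dixmier-measurable if all Dixmier traces on $\mathcal{I}_k$ take the same value on $T$. *)

theory Defs
  imports "HOL-Analysis.Analysis" "HOL-Library.Landau_Symbols"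
begin

text \<open>
  Complex Hilbert spaces, with the inner product conjugate-linear in its first argument. The class
  extends the library's real Hilbert spaces: the underlying real inner product is the real part of
  the complex one, so norm, topology, completeness and positive definiteness are inherited.
\<close>

class complex_hilbert_space = real_inner + banach +
  fixes scaleC :: "complex \<Rightarrow> 'a \<Rightarrow> 'a" (infixr "*\<^sub>C" 75)
    and cinner :: "'a \<Rightarrow> 'a \<Rightarrow> complex"
  assumes scaleC_add_right: "a *\<^sub>C (x + y) = a *\<^sub>C x + a *\<^sub>C y"
    and scaleC_add_left: "(a + b) *\<^sub>C x = a *\<^sub>C x + b *\<^sub>C x"
    and scaleC_scaleC: "a *\<^sub>C b *\<^sub>C x = (a * b) *\<^sub>C x"
    and scaleC_of_real: "complex_of_real r *\<^sub>C x = r *\<^sub>R x"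
    and cinner_add_left: "cinner (x + y) z = cinner x z + cinner y z"
    and cinner_scaleC_left: "cinner (a *\<^sub>C x) y = cnj a * cinner x y"
    and cinner_commute: "cinner x y = cnj (cinner y x)"
    and inner_eq_Re_cinner: "inner x y = Re (cinner x y)"

global_interpretation complex_vector:
  vector_space "scaleC :: complex \<Rightarrow> 'a \<Rightarrow> 'a::complex_hilbert_space"
  defines cspan = complex_vector.span
    and cdim = complex_vector.dim
proof
  show "1 *\<^sub>C x = x" for x :: 'a
    using scaleC_of_real[of 1 x] by simp
qed (simp_all add: scaleC_add_right scaleC_add_left scaleC_scaleC)

definition separable_infinite_dim :: "'a::complex_hilbert_space itself \<Rightarrow> bool" where
  "separable_infinite_dim _ \<longleftrightarrow>
     separable_space (euclidean :: 'a topology) \<and>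
     \<not> (\<exists>B::'a set. finite B \<and> cspan B = UNIV)"


text \<open>Operators are plain functions; all predicates below that depend on boundedness or linearity
  include it.\<close>

definition bounded_clinear :: "('a::complex_hilbert_space \<Rightarrow> 'b::complex_hilbert_space) \<Rightarrow> bool" where
  "bounded_clinear T \<longleftrightarrow> bounded_linear T \<and> (\<forall>c x. T (c *\<^sub>C x) = c *\<^sub>C T x)"

definition compact_op :: "('a::complex_hilbert_space \<Rightarrow> 'a) \<Rightarrow> bool" where
  "compact_op T \<longleftrightarrow> bounded_clinear T \<and> compact (closure (T ` cball 0 1))"

definition positive_op :: "('a::complex_hilbert_space \<Rightarrow> 'a) \<Rightarrow> bool" where
  "positive_op T \<longleftrightarrow> bounded_clinear T \<and> (\<forall>x. cinner x (T x) \<in> \<real> \<and> 0 \<le> Re (cinner x (T x)))"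

definition cadjoint :: "('a::complex_hilbert_space \<Rightarrow> 'a) \<Rightarrow> 'a \<Rightarrow> 'a" where
  "cadjoint T = (THE S. \<forall>x y. cinner (S x) y = cinner x (T y))"

text \<open>
  The singular values of a compact operator \<open>T\<close>: the square roots of the eigenvalues of \<open>T*T\<close>,
  each positive one repeated according to its multiplicity, in non-increasing order, padded with
  zeros if there are only finitely many. Convergence to \<open>0\<close> excludes constant tails at a positive
  value, whose infinite level set would have \<open>card\<close> equal to \<open>0\<close>.
\<close>

definition is_singular_values :: "('a::complex_hilbert_space \<Rightarrow> 'a) \<Rightarrow> (nat \<Rightarrow> real) \<Rightarrow> bool" where
  "is_singular_values T s \<longleftrightarrow>
     decseq s \<and> s \<longlonglongrightarrow> 0 \<and>
     (\<forall>\<sigma>>0. card {n. s n = \<sigma>} = cdim {x. cadjoint T (T x) = complex_of_real (\<sigma>\<^sup>2) *\<^sub>C x})"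

definition singular_value :: "nat \<Rightarrow> ('a::complex_hilbert_space \<Rightarrow> 'a) \<Rightarrow> real" where
  "singular_value n T = (THE s. is_singular_values T s) n"


definition weak_trace_class :: "('a::complex_hilbert_space \<Rightarrow> 'a) set" where
  "weak_trace_class =
     {T. compact_op T \<and> (\<lambda>n. singular_value n T) \<in> O(\<lambda>n. 1 / (real n + 1))}"

definition g_fun :: "nat \<Rightarrow> real \<Rightarrow> real" where
  "g_fun k t = real k ^ k / exp 1 ^ k * indicator {0..<exp 1 ^ k} t
             + ln t ^ k / t * indicator {exp 1 ^ k..} t"

definition G_fun :: "nat \<Rightarrow> real \<Rightarrow> real" where
  "G_fun k t = ln t ^ (k + 1) / (real k + 1)"

definition I_ideal :: "nat \<Rightarrow> ('a::complex_hilbert_space \<Rightarrow> 'a) set" where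
  "I_ideal k =
     {T. compact_op T \<and> (\<lambda>n. singular_value n T) \<in> O(\<lambda>n. g_fun k (real n))}"


text \<open>
  Positive linear functionals on the real space of bounded sequences that extend the limit. They
  are represented by total functions on all sequences, constrained only on the bounded ones.
\<close>

definition extended_limits :: "((nat \<Rightarrow> real) \<Rightarrow> real) set" where
  "extended_limits =
     {\<omega>. (\<forall>x y. Bseq x \<longrightarrow> Bseq y \<longrightarrow> \<omega> (\<lambda>n. x n + y n) = \<omega> x + \<omega> y) \<and>
         (\<forall>c x. Bseq x \<longrightarrow> \<omega> (\<lambda>n. c * x n) = c * \<omega> x) \<and>
         (\<forall>x. Bseq x \<longrightarrow> (\<forall>n. 0 \<le> x n) \<longrightarrow> 0 \<le> \<omega> x) \<and>
         (\<forall>x l. x \<longlonglongrightarrow> l \<longrightarrow> \<omega> x = l)}"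

text \<open>At \<open>n = 0\<close> the denominator vanishes and the term is \<open>0\<close> by convention; an extended limit does
  not depend on finitely many terms.\<close>

definition Tr_fun ::
    "nat \<Rightarrow> ((nat \<Rightarrow> real) \<Rightarrow> real) \<Rightarrow> ('a::complex_hilbert_space \<Rightarrow> 'a) \<Rightarrow> real" where
  "Tr_fun k \<omega> T = \<omega> (\<lambda>n. 1 / G_fun k (real n + 1) * (\<Sum>j=0..n. singular_value j T))"

definition linear_functional_on ::
    "('a::complex_hilbert_space \<Rightarrow> 'a) set \<Rightarrow> (('a \<Rightarrow> 'a) \<Rightarrow> complex) \<Rightarrow> bool" where
  "linear_functional_on I \<phi> \<longleftrightarrow>
     (\<forall>S\<in>I. \<forall>T\<in>I. \<phi> (\<lambda>x. S x + T x) = \<phi> S + \<phi> T) \<and>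
     (\<forall>c. \<forall>T\<in>I. \<phi> (\<lambda>x. c *\<^sub>C T x) = c * \<phi> T)"

text \<open>Functionals on the ideal are again total functions, unconstrained outside the ideal.\<close>

definition dixmier_traces :: "nat \<Rightarrow> (('a::complex_hilbert_space \<Rightarrow> 'a) \<Rightarrow> complex) set" where
  "dixmier_traces k =
     {\<phi>. linear_functional_on (I_ideal k) \<phi> \<and>
         (\<exists>\<omega>\<in>extended_limits. \<forall>T\<in>I_ideal k. positive_op T \<longrightarrow>
            \<phi> T = complex_of_real (Tr_fun k \<omega> T))}"

definition dixmier_measurable :: "nat \<Rightarrow> ('a::complex_hilbert_space \<Rightarrow> 'a) \<Rightarrow> bool" where
  "dixmier_measurable k T \<longleftrightarrow>
     T \<in> I_ideal k \<and> (\<forall>\<phi>\<in>dixmier_traces k. \<forall>\<psi>\<in>dixmier_traces k. \<phi> T = \<psi> T)"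


text \<open>
  \<open>hilbert_tensor_power k t\<close> says that the Hilbert space \<open>'b\<close>, with \<open>t x\<close> as the elementary tensor
  of \<open>x 0, \<dots>, x k\<close>, is the Hilbert space tensor product of \<open>k + 1\<close> copies of \<open>'a\<close>. This determines
  \<open>('b, t)\<close> up to a unique unitary. The inner product formula forces \<open>t x\<close> to depend only on
  \<open>x 0, \<dots>, x k\<close>, as recorded in the first clause, and to be multilinear, as recorded in the second
  and third.
\<close>

definition hilbert_tensor_power ::
    "nat \<Rightarrow> ((nat \<Rightarrow> 'a::complex_hilbert_space) \<Rightarrow> 'b::complex_hilbert_space) \<Rightarrow> bool" where
  "hilbert_tensor_power k t \<longleftrightarrow>
     (\<forall>x y. (\<forall>i\<le>k. x i = y i) \<longrightarrow> t x = t y) \<and>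
     (\<forall>x u v. \<forall>i\<le>k. t (x(i := u + v)) = t (x(i := u)) + t (x(i := v))) \<and>
     (\<forall>x c u. \<forall>i\<le>k. t (x(i := c *\<^sub>C u)) = c *\<^sub>C t (x(i := u))) \<and>
     (\<forall>x y. cinner (t x) (t y) = (\<Prod>i\<le>k. cinner (x i) (y i))) \<and>
     closure (cspan (range t)) = UNIV"

text \<open>The tensor product of the operators \<open>A 0, \<dots>, A k\<close>: the bounded operator acting factorwise on
  elementary tensors, which exists and is unique for bounded \<open>A i\<close>.\<close>

definition tensor_op ::
    "((nat \<Rightarrow> 'a::complex_hilbert_space) \<Rightarrow> 'b::complex_hilbert_space) \<Rightarrow>
     (nat \<Rightarrow> 'a \<Rightarrow> 'a) \<Rightarrow> 'b \<Rightarrow> 'b" where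
  "tensor_op t A = (THE B. bounded_clinear B \<and> (\<forall>x. B (t x) = t (\<lambda>i. A i (x i))))"

end

theory Submission
  imports Defs
begin

text \<open>
  The operators \<open>V\<^sub>i T\<^sub>i\<close> of the first claim are assumed to be Dixmier-measurable, so they lie in
  \<open>\<L>\<^bsub>1,\<infinity>\<^esub>\<close>, and the first claim is a case of the second. For the second, fix a Dixmier trace
  \<open>\<phi>\<close> on \<open>\<I>\<^sub>k\<close>, a slot \<open>i\<close>, and positive operators in the other slots, whose tensor product has
  singular values \<open>r\<^sub>q\<close>. If \<open>A \<ge> 0\<close> with singular values \<open>s\<^sub>p\<close> is put into slot \<open>i\<close>, the tensor
  product has singular values \<open>r\<^sub>q s\<^sub>p\<close>. Up to an error that is negligible against \<open>log\<^sup>k\<^sup>+\<^sup>1 n\<close>,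
  the sum of its first \<open>n\<close> singular values is the sum of those that exceed \<open>1/n\<close>, and
  \<open>\<Sum>\<^bsub>r\<^sub>q s\<^sub>p > 1/n\<^esub> r\<^sub>q s\<^sub>p = \<Sum>\<^sub>q r\<^sub>q \<Sum>\<^bsub>s\<^sub>p > 1/(n r\<^sub>q)\<^esub> s\<^sub>p\<close>.
  The inner sum is, up to a bounded error, the sum of the first \<open>n r\<^sub>q\<close> singular values of \<open>A\<close>.
  Hence the normalised partial sums of the tensor product are weighted averages, with weights that
  do not involve \<open>A\<close>, of the normalised partial sums of \<open>A\<close>
  (\<open>product_upper_sum_log_average\<close>). An extended limit composed with these averages is a multiple
  of an extended limit, because averages of a null sequence form a null sequence. So
  \<open>A \<mapsto> \<phi>(\<dots> \<otimes> A \<otimes> \<dots>)\<close> is a multiple of a Dixmier trace on \<open>\<L>\<^bsub>1,\<infinity>\<^esub>\<close>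
  (\<open>slot_dixmier_trace\<close>).

  Consequently a Dixmier-measurable \<open>A\<close> can be exchanged, at the price of a scalar factor that does
  not depend on \<open>\<phi>\<close>, for a fixed operator \<open>R\<close> on which all Dixmier traces agree and do not vanish.
  Every element of \<open>\<L>\<^bsub>1,\<infinity>\<^esub>\<close> is a linear combination of four positive ones, so by
  multilinearity the other slots need not be positive (\<open>slot_replacement\<close>). After all slots have
  been exchanged there remains \<open>\<phi>(R \<otimes> \<dots> \<otimes> R)\<close>. For \<open>R\<close> with eigenvalue \<open>2\<^bsup>-j\<^esup>\<close> of
  multiplicity \<open>2\<^sup>j\<close>, \<open>j \<ge> 0\<close>, the normalised partial sums converge, so this number is the same
  for all \<open>\<phi>\<close> (\<open>reference_operator\<close>).

  The operator theory behind this is organised around singular systems, that is, singular value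
  expansions \<open>T = \<Sum> s\<^sub>i \<langle>e\<^sub>i, \<cdot>\<rangle> f\<^sub>i\<close> over arbitrary index sets. A singular system determines
  the singular values, every compact operator has one, and singular systems of the factors multiply
  to one of the tensor product.
\<close>

section \<open>Complex inner products and bounded complex-linear operators\<close>

lemma cinner_add_right: "cinner x (y + z) = cinner x y + cinner x z"
  by (metis cinner_add_left cinner_commute complex_cnj_add)

lemma cinner_scaleC_right: "cinner x (c *\<^sub>C y) = c * cinner x y"
  by (metis cinner_commute cinner_scaleC_left complex_cnj_cnj complex_cnj_mult)

lemma cinner_self: "cinner x x = complex_of_real ((norm x)\<^sup>2)"
proof -
  have "Im (cinner x x) = 0"
    using cinner_commute[of x x] by (metis Im_complex_of_real Reals_cnj_iff complex_is_Real_iff)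
  moreover have "Re (cinner x x) = (norm x)\<^sup>2"
    using inner_eq_Re_cinner[of x x] by (simp add: power2_norm_eq_inner)
  ultimately show ?thesis by (simp add: complex_eq_iff)
qed

lemma of_real_cmod_square: "(complex_of_real (cmod z))\<^sup>2 = z * cnj z"
  using complex_norm_square[of z] by simp

lemma norm_scaleC: "norm (c *\<^sub>C (x::'a::complex_hilbert_space)) = cmod c * norm x"
proof -
  have "complex_of_real ((norm (c *\<^sub>C x))\<^sup>2) = complex_of_real ((cmod c * norm x)\<^sup>2)"
    unfolding cinner_self[symmetric] cinner_scaleC_left cinner_scaleC_right
    by (simp add: cinner_self power_mult_distrib of_real_cmod_square mult.commute mult.left_commute)
  then have "(norm (c *\<^sub>C x))\<^sup>2 = (cmod c * norm x)\<^sup>2" using of_real_eq_iff by blast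
  then show ?thesis by (simp add: power2_eq_iff_nonneg)
qed

text \<open>
  Multiplying \<open>y\<close> by a phase makes the complex inner product real, which reduces the claim to the
  real Cauchy-Schwarz inequality.
\<close>

lemma norm_cinner_le: "cmod (cinner x y) \<le> norm x * norm y"
proof (cases "cinner x y = 0")
  case False
  define u where "u = cnj (cinner x y) / cmod (cinner x y)"
  have u: "cmod u = 1" using False by (simp add: u_def norm_divide)
  have "cinner x (u *\<^sub>C y) = complex_of_real (cmod (cinner x y))"
    using False
    by (simp add: cinner_scaleC_right u_def mult.commute[of "cnj _"] of_real_cmod_square[symmetric] power2_eq_square)
  then have "cmod (cinner x y) = inner x (u *\<^sub>C y)" by (simp add: inner_eq_Re_cinner)
  also have "\<dots> \<le> norm x * norm (u *\<^sub>C y)" by (rule norm_cauchy_schwarz)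
  finally show ?thesis by (simp add: norm_scaleC u)
qed simp

lemma bounded_bilinear_cinner:
  "bounded_bilinear (cinner :: 'a::complex_hilbert_space \<Rightarrow> 'a \<Rightarrow> complex)"
proof
  fix a b c :: 'a and r :: real
  show "cinner (a + b) c = cinner a c + cinner b c" by (rule cinner_add_left)
  show "cinner a (b + c) = cinner a b + cinner a c" by (rule cinner_add_right)
  show "cinner (r *\<^sub>R a) b = r *\<^sub>R cinner a b"
    by (simp add: scaleC_of_real[symmetric] cinner_scaleC_left scaleR_conv_of_real)
  show "cinner a (r *\<^sub>R b) = r *\<^sub>R cinner a b"
    by (simp add: scaleC_of_real[symmetric] cinner_scaleC_right scaleR_conv_of_real)
  show "\<exists>K. \<forall>a b::'a. cmod (cinner a b) \<le> norm a * norm b * K"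
    by (rule exI[of _ 1]) (simp add: norm_cinner_le)
qed

interpretation cinner: bounded_bilinear
  "cinner :: 'a::complex_hilbert_space \<Rightarrow> 'a \<Rightarrow> complex"
  by (rule bounded_bilinear_cinner)

lemma bounded_bilinear_scaleC:
  "bounded_bilinear (scaleC :: complex \<Rightarrow> 'a \<Rightarrow> 'a::complex_hilbert_space)"
proof
  fix a b :: complex and x y :: 'a and r :: real
  show "(a + b) *\<^sub>C x = a *\<^sub>C x + b *\<^sub>C x" by (rule scaleC_add_left)
  show "a *\<^sub>C (x + y) = a *\<^sub>C x + a *\<^sub>C y" by (rule scaleC_add_right)
  show "(r *\<^sub>R a) *\<^sub>C x = r *\<^sub>R (a *\<^sub>C x)"
    by (simp add: scaleC_of_real[symmetric] scaleC_scaleC scaleR_conv_of_real)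
  show "a *\<^sub>C (r *\<^sub>R x) = r *\<^sub>R (a *\<^sub>C x)"
    by (simp add: scaleC_of_real[symmetric] scaleC_scaleC mult.commute)
  show "\<exists>K. \<forall>a. \<forall>x::'a. norm (a *\<^sub>C x) \<le> norm a * norm x * K"
    by (rule exI[of _ 1]) (simp add: norm_scaleC)
qed

interpretation scaleC: bounded_bilinear
  "scaleC :: complex \<Rightarrow> 'a \<Rightarrow> 'a::complex_hilbert_space"
  by (rule bounded_bilinear_scaleC)

lemma cinner_eq_zeroD: "(\<And>y. cinner y x = 0) \<Longrightarrow> x = 0"
  by (metis cinner_self norm_eq_zero of_real_eq_0_iff zero_eq_power2)

lemma cinner_extensionality: "(\<And>z. cinner z x = cinner z y) \<Longrightarrow> x = y"
  using cinner_eq_zeroD[of "x - y"] by (simp add: cinner.diff_right)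

lemma norm_diff_sq:
  "(norm (x - y))\<^sup>2 = (norm x)\<^sup>2 - 2 * Re (cinner x y) + (norm (y::'a::complex_hilbert_space))\<^sup>2"
  by (simp add: power2_norm_eq_inner inner_diff_left inner_diff_right inner_commute
      inner_eq_Re_cinner[symmetric])

lemma bounded_clinear_add: "bounded_clinear T \<Longrightarrow> T (x + y) = T x + T y"
  by (simp add: bounded_clinear_def bounded_linear.linear linear_add)

lemma bounded_clinear_diff: "bounded_clinear T \<Longrightarrow> T (x - y) = T x - T y"
  by (simp add: bounded_clinear_def bounded_linear.linear linear_diff)

lemma bounded_clinear_scaleC: "bounded_clinear T \<Longrightarrow> T (c *\<^sub>C x) = c *\<^sub>C T x"
  by (simp add: bounded_clinear_def)

lemma bounded_clinear_zero: "bounded_clinear T \<Longrightarrow> T 0 = 0"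
  by (simp add: bounded_clinear_def bounded_linear.linear linear_0)

lemma bounded_clinear_sum: "bounded_clinear T \<Longrightarrow> T (\<Sum>i\<in>F. g i) = (\<Sum>i\<in>F. T (g i))"
  by (simp add: bounded_clinear_def bounded_linear.linear linear_sum)

lemma bounded_clinear_bound:
  assumes "bounded_clinear T" obtains K where "K > 0" "\<And>x. norm (T x) \<le> K * norm x"
  using assms bounded_linear.pos_bounded[of T] by (auto simp: bounded_clinear_def mult.commute)

lemma bounded_clinearI:
  assumes "\<And>x y. T (x + y) = T x + T y" "\<And>c x. T (c *\<^sub>C x) = c *\<^sub>C T x"
    "\<And>x. norm (T x) \<le> K * norm x"
  shows "bounded_clinear T"
  unfolding bounded_clinear_def
proof
  show "bounded_linear T"
  proof (rule bounded_linear_intro[where K=K])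
    show "T (r *\<^sub>R x) = r *\<^sub>R T x" for r x
      using assms(2)[of "complex_of_real r" x] by (simp add: scaleC_of_real)
  qed (use assms in \<open>auto simp: mult.commute\<close>)
qed (use assms in simp)

lemma bounded_clinear_sum_op:
  assumes "bounded_clinear S" "bounded_clinear T"
  shows "bounded_clinear (\<lambda>x. S x + T x)"
  using assms by (auto simp: bounded_clinear_def bounded_linear_add scaleC_add_right)

lemma bounded_clinear_scale_op:
  assumes "bounded_clinear T"
  shows "bounded_clinear (\<lambda>x. c *\<^sub>C T x)"
  using assms scaleC.bounded_linear_right bounded_linear_compose
  by (fastforce simp: bounded_clinear_def scaleC_scaleC mult.commute)

section \<open>Singular systems\<close>

definition orthonormal_on :: "'i set \<Rightarrow> ('i \<Rightarrow> 'a::complex_hilbert_space) \<Rightarrow> bool" where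
  "orthonormal_on I e \<longleftrightarrow> (\<forall>i\<in>I. \<forall>j\<in>I. cinner (e i) (e j) = (if i = j then 1 else 0))"

text \<open>
  The positive weights of a singular value expansion: only finitely many of them lie above any
  positive level, so they can be listed in non-increasing order.
\<close>

definition vanishing_on :: "'i set \<Rightarrow> ('i \<Rightarrow> real) \<Rightarrow> bool" where
  "vanishing_on I s \<longleftrightarrow> (\<forall>i\<in>I. 0 < s i) \<and> (\<forall>\<epsilon>>0. finite {i\<in>I. \<epsilon> < s i})"

lemma vanishing_on_finite: "vanishing_on I s \<Longrightarrow> \<epsilon> > 0 \<Longrightarrow> finite {i\<in>I. \<epsilon> < s i}"
  by (simp add: vanishing_on_def)

text \<open>
  The inner product is linear in its second argument, so \<open>e\<close> is the family that is tested against
  and \<open>f\<close> the one that spans the range.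
\<close>

definition sv_sum :: "'i set \<Rightarrow> ('i \<Rightarrow> 'a) \<Rightarrow> ('i \<Rightarrow> 'a) \<Rightarrow> ('i \<Rightarrow> real) \<Rightarrow> 'a \<Rightarrow> 'a::complex_hilbert_space"
  where "sv_sum F e f s x = (\<Sum>i\<in>F. (complex_of_real (s i) * cinner (e i) x) *\<^sub>C f i)"

text \<open>
  The singular value expansion of \<open>T\<close>. Convergence of the series is expressed by truncation at a
  level \<open>\<epsilon>\<close> of the weights: the error is then at most \<open>\<epsilon>\<close> in operator norm. This form needs no
  enumeration of \<open>I\<close>, so it applies to the product index sets of tensor products.
\<close>

definition singular_system where
  "singular_system T I e f s \<longleftrightarrow>
     bounded_clinear T \<and> vanishing_on I s \<and> orthonormal_on I e \<and> orthonormal_on I f \<and>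
     (\<forall>\<epsilon>>0. \<forall>x. norm (T x - sv_sum {i\<in>I. \<epsilon> < s i} e f s x) \<le> \<epsilon> * norm x)"

lemma orthonormal_cinner_sum:
  assumes "orthonormal_on I e" "F \<subseteq> I" "finite F" "i \<in> I"
  shows "cinner (e i) (\<Sum>j\<in>F. c j *\<^sub>C e j) = (if i \<in> F then c i else 0)"
proof -
  have "cinner (e i) (\<Sum>j\<in>F. c j *\<^sub>C e j) = (\<Sum>j\<in>F. if i = j then c j else 0)"
    unfolding cinner.sum_right
    by (rule sum.cong) (use assms in \<open>auto simp: cinner_scaleC_right orthonormal_on_def\<close>)
  then show ?thesis using assms(3) by (simp add: sum.delta)
qed

lemma orthonormal_on_norm:
  assumes "orthonormal_on I e" "i \<in> I" shows "norm (e i) = 1"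
proof -
  have "complex_of_real ((norm (e i))\<^sup>2) = complex_of_real 1"
    unfolding cinner_self[symmetric] using assms by (simp add: orthonormal_on_def)
  then have "(norm (e i))\<^sup>2 = 1" using of_real_eq_iff by blast
  then show ?thesis using power2_eq_1_iff[of "norm (e i)"] norm_ge_zero[of "e i"] by linarith
qed

lemma orthonormal_norm_sum:
  assumes "orthonormal_on I e" "F \<subseteq> I" "finite F"
  shows "(norm (\<Sum>j\<in>F. c j *\<^sub>C e j))\<^sup>2 = (\<Sum>j\<in>F. (cmod (c j))\<^sup>2)"
proof -
  have "complex_of_real ((norm (\<Sum>j\<in>F. c j *\<^sub>C e j))\<^sup>2) =
     (\<Sum>i\<in>F. cnj (c i) * cinner (e i) (\<Sum>j\<in>F. c j *\<^sub>C e j))"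
    unfolding cinner_self[symmetric] by (subst cinner.sum_left) (simp add: cinner_scaleC_left)
  also have "\<dots> = (\<Sum>i\<in>F. complex_of_real ((cmod (c i))\<^sup>2))"
    by (rule sum.cong) (use assms orthonormal_cinner_sum[OF assms(1-3)] in
        \<open>auto simp: of_real_cmod_square mult.commute subset_iff\<close>)
  finally show ?thesis by (metis of_real_eq_iff of_real_sum)
qed

lemma orthonormal_residual:
  assumes "orthonormal_on I e" "F \<subseteq> I" "finite F"
  shows "(norm (x - (\<Sum>j\<in>F. cinner (e j) x *\<^sub>C e j)))\<^sup>2 = (norm x)\<^sup>2 - (\<Sum>j\<in>F. (cmod (cinner (e j) x))\<^sup>2)"
proof -
  have "cinner x (\<Sum>j\<in>F. cinner (e j) x *\<^sub>C e j) = (\<Sum>j\<in>F. complex_of_real ((cmod (cinner (e j) x))\<^sup>2))"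
    unfolding cinner.sum_right
    by (rule sum.cong) (auto simp: cinner_scaleC_right of_real_cmod_square cinner_commute[of x])
  then show ?thesis
    unfolding norm_diff_sq orthonormal_norm_sum[OF assms] by simp
qed

lemma bessel:
  assumes "orthonormal_on I e" "F \<subseteq> I" "finite F"
  shows "(\<Sum>j\<in>F. (cmod (cinner (e j) x))\<^sup>2) \<le> (norm x)\<^sup>2"
  using orthonormal_residual[OF assms, of x] by (smt (verit) zero_le_power2)

lemma norm_sv_sum:
  assumes "orthonormal_on I f" "F \<subseteq> I" "finite F"
  shows "(norm (sv_sum F e f s x))\<^sup>2 = (\<Sum>i\<in>F. (s i)\<^sup>2 * (cmod (cinner (e i) x))\<^sup>2)"
  unfolding sv_sum_def
  using orthonormal_norm_sum[OF assms, of "\<lambda>i. complex_of_real (s i) * cinner (e i) x"]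
  by (simp add: norm_mult power_mult_distrib)

lemma norm_sv_sum_le:
  assumes "orthonormal_on I e" "orthonormal_on I f" "F \<subseteq> I" "finite F"
    "\<And>i. i \<in> F \<Longrightarrow> \<bar>s i\<bar> \<le> c" "0 \<le> c"
  shows "norm (sv_sum F e f s x) \<le> c * norm x"
proof -
  have "(norm (sv_sum F e f s x))\<^sup>2 \<le> (\<Sum>i\<in>F. c\<^sup>2 * (cmod (cinner (e i) x))\<^sup>2)"
    unfolding norm_sv_sum[OF assms(2-4)]
    by (intro sum_mono mult_right_mono) (use assms in \<open>auto simp: abs_le_square_iff[symmetric]\<close>)
  also have "\<dots> \<le> c\<^sup>2 * (norm x)\<^sup>2"
    unfolding sum_distrib_left[symmetric] by (intro mult_left_mono bessel[OF assms(1,3,4)]) simp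
  finally have "(norm (sv_sum F e f s x))\<^sup>2 \<le> (c * norm x)\<^sup>2" by (simp add: power_mult_distrib)
  then show ?thesis using assms(6) by (simp add: power2_le_iff_abs_le abs_mult)
qed

lemma sv_sum_add: "sv_sum F e f s (x + y) = sv_sum F e f s x + sv_sum F e f s y"
  by (simp add: sv_sum_def cinner_add_right distrib_left scaleC_add_left sum.distrib)

lemma sv_sum_scaleC: "sv_sum F e f s (c *\<^sub>C x) = c *\<^sub>C sv_sum F e f s x"
  unfolding sv_sum_def cinner_scaleC_right scaleC.sum_right scaleC_scaleC
  by (simp only: mult.left_commute)

lemma sv_sum_diff_subset:
  "finite F \<Longrightarrow> G \<subseteq> F \<Longrightarrow> sv_sum F e f s x - sv_sum G e f s x = sv_sum (F - G) e f s x"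
  unfolding sv_sum_def by (subst sum.subset_diff[of G F]) auto

lemma vanishing_on_bounded:
  assumes "vanishing_on I s" obtains c where "c > 0" "\<And>i. i \<in> I \<Longrightarrow> s i \<le> c"
proof -
  define F where "F = {i\<in>I. 1 < s i}"
  have F: "finite F" using assms unfolding F_def by (rule vanishing_on_finite) simp
  show thesis
  proof (rule that[of "1 + (\<Sum>i\<in>F. s i)"])
    have nn: "\<And>i. i \<in> F \<Longrightarrow> 0 \<le> s i" using assms by (auto simp: F_def vanishing_on_def less_imp_le)
    then show "0 < 1 + sum s F" using sum_nonneg[of F s] by simp
    fix i assume i: "i \<in> I"
    show "s i \<le> 1 + sum s F"
    proof (cases "i \<in> F")
      case True
      then show ?thesis using member_le_sum[of i F s] nn F by auto
    next
      case False
      then show ?thesis using i nn sum_nonneg[of F s] by (auto simp: F_def)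
    qed
  qed
qed

text \<open>
  By Bessel's inequality a partial sum over weights that are at most \<open>\<epsilon>\<close> has norm at most \<open>\<epsilon>\<close>.
  So the truncations at the levels \<open>1/n\<close> converge uniformly on bounded sets. The operators obtained
  in this way include adjoints and tensor products, whose existence then needs no separate argument.
\<close>

lemma singular_system_exists:
  fixes e f :: "'i \<Rightarrow> 'a::complex_hilbert_space"
  assumes v: "vanishing_on I s" and e: "orthonormal_on I e" and f: "orthonormal_on I f"
  shows "\<exists>T. singular_system T I e f s"
proof -
  define F where "F \<epsilon> = {i\<in>I. \<epsilon> < s i}" for \<epsilon>
  have F: "finite (F \<epsilon>)" if "\<epsilon> > 0" for \<epsilon> using v that by (simp add: F_def vanishing_on_def)
  have close: "norm (sv_sum (F \<delta>) e f s x - sv_sum (F \<epsilon>) e f s x) \<le> \<epsilon> * norm x"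
    if "0 < \<delta>" "\<delta> \<le> \<epsilon>" for \<delta> \<epsilon> x
  proof -
    have "F \<epsilon> \<subseteq> F \<delta>" using that by (auto simp: F_def)
    then have "sv_sum (F \<delta>) e f s x - sv_sum (F \<epsilon>) e f s x = sv_sum (F \<delta> - F \<epsilon>) e f s x"
      using F that by (simp add: sv_sum_diff_subset)
    moreover have "norm (sv_sum (F \<delta> - F \<epsilon>) e f s x) \<le> \<epsilon> * norm x"
      by (rule norm_sv_sum_le[OF e f]) (use F[of \<delta>] that in \<open>auto simp: F_def\<close>)
    ultimately show ?thesis by simp
  qed
  define X where "X x n = sv_sum (F (1 / real (Suc n))) e f s x" for x n
  have "Cauchy (X x)" for x
  proof (rule metric_CauchyI)
    fix r :: real assume r: "r > 0"
    obtain N where N: "norm x / real (Suc N) < r"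
    proof -
      obtain N where "norm x / r < real N" using reals_Archimedean2 by blast
      then have "norm x < r * real N" using r by (simp add: pos_divide_less_eq mult.commute)
      also have "\<dots> \<le> r * real (Suc N)" using r by simp
      finally show thesis by (intro that) (simp add: pos_divide_less_eq)
    qed
    have "dist (X x m) (X x n) < r" if "m \<ge> n" "n \<ge> N" for m n
    proof -
      have "dist (X x m) (X x n) \<le> 1 / real (Suc n) * norm x"
        unfolding dist_norm X_def by (rule close) (use that in \<open>auto simp: frac_le\<close>)
      also have "\<dots> \<le> norm x / real (Suc N)" using that by (simp add: frac_le)
      finally show ?thesis using N by simp
    qed
    note D = this
    have "dist (X x m) (X x n) < r" if "m \<ge> N" "n \<ge> N" for m n
    proof (cases "n \<le> m")
      case False
      then show ?thesis using D[of m n] that by (simp add: dist_commute)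
    qed (use D[of n m] that in simp)
    then show "\<exists>M. \<forall>m\<ge>M. \<forall>n\<ge>M. dist (X x m) (X x n) < r" by blast
  qed
  then have conv: "X x \<longlonglongrightarrow> lim (X x)" for x
    by (simp add: Cauchy_convergent convergent_LIMSEQ_iff[symmetric])
  define T where "T x = lim (X x)" for x
  have lim: "X x \<longlonglongrightarrow> T x" for x unfolding T_def by (rule conv)
  have approx: "norm (T x - sv_sum (F \<epsilon>) e f s x) \<le> \<epsilon> * norm x" if \<epsilon>: "\<epsilon> > 0" for \<epsilon> x
  proof -
    obtain N where N: "1 / real (Suc N) < \<epsilon>" using nat_approx_posE[OF \<epsilon>] by metis
    have "norm (X x n - sv_sum (F \<epsilon>) e f s x) \<le> \<epsilon> * norm x" if "n \<ge> N" for n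
      unfolding X_def
    proof (rule close)
      have "1 / real (Suc n) \<le> 1 / real (Suc N)" using that by (simp add: frac_le)
      then show "1 / real (Suc n) \<le> \<epsilon>" using N by simp
    qed simp
    moreover have "(\<lambda>n. norm (X x n - sv_sum (F \<epsilon>) e f s x)) \<longlonglongrightarrow> norm (T x - sv_sum (F \<epsilon>) e f s x)"
      by (intro tendsto_intros lim)
    ultimately show ?thesis by (meson LIMSEQ_le_const2)
  qed
  obtain c where c: "c > 0" "\<And>i. i \<in> I \<Longrightarrow> s i \<le> c" using v vanishing_on_bounded by blast
  have "bounded_clinear T"
  proof (rule bounded_clinearI)
    fix x y
    have "X (x + y) = (\<lambda>n. X x n + X y n)" by (simp add: X_def sv_sum_add fun_eq_iff)
    then have "X (x + y) \<longlonglongrightarrow> T x + T y" by (simp add: lim tendsto_add)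
    then show "T (x + y) = T x + T y" using lim LIMSEQ_unique by blast
  next
    fix a x
    have "X (a *\<^sub>C x) = (\<lambda>n. a *\<^sub>C X x n)" by (simp add: X_def sv_sum_scaleC fun_eq_iff)
    then have "X (a *\<^sub>C x) \<longlonglongrightarrow> a *\<^sub>C T x" by (simp add: lim scaleC.tendsto tendsto_const)
    then show "T (a *\<^sub>C x) = a *\<^sub>C T x" using lim LIMSEQ_unique by blast
  next
    fix x
    have "F c = {}" using c by (auto simp: F_def not_less)
    then show "norm (T x) \<le> c * norm x" using approx[OF c(1), of x] by (simp add: sv_sum_def)
  qed
  then have "singular_system T I e f s"
    using assms approx by (simp add: singular_system_def F_def)
  then show ?thesis by (rule exI[of _ T])
qed

text \<open>
  Turns the estimates with an arbitrary truncation level into exact identities.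
\<close>

lemma le_of_le_all_pos:
  fixes a b K :: real
  assumes "0 < d" "\<And>\<epsilon>. 0 < \<epsilon> \<Longrightarrow> \<epsilon> < d \<Longrightarrow> a \<le> \<epsilon> * K"
  shows "a \<le> 0"
proof (rule ccontr)
  assume "\<not> a \<le> 0"
  then have a: "a > 0" by simp
  define \<epsilon> where "\<epsilon> = min (d/2) (a / (2 * (\<bar>K\<bar> + 1)))"
  have "\<epsilon> > 0" "\<epsilon> < d" using a assms(1) by (auto simp: \<epsilon>_def)
  then have "a \<le> \<epsilon> * K" using assms by blast
  also have "\<dots> \<le> \<epsilon> * (\<bar>K\<bar> + 1)" using \<open>\<epsilon> > 0\<close> by (intro mult_left_mono) auto
  also have "\<dots> \<le> a / (2 * (\<bar>K\<bar> + 1)) * (\<bar>K\<bar> + 1)" unfolding \<epsilon>_def by (intro mult_right_mono) auto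
  also have "\<dots> = a / 2" by (simp add: field_simps)
  finally show False using a by simp
qed

lemma singular_system_cinner_right:
  assumes S: "singular_system T I e f s" and i: "i \<in> I"
  shows "cinner (f i) (T x) = complex_of_real (s i) * cinner (e i) x"
proof -
  have si: "0 < s i" using S i by (auto simp: singular_system_def vanishing_on_def)
  have "cmod (cinner (f i) (T x) - complex_of_real (s i) * cinner (e i) x) \<le> \<epsilon> * norm x"
    if \<epsilon>: "0 < \<epsilon>" "\<epsilon> < s i" for \<epsilon>
  proof -
    define F where "F = {i\<in>I. \<epsilon> < s i}"
    have F: "finite F" "F \<subseteq> I" "i \<in> F" using S \<epsilon> i by (auto simp: singular_system_def vanishing_on_def F_def)
    have f: "orthonormal_on I f" using S by (simp add: singular_system_def)
    have fi: "norm (f i) = 1" using f i by (rule orthonormal_on_norm)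
    have "cinner (f i) (sv_sum F e f s x) = complex_of_real (s i) * cinner (e i) x"
      unfolding sv_sum_def using orthonormal_cinner_sum[OF f F(2,1) i] F(3) by simp
    then have "cinner (f i) (T x) - complex_of_real (s i) * cinner (e i) x = cinner (f i) (T x - sv_sum F e f s x)"
      by (simp add: cinner.diff_right)
    then have "cmod (cinner (f i) (T x) - complex_of_real (s i) * cinner (e i) x) \<le> norm (T x - sv_sum F e f s x)"
      using norm_cinner_le[of "f i"] fi by simp
    also have "\<dots> \<le> \<epsilon> * norm x" using S \<epsilon> by (simp add: singular_system_def F_def)
    finally show ?thesis .
  qed
  then have "cmod (cinner (f i) (T x) - complex_of_real (s i) * cinner (e i) x) \<le> 0"
    by (rule le_of_le_all_pos[OF si])
  then show ?thesis by simp
qed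

lemma singular_system_orthogonal_bound:
  assumes S: "singular_system T I e f s" and "\<epsilon> > 0" "\<And>i. i \<in> I \<Longrightarrow> \<epsilon> < s i \<Longrightarrow> cinner (e i) x = 0"
  shows "norm (T x) \<le> \<epsilon> * norm x"
proof -
  have "sv_sum {i\<in>I. \<epsilon> < s i} e f s x = 0" using assms(3) by (simp add: sv_sum_def)
  then show ?thesis using S assms(2) unfolding singular_system_def by (metis diff_zero)
qed

lemma singular_system_apply:
  assumes S: "singular_system T I e f s" and i: "i \<in> I"
  shows "T (e i) = complex_of_real (s i) *\<^sub>C f i"
proof -
  have si: "0 < s i" using S i by (auto simp: singular_system_def vanishing_on_def)
  have "norm (T (e i) - complex_of_real (s i) *\<^sub>C f i) \<le> \<epsilon> * norm (e i)"
    if \<epsilon>: "0 < \<epsilon>" "\<epsilon> < s i" for \<epsilon>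
  proof -
    define F where "F = {i\<in>I. \<epsilon> < s i}"
    have F: "finite F" "F \<subseteq> I" "i \<in> F" using S \<epsilon> i by (auto simp: singular_system_def vanishing_on_def F_def)
    have "sv_sum F e f s (e i) = (\<Sum>j\<in>F. if j = i then complex_of_real (s i) *\<^sub>C f i else 0)"
      unfolding sv_sum_def
      by (rule sum.cong) (use S i F in \<open>auto simp: singular_system_def orthonormal_on_def subset_iff\<close>)
    also have "\<dots> = complex_of_real (s i) *\<^sub>C f i" using F by simp
    finally show ?thesis using S \<epsilon> unfolding singular_system_def F_def by metis
  qed
  then have "norm (T (e i) - complex_of_real (s i) *\<^sub>C f i) \<le> 0"
    by (rule le_of_le_all_pos[OF si])
  then show ?thesis by simp
qed

lemma sv_sum_adjoint: "cinner (sv_sum F f e s x) y = cinner x (sv_sum F e f s y)"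
  unfolding sv_sum_def cinner.sum_left cinner.sum_right cinner_scaleC_left cinner_scaleC_right
  by (rule sum.cong) (simp_all add: cinner_commute[of x "f _"])

text \<open>
  Exchanging the two orthonormal families of a singular system gives the adjoint, because it does so
  for every finite partial sum.
\<close>

lemma singular_system_adjoint:
  assumes S: "singular_system T I e f s" and R: "singular_system R I f e s"
  shows "cinner (R x) y = cinner x (T y)"
proof -
  have "cmod (cinner (R x) y - cinner x (T y)) \<le> \<epsilon> * (2 * norm x * norm y)" if "0 < \<epsilon>" for \<epsilon>
  proof -
    define F where "F = {i\<in>I. \<epsilon> < s i}"
    have "cinner (R x) y - cinner x (T y) =
       cinner (R x - sv_sum F f e s x) y - cinner x (T y - sv_sum F e f s y)"
      by (simp add: cinner.diff_left cinner.diff_right sv_sum_adjoint)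
    also have "cmod \<dots> \<le> norm (R x - sv_sum F f e s x) * norm y + norm x * norm (T y - sv_sum F e f s y)"
      by (meson norm_triangle_ineq4 norm_cinner_le add_mono order_trans)
    also have "\<dots> \<le> (\<epsilon> * norm x) * norm y + norm x * (\<epsilon> * norm y)"
      using S R that by (intro add_mono mult_left_mono mult_right_mono) (auto simp: singular_system_def F_def)
    finally show ?thesis by (simp add: algebra_simps)
  qed
  then have "cmod (cinner (R x) y - cinner x (T y)) \<le> 0"
    using le_of_le_all_pos[OF zero_less_one] by blast
  then show ?thesis by simp
qed

lemma cadjoint_eqI:
  assumes "\<And>x y. cinner (R x) y = cinner x (T y)"
  shows "cadjoint T = R"
  unfolding cadjoint_def
proof (rule the_equality)
  show "\<forall>x y. cinner (R x) y = cinner x (T y)" using assms by blast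
  fix Q assume "\<forall>x y. cinner (Q x) y = cinner x (T y)"
  then have "cinner y (Q x) = cinner y (R x)" for x y
    using assms by (metis cinner_commute)
  then show "Q = R" using cinner_extensionality by blast
qed

section \<open>Singular values from a singular system\<close>

lemma orthonormal_inj_on: "orthonormal_on I e \<Longrightarrow> inj_on e I"
  unfolding orthonormal_on_def inj_on_def by (metis zero_neq_one)

lemma orthonormal_independent:
  fixes e :: "'i \<Rightarrow> 'a::complex_hilbert_space"
  assumes e: "orthonormal_on I e" and F: "F \<subseteq> I" "finite F"
  shows "complex_vector.independent (e ` F)"
proof (rule complex_vector.independent_if_scalars_zero)
  show "finite (e ` F)" using F by simp
  fix g x assume 0: "(\<Sum>y\<in>e ` F. g y *\<^sub>C y) = 0" and x: "x \<in> e ` F"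
  obtain i where i: "i \<in> F" "x = e i" using x by blast
  have inj: "inj_on e F" using orthonormal_inj_on[OF e] F(1) inj_on_subset by blast
  have "(\<Sum>j\<in>F. g (e j) *\<^sub>C e j) = 0" using 0 by (simp add: sum.reindex[OF inj])
  moreover have "cinner (e i) (\<Sum>j\<in>F. g (e j) *\<^sub>C e j) = g (e i)"
    using orthonormal_cinner_sum[OF e F, of i "\<lambda>j. g (e j)"] i F by auto
  ultimately show "g x = 0" using i by (simp add: cinner.zero_right)
qed

lemma finite_level_set:
  assumes "vanishing_on I s" "\<sigma> > 0"
  shows "finite {i\<in>I. s i = \<sigma>}"
  by (rule finite_subset[OF _ vanishing_on_finite[OF assms(1), of "\<sigma>/2"]]) (use assms in auto)

text \<open>
  On the span of the \<open>e\<^sub>i\<close> the operator \<open>T*T\<close> is diagonal with entries \<open>s\<^sub>i\<^sup>2\<close>. Given an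
  eigenvector for \<open>\<sigma>\<^sup>2\<close>, subtract its projection to the span of the \<open>e\<^sub>i\<close> with \<open>s\<^sub>i = \<sigma>\<close>: the
  rest is again an eigenvector and is orthogonal to all \<open>e\<^sub>i\<close>, so it is annihilated by \<open>T\<close> and
  must be \<open>0\<close>.
\<close>

lemma eigenspace_dim:
  fixes T :: "'a::complex_hilbert_space \<Rightarrow> 'a"
  assumes S: "singular_system T I e f s" and \<sigma>: "\<sigma> > 0"
  shows "cdim {x. cadjoint T (T x) = complex_of_real (\<sigma>\<^sup>2) *\<^sub>C x} = card {i\<in>I. s i = \<sigma>}"
proof -
  have e: "orthonormal_on I e" and f: "orthonormal_on I f" and v: "vanishing_on I s"
    and T: "bounded_clinear T" using S by (auto simp: singular_system_def)
  obtain R where R: "singular_system R I f e s" using singular_system_exists[OF v f e] by blast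
  have RT: "cinner (R x) y = cinner x (T y)" for x y by (rule singular_system_adjoint[OF S R])
  have adj: "cadjoint T = R" by (rule cadjoint_eqI) (rule RT)
  have Rlin: "bounded_clinear R" using R by (simp add: singular_system_def)
  define E where "E = {x. R (T x) = complex_of_real (\<sigma>\<^sup>2) *\<^sub>C x}"
  define J where "J = {i\<in>I. s i = \<sigma>}"
  have J: "finite J" "J \<subseteq> I" using finite_level_set[OF v \<sigma>] by (auto simp: J_def)
  have eig: "R (T (e i)) = complex_of_real ((s i)\<^sup>2) *\<^sub>C e i" if "i \<in> I" for i
    using singular_system_apply[OF S that] singular_system_apply[OF R that]
    by (simp add: bounded_clinear_scaleC[OF Rlin] scaleC_scaleC power2_eq_square)
  have orth: "cinner (e i) x = 0" if "x \<in> E" "i \<in> I" "s i \<noteq> \<sigma>" for x i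
  proof -
    have "complex_of_real (\<sigma>\<^sup>2) * cinner (e i) x = cinner (e i) (R (T x))"
      using that(1) by (simp add: E_def cinner_scaleC_right)
    also have "\<dots> = complex_of_real (s i) * cinner (f i) (T x)"
      by (rule singular_system_cinner_right[OF R that(2)])
    also have "\<dots> = complex_of_real ((s i)\<^sup>2) * cinner (e i) x"
      using singular_system_cinner_right[OF S that(2)] by (simp add: power2_eq_square)
    finally have "complex_of_real (\<sigma>\<^sup>2) = complex_of_real ((s i)\<^sup>2) \<or> cinner (e i) x = 0"
      by (metis mult_cancel_right)
    moreover have "s i > 0" using v that(2) by (simp add: vanishing_on_def)
    ultimately show ?thesis using that(3) \<sigma>
      by (metis of_real_eq_iff power2_eq_iff_nonneg less_imp_le)
  qed
  have sub: "E \<subseteq> cspan (e ` J)"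
  proof
    fix x assume x: "x \<in> E"
    define p where "p = (\<Sum>i\<in>J. cinner (e i) x *\<^sub>C e i)"
    define z where "z = x - p"
    have "R (T p) = complex_of_real (\<sigma>\<^sup>2) *\<^sub>C p"
      unfolding p_def bounded_clinear_sum[OF T] bounded_clinear_sum[OF Rlin] scaleC.sum_right
      using eig J by (intro sum.cong)
        (auto simp: bounded_clinear_scaleC[OF T] bounded_clinear_scaleC[OF Rlin] scaleC_scaleC J_def mult.commute)
    then have z: "R (T z) = complex_of_real (\<sigma>\<^sup>2) *\<^sub>C z"
      using x by (simp add: z_def E_def bounded_clinear_diff[OF T] bounded_clinear_diff[OF Rlin] scaleC.diff_right)
    have "cinner (e i) z = 0" if "i \<in> I" for i
    proof (cases "i \<in> J")
      case True
      then show ?thesis using orthonormal_cinner_sum[OF e J(2,1) that, of "\<lambda>i. cinner (e i) x"]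
        by (simp add: z_def p_def cinner.diff_right)
    next
      case False
      then have "s i \<noteq> \<sigma>" using that by (simp add: J_def)
      then show ?thesis using orth[of z i] z that by (simp add: E_def)
    qed
    then have "norm (T z) \<le> \<epsilon> * norm z" if "\<epsilon> > 0" for \<epsilon>
      using singular_system_orthogonal_bound[OF S that] by blast
    then have "norm (T z) \<le> 0" using le_of_le_all_pos[OF zero_less_one] by blast
    then have "R (T z) = 0" by (simp add: bounded_clinear_zero[OF Rlin])
    then have "complex_of_real (\<sigma>\<^sup>2) *\<^sub>C z = 0" using z by simp
    then have "z = 0" using norm_scaleC[of "complex_of_real (\<sigma>\<^sup>2)" z] \<sigma> by simp
    then have "x = p" by (simp add: z_def)
    moreover have "p \<in> cspan (e ` J)" unfolding p_def
      by (intro complex_vector.span_sum complex_vector.span_scale complex_vector.span_base) auto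
    ultimately show "x \<in> cspan (e ` J)" by simp
  qed
  have "e ` J \<subseteq> E" using eig J by (auto simp: E_def J_def)
  then have "card (e ` J) = cdim E"
    using complex_vector.basis_card_eq_dim sub orthonormal_independent[OF e J(2,1)] by blast
  moreover have "card (e ` J) = card J"
    using orthonormal_inj_on[OF e] J(2) card_image inj_on_subset by blast
  ultimately show ?thesis by (simp add: adj E_def J_def)
qed

definition upper_count :: "'i set \<Rightarrow> ('i \<Rightarrow> real) \<Rightarrow> real \<Rightarrow> nat" where
  "upper_count I s \<epsilon> = card {i\<in>I. \<epsilon> < s i}"

lemma upper_count_antimono:
  "vanishing_on I s \<Longrightarrow> 0 < \<delta> \<Longrightarrow> \<delta> \<le> \<epsilon> \<Longrightarrow> upper_count I s \<epsilon> \<le> upper_count I s \<delta>"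
  unfolding upper_count_def by (rule card_mono) (auto simp: vanishing_on_finite)

text \<open>
  The sequence \<open>\<mu>\<close> is the decreasing rearrangement of the weights \<open>s\<close>, padded with zeros. The
  condition on level sets has the same shape as the one that defines singular values.
\<close>

definition same_level_counts :: "'i set \<Rightarrow> ('i \<Rightarrow> real) \<Rightarrow> (nat \<Rightarrow> real) \<Rightarrow> bool" where
  "same_level_counts I s \<mu> \<longleftrightarrow> decseq \<mu> \<and> \<mu> \<longlonglongrightarrow> 0 \<and> (\<forall>\<sigma>>0. card {n. \<mu> n = \<sigma>} = card {i\<in>I. s i = \<sigma>})"

lemma decseq_null_nonneg:
  fixes \<mu> :: "nat \<Rightarrow> real" assumes "decseq \<mu>" "\<mu> \<longlonglongrightarrow> 0" shows "0 \<le> \<mu> n"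
  using decseq_ge[OF assms] .

lemma decseq_null_finite:
  fixes \<mu> :: "nat \<Rightarrow> real" assumes "\<mu> \<longlonglongrightarrow> 0" "\<epsilon> > 0" shows "finite {n. \<epsilon> < \<mu> n}"
proof -
  have "eventually (\<lambda>n. \<mu> n < \<epsilon>) sequentially" using assms order_tendstoD(2) by blast
  then obtain N where "\<And>n. n \<ge> N \<Longrightarrow> \<mu> n < \<epsilon>" by (auto simp: eventually_sequentially)
  then have "{n. \<epsilon> < \<mu> n} \<subseteq> {..<N}" by (force simp: not_less[symmetric])
  then show ?thesis using finite_subset by blast
qed

lemma same_level_counts_bij:
  assumes s: "vanishing_on I s" and m: "same_level_counts I s \<mu>"
  obtains h where "bij_betw h {n. 0 < \<mu> n} I" "\<And>n. 0 < \<mu> n \<Longrightarrow> s (h n) = \<mu> n"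
proof -
  have ex: "\<exists>h. bij_betw h {n. \<mu> n = \<sigma>} {i\<in>I. s i = \<sigma>}" if "\<sigma> > 0" for \<sigma>
  proof (rule finite_same_card_bij)
    have \<mu>: "decseq \<mu>" "\<mu> \<longlonglongrightarrow> 0" using m by (auto simp: same_level_counts_def)
    show "finite {n. \<mu> n = \<sigma>}"
      by (rule finite_subset[OF _ decseq_null_finite[OF \<mu>(2), of "\<sigma>/2"]]) (use that in auto)
    show "finite {i\<in>I. s i = \<sigma>}" by (rule finite_level_set[OF s that])
    show "card {n. \<mu> n = \<sigma>} = card {i\<in>I. s i = \<sigma>}" using m that by (simp add: same_level_counts_def)
  qed
  then obtain H where H: "\<And>\<sigma>. \<sigma> > 0 \<Longrightarrow> bij_betw (H \<sigma>) {n. \<mu> n = \<sigma>} {i\<in>I. s i = \<sigma>}" by metis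
  define h where "h n = H (\<mu> n) n" for n
  have h: "h n \<in> I \<and> s (h n) = \<mu> n" if "0 < \<mu> n" for n
    using bij_betwE[OF H[OF that]] by (simp add: h_def)
  have "bij_betw h {n. 0 < \<mu> n} I"
  proof (rule bij_betw_imageI)
    show "inj_on h {n. 0 < \<mu> n}"
    proof (rule inj_onI)
      fix m n assume mn: "m \<in> {n. 0 < \<mu> n}" "n \<in> {n. 0 < \<mu> n}" "h m = h n"
      then have "\<mu> m = \<mu> n" using h by (metis mem_Collect_eq)
      moreover have "inj_on (H (\<mu> m)) {k. \<mu> k = \<mu> m}" using H mn bij_betw_imp_inj_on by auto
      ultimately show "m = n" using mn by (auto simp: h_def dest: inj_onD)
    qed
    show "h ` {n. 0 < \<mu> n} = I"
    proof
      show "I \<subseteq> h ` {n. 0 < \<mu> n}"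
      proof
        fix i assume i: "i \<in> I"
        then have si: "s i > 0" using s by (simp add: vanishing_on_def)
        then have "i \<in> H (s i) ` {n. \<mu> n = s i}" using bij_betw_imp_surj_on[OF H[OF si]] i by simp
        then obtain n where "\<mu> n = s i" "i = H (s i) n" by blast
        then show "i \<in> h ` {n. 0 < \<mu> n}" using si by (auto simp: h_def intro!: image_eqI[of _ _ n])
      qed
    qed (use h in auto)
  qed
  then show thesis using h that by blast
qed

lemma decseq_upper_set:
  fixes \<mu> :: "nat \<Rightarrow> real"
  assumes "decseq \<mu>" "\<mu> \<longlonglongrightarrow> 0" "\<epsilon> > 0"
  shows "{n. \<epsilon> < \<mu> n} = {..<card {n. \<epsilon> < \<mu> n}}"
proof -
  have fin: "finite {n. \<epsilon> < \<mu> n}" by (rule decseq_null_finite[OF assms(2,3)])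
  define N where "N = (LEAST n. \<not> \<epsilon> < \<mu> n)"
  have ex: "\<exists>n. \<not> \<epsilon> < \<mu> n" using fin by (metis (mono_tags, lifting) Collect_cong UNIV_def infinite_UNIV_nat)
  have "{n. \<epsilon> < \<mu> n} = {..<N}"
  proof (intro equalityI subsetI)
    fix n assume n: "n \<in> {n. \<epsilon> < \<mu> n}"
    have "\<not> \<epsilon> < \<mu> N" unfolding N_def using LeastI_ex[OF ex] .
    then have "\<not> N \<le> n" using assms(1) n by (auto dest: decseqD[of \<mu> N n])
    then show "n \<in> {..<N}" by simp
  qed (auto simp: N_def dest: not_less_Least)
  then show ?thesis by simp
qed

text \<open>
  Converts bounds on the counting function into bounds on the rearranged sequence and back.
\<close>

lemma same_level_counts_upper:
  assumes s: "vanishing_on I s" and m: "same_level_counts I s \<mu>" and "\<epsilon> > 0"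
  shows "\<epsilon> < \<mu> n \<longleftrightarrow> n < upper_count I s \<epsilon>"
proof -
  obtain h where h: "bij_betw h {n. 0 < \<mu> n} I" "\<And>n. 0 < \<mu> n \<Longrightarrow> s (h n) = \<mu> n"
    using same_level_counts_bij[OF s m] by blast
  have "bij_betw h {n. \<epsilon> < \<mu> n} {i\<in>I. \<epsilon> < s i}"
  proof (rule bij_betw_subset[OF h(1)])
    show "h ` {n. \<epsilon> < \<mu> n} = {i\<in>I. \<epsilon> < s i}"
    proof (intro equalityI subsetI)
      fix i assume i: "i \<in> {i\<in>I. \<epsilon> < s i}"
      then obtain n where "0 < \<mu> n" "i = h n" using bij_betw_imp_surj_on[OF h(1)] by blast
      then show "i \<in> h ` {n. \<epsilon> < \<mu> n}" using i h(2) by auto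
    qed (use h assms(3) bij_betwE[OF h(1)] in auto)
  qed (use assms(3) in auto)
  then have "card {n. \<epsilon> < \<mu> n} = upper_count I s \<epsilon>" by (simp add: upper_count_def bij_betw_same_card)
  moreover have "{n. \<epsilon> < \<mu> n} = {..<card {n. \<epsilon> < \<mu> n}}"
    using m assms(3) by (intro decseq_upper_set) (auto simp: same_level_counts_def)
  ultimately show ?thesis by (metis lessThan_iff mem_Collect_eq)
qed

lemma nonneg_eqI_upper:
  fixes a b :: real
  assumes "0 \<le> a" "0 \<le> b" "\<And>\<epsilon>. \<epsilon> > 0 \<Longrightarrow> \<epsilon> < a \<longleftrightarrow> \<epsilon> < b"
  shows "a = b"
proof (rule ccontr)
  assume "a \<noteq> b"
  then consider "a < b" | "b < a" by linarith
  then show False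
  proof cases
    case 1
    then show False using assms(3)[of "(a+b)/2"] assms(1,2) by auto
  next
    case 2
    then show False using assms(3)[of "(a+b)/2"] assms(1,2) by auto
  qed
qed

lemma same_level_counts_unique:
  assumes s: "vanishing_on I s" and m: "same_level_counts I s \<mu>" "same_level_counts I s \<nu>"
  shows "\<mu> = \<nu>"
proof
  fix n show "\<mu> n = \<nu> n"
    using m same_level_counts_upper[OF s m(1)] same_level_counts_upper[OF s m(2)]
    by (intro nonneg_eqI_upper) (auto simp: same_level_counts_def decseq_null_nonneg)
qed

text \<open>
  The rearrangement is the generalised inverse of the counting function,
  \<open>\<mu>\<^sub>n = inf {\<epsilon> > 0. N \<epsilon> \<le> n}\<close>. The counting function is a right-continuous step function, so
  \<open>\<epsilon> < \<mu>\<^sub>n\<close> holds exactly if \<open>n < N \<epsilon>\<close>, and the multiplicity of a value \<open>\<sigma>\<close> is the jump of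
  \<open>N\<close> at \<open>\<sigma>\<close>.
\<close>

lemma same_level_counts_exists:
  assumes s: "vanishing_on I s"
  shows "\<exists>\<mu>. same_level_counts I s \<mu>"
proof -
  define N where "N = upper_count I s"
  obtain c where c: "c > 0" "\<And>i. i \<in> I \<Longrightarrow> s i \<le> c" using vanishing_on_bounded[OF s] by blast
  have Nc: "N c = 0" using c by (auto simp: N_def upper_count_def card_eq_0_iff not_less)
  define A where "A n = {\<epsilon>. 0 < \<epsilon> \<and> N \<epsilon> \<le> n}" for n
  define \<mu> where "\<mu> n = Inf (A n)" for n
  have ne: "A n \<noteq> {}" for n using c(1) Nc by (auto simp: A_def)
  have bd: "bdd_below (A n)" for n by (rule bdd_belowI[of _ 0]) (auto simp: A_def)
  have nn: "0 \<le> \<mu> n" for n unfolding \<mu>_def by (rule cInf_greatest[OF ne]) (auto simp: A_def)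
  have step: "\<exists>\<delta>>\<epsilon>. N \<delta> = N \<epsilon>" if "\<epsilon> > 0" for \<epsilon>
  proof -
    define F where "F = {i\<in>I. \<epsilon> < s i}"
    have F: "finite F" using s that by (simp add: F_def vanishing_on_def)
    define m where "m = Min (insert (\<epsilon> + 1) (s ` F))"
    have m: "\<epsilon> < m" "\<And>i. i \<in> F \<Longrightarrow> m \<le> s i" using F by (auto simp: m_def F_def)
    define \<delta> where "\<delta> = (\<epsilon> + m) / 2"
    have \<delta>: "\<epsilon> < \<delta>" "\<delta> < m" using m by (auto simp: \<delta>_def)
    have "{i\<in>I. \<delta> < s i} = F" using \<delta> m(2) by (force simp: F_def)
    then show ?thesis using \<delta> by (auto simp: N_def upper_count_def F_def)
  qed
  have up: "\<epsilon> < \<mu> n \<longleftrightarrow> n < N \<epsilon>" if \<epsilon>: "\<epsilon> > 0" for \<epsilon> n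
  proof
    assume "\<epsilon> < \<mu> n"
    then have "\<epsilon> \<notin> A n" using cInf_lower[OF _ bd, of \<epsilon> n] by (auto simp: \<mu>_def)
    then show "n < N \<epsilon>" using \<epsilon> by (simp add: A_def)
  next
    assume n: "n < N \<epsilon>"
    obtain \<delta> where \<delta>: "\<epsilon> < \<delta>" "N \<delta> = N \<epsilon>" using step[OF \<epsilon>] by blast
    have "\<delta> \<le> \<mu> n" unfolding \<mu>_def
    proof (rule cInf_greatest[OF ne])
      fix x assume "x \<in> A n"
      then have x: "0 < x" "N x < N \<delta>" using n \<delta> by (auto simp: A_def)
      then have "\<not> x \<le> \<delta>" using upper_count_antimono[OF s, of x \<delta>] by (auto simp: N_def)
      then show "\<delta> \<le> x" by simp
    qed
    then show "\<epsilon> < \<mu> n" using \<delta> by simp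
  qed
  have "decseq \<mu>"
    unfolding decseq_def
  proof (intro allI impI)
    fix m n :: nat assume "m \<le> n"
    then have "A m \<subseteq> A n" by (auto simp: A_def)
    then show "\<mu> n \<le> \<mu> m" unfolding \<mu>_def by (rule cInf_superset_mono[OF ne bd])
  qed
  moreover have "\<mu> \<longlonglongrightarrow> 0"
  proof (rule LIMSEQ_I)
    fix r :: real assume r: "r > 0"
    have "norm (\<mu> n - 0) < r" if "n \<ge> N (r/2)" for n
      using up[of "r/2" n] that nn[of n] r by auto
    then show "\<exists>no. \<forall>n\<ge>no. norm (\<mu> n - 0) < r" by blast
  qed
  moreover have "card {n. \<mu> n = \<sigma>} = card {i\<in>I. s i = \<sigma>}" if \<sigma>: "\<sigma> > 0" for \<sigma>
  proof -
    \<comment> \<open>below \<open>\<sigma>\<close> there is a gap \<open>(d, \<sigma>)\<close> without weights\<close>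
    define F where "F = {i\<in>I. \<sigma>/2 < s i}"
    have F: "finite F" using vanishing_on_finite[OF s, of "\<sigma>/2"] \<sigma> unfolding F_def by linarith
    define m where "m = Max (insert (\<sigma>/2) (s ` {i\<in>F. s i < \<sigma>}))"
    have "\<sigma>/2 \<le> m" unfolding m_def by (rule Max_ge) (use F in auto)
    moreover have "m < \<sigma>" using F \<sigma> by (auto simp: m_def)
    moreover have "s i \<le> m" if "i \<in> F" "s i < \<sigma>" for i
      unfolding m_def by (rule Max_ge) (use F that in auto)
    ultimately have m: "\<sigma>/2 \<le> m" "m < \<sigma>" "\<And>i. i \<in> F \<Longrightarrow> s i < \<sigma> \<Longrightarrow> s i \<le> m" by auto
    define d where "d = (m + \<sigma>) / 2"
    have d: "0 < d" "d < \<sigma>" "\<sigma>/2 < d" "m < d" using m \<sigma> by (auto simp: d_def)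
    have gap: "\<epsilon> < s i \<longleftrightarrow> \<sigma> \<le> s i" if "d \<le> \<epsilon>" "\<epsilon> < \<sigma>" "i \<in> I" for i \<epsilon>
      using d that m(3)[of i] by (force simp: F_def)
    have Nd: "N \<epsilon> = N d" if "d \<le> \<epsilon>" "\<epsilon> < \<sigma>" for \<epsilon>
    proof -
      have "{i\<in>I. \<epsilon> < s i} = {i\<in>I. d < s i}" using gap d that by auto
      then show ?thesis by (simp add: N_def upper_count_def)
    qed
    have "{n. \<mu> n = \<sigma>} = {N \<sigma>..<N d}"
    proof (intro equalityI subsetI)
      fix n assume "n \<in> {n. \<mu> n = \<sigma>}"
      then show "n \<in> {N \<sigma>..<N d}" using up[of \<sigma> n] up[of d n] d \<sigma> by auto
    next
      fix n assume n: "n \<in> {N \<sigma>..<N d}"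
      have "\<not> \<sigma> < \<mu> n" using n up[OF \<sigma>, of n] by auto
      moreover have "\<not> \<mu> n < \<sigma>"
      proof
        assume lt: "\<mu> n < \<sigma>"
        define \<epsilon> where "\<epsilon> = max d (\<mu> n)"
        have \<epsilon>: "0 < \<epsilon>" "d \<le> \<epsilon>" "\<epsilon> < \<sigma>" using d lt by (auto simp: \<epsilon>_def)
        have "\<epsilon> < \<mu> n" using up[OF \<epsilon>(1), of n] n Nd[OF \<epsilon>(2,3)] by simp
        then show False by (simp add: \<epsilon>_def)
      qed
      ultimately show "n \<in> {n. \<mu> n = \<sigma>}" by simp
    qed
    moreover have "{i\<in>I. s i = \<sigma>} = {i\<in>I. d < s i} - {i\<in>I. \<sigma> < s i}" using gap[of d] d by auto
    moreover have "card ({i\<in>I. d < s i} - {i\<in>I. \<sigma> < s i}) = N d - N \<sigma>"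
      unfolding N_def upper_count_def
      by (rule card_Diff_subset) (use d \<sigma> s in \<open>auto simp: vanishing_on_def\<close>)
    ultimately show ?thesis by simp
  qed
  ultimately have "same_level_counts I s \<mu>" by (simp add: same_level_counts_def)
  then show ?thesis by blast
qed

text \<open>
  Since rearrangements exist and are unique, the definite description in the definition of singular
  values denotes the rearrangement of the weights of any singular system.
\<close>

lemma singular_system_singular_value:
  assumes S: "singular_system T I e f s"
  shows "same_level_counts I s (\<lambda>n. singular_value n T)"
proof -
  have s: "vanishing_on I s" using S by (simp add: singular_system_def)
  have eq: "is_singular_values T = same_level_counts I s"
    by (rule ext) (simp add: is_singular_values_def same_level_counts_def eigenspace_dim[OF S]
        del: of_real_power)
  obtain \<mu> where \<mu>: "same_level_counts I s \<mu>" using same_level_counts_exists[OF s] by blast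
  then have "(THE m. is_singular_values T m) = \<mu>"
    unfolding eq using same_level_counts_unique[OF s] by blast
  then show ?thesis using \<mu> by (simp add: singular_value_def)
qed

section \<open>Compact operators have singular systems\<close>

lemma compact_op_subseq:
  assumes T: "compact_op T" and b: "\<And>n. norm (x n) \<le> 1"
  obtains r l where "strict_mono (r :: nat \<Rightarrow> nat)" "(\<lambda>n. T (x (r n))) \<longlonglongrightarrow> l"
proof -
  have "compact (closure (T ` cball 0 1))" using T by (simp add: compact_op_def)
  then have "(\<forall>n. T (x n) \<in> closure (T ` cball 0 1)) \<longrightarrow>
      (\<exists>l\<in>closure (T ` cball 0 1). \<exists>r. strict_mono r \<and> ((\<lambda>n. T (x n)) \<circ> r) \<longlonglongrightarrow> l)"
    unfolding compact_def by (rule spec)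
  moreover have "\<forall>n. T (x n) \<in> closure (T ` cball 0 1)"
    using b by (auto intro!: closure_subset[THEN subsetD])
  ultimately obtain l r where "strict_mono (r :: nat \<Rightarrow> nat)" "((\<lambda>n. T (x n)) \<circ> r) \<longlonglongrightarrow> l"
    by blast
  then show thesis using that by (simp add: o_def)
qed

lemma parallelogram:
  fixes x y :: "'a::real_inner"
  shows "(norm (x - y))\<^sup>2 = 2 * (norm x)\<^sup>2 + 2 * (norm y)\<^sup>2 - (norm (x + y))\<^sup>2"
  by (simp add: power2_norm_eq_inner inner_diff_left inner_diff_right inner_add_left inner_add_right inner_commute)

text \<open>
  Let \<open>m\<close> be the norm of the restriction of \<open>T\<close> to \<open>M\<close>, and \<open>z\<^sub>n\<close> unit vectors with
  \<open>T z\<^sub>n \<longlonglongrightarrow> l\<close> and \<open>\<parallel>l\<parallel> = m\<close>. For large \<open>p, q\<close> the norm of \<open>T (z\<^sub>p + z\<^sub>q)\<close> is almost \<open>2 m\<close>,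
  so \<open>\<parallel>z\<^sub>p + z\<^sub>q\<parallel>\<close> is almost \<open>2\<close>, and by the parallelogram law \<open>\<parallel>z\<^sub>p - z\<^sub>q\<parallel>\<close> is small. Thus
  \<open>z\<^sub>n\<close> itself converges, without any use of the adjoint of \<open>T\<close>.
\<close>

lemma compact_op_attains_norm:
  assumes T: "compact_op T" and M: "closed M"
    and add: "\<And>x y. x \<in> M \<Longrightarrow> y \<in> M \<Longrightarrow> x + y \<in> M"
    and sc: "\<And>c x. x \<in> M \<Longrightarrow> c *\<^sub>C x \<in> M"
    and w: "w \<in> M" "T w \<noteq> 0"
  obtains y where "y \<in> M" "norm y = 1" "T y \<noteq> 0" "\<And>x. x \<in> M \<Longrightarrow> norm (T x) \<le> norm (T y) * norm x"
proof -
  have lin: "bounded_clinear T" using T by (simp add: compact_op_def)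
  obtain K where K: "K > 0" "\<And>x. norm (T x) \<le> K * norm x" using bounded_clinear_bound[OF lin] by blast
  define A where "A = {norm (T x) | x. x \<in> M \<and> norm x = 1}"
  define m where "m = Sup A"
  have bd: "bdd_above A"
  proof (rule bdd_aboveI)
    fix a assume "a \<in> A"
    then obtain x where "a = norm (T x)" "norm x = 1" by (auto simp: A_def)
    then show "a \<le> K" using K(2)[of x] by simp
  qed
  have nrm: "norm (T x) \<le> m * norm x" if x: "x \<in> M" for x
  proof (cases "x = 0")
    case False
    define u where "u = complex_of_real (1 / norm x) *\<^sub>C x"
    have "u \<in> M" "norm u = 1" using x sc False by (auto simp: u_def norm_scaleC norm_divide)
    then have "norm (T u) \<le> m" unfolding m_def by (intro cSup_upper bd) (auto simp: A_def)
    moreover have "norm (T u) = norm (T x) / norm x"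
      using False by (simp add: u_def bounded_clinear_scaleC[OF lin] norm_scaleC norm_divide)
    ultimately show ?thesis using False by (simp add: pos_divide_le_eq)
  qed (simp add: bounded_clinear_zero[OF lin])
  have "0 < norm (T w)" using w by simp
  also have "\<dots> \<le> m * norm w" by (rule nrm[OF w(1)])
  finally have wm: "0 < m * norm w" .
  then have m0: "m > 0" by (simp add: zero_less_mult_iff)
  have w0: "w \<noteq> 0" using wm by auto
  have ne: "A \<noteq> {}"
  proof -
    have "complex_of_real (1 / norm w) *\<^sub>C w \<in> M" "norm (complex_of_real (1 / norm w) *\<^sub>C w) = 1"
      using w w0 sc by (auto simp: norm_scaleC norm_divide)
    then show ?thesis by (auto simp: A_def)
  qed
  have "\<exists>x. x \<in> M \<and> norm x = 1 \<and> m - 1 / real (Suc n) < norm (T x)" for n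
  proof -
    have "m - 1 / real (Suc n) < Sup A" by (simp add: m_def)
    then obtain a where "a \<in> A" "m - 1 / real (Suc n) < a" using less_cSup_iff[OF ne bd] by blast
    then show ?thesis by (auto simp: A_def)
  qed
  then obtain x where x: "\<And>n. x n \<in> M" "\<And>n. norm (x n) = 1" "\<And>n. m - 1 / real (Suc n) < norm (T (x n))"
    by metis
  obtain r l where r: "strict_mono (r :: nat \<Rightarrow> nat)" "(\<lambda>n. T (x (r n))) \<longlonglongrightarrow> l"
    using compact_op_subseq[OF T, of x] x(2) by (metis order_refl)
  define z where "z n = x (r n)" for n
  have z: "\<And>n. z n \<in> M" "\<And>n. norm (z n) = 1" using x by (auto simp: z_def)
  have Tz: "(\<lambda>n. T (z n)) \<longlonglongrightarrow> l" using r by (simp add: z_def)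
  have "(\<lambda>n. norm (T (x n))) \<longlonglongrightarrow> m"
  proof (rule tendsto_sandwich[of "\<lambda>n. m - 1 / real (Suc n)" _ _ "\<lambda>_. m"])
    show "(\<lambda>n. m - 1 / real (Suc n)) \<longlonglongrightarrow> m"
      using tendsto_diff[OF tendsto_const[of m] LIMSEQ_inverse_real_of_nat] by (simp add: inverse_eq_divide)
    show "\<forall>\<^sub>F n in sequentially. norm (T (x n)) \<le> m" using nrm x(1,2) by (metis (mono_tags, lifting) always_eventually mult.right_neutral)
  qed (use x(3) in \<open>auto intro: always_eventually less_imp_le\<close>)
  then have "(\<lambda>n. norm (T (z n))) \<longlonglongrightarrow> m"
    using LIMSEQ_subseq_LIMSEQ[OF _ r(1)] by (fastforce simp: z_def o_def)
  then have l: "norm l = m" using tendsto_norm[OF Tz] LIMSEQ_unique by blast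
  have "Cauchy z"
  proof (rule metric_CauchyI)
    fix \<epsilon> :: real assume \<epsilon>: "\<epsilon> > 0"
    have lim: "\<exists>N. \<forall>n\<ge>N. dist (T (z n)) l < d" if "d > 0" for d
      using Tz that by (simp add: lim_sequentially)
    \<comment> \<open>the choice of \<open>d\<close> makes the parallelogram law give \<open>\<parallel>z\<^sub>p - z\<^sub>q\<parallel>\<^sup>2 < \<epsilon>\<^sup>2\<close> below\<close>
    define d where "d = min m (\<epsilon>\<^sup>2 * m / 8)"
    have d: "d > 0" "d \<le> m" "d \<le> \<epsilon>\<^sup>2 * m / 8" using m0 \<epsilon> by (auto simp: d_def)
    obtain N where N: "\<And>n. n \<ge> N \<Longrightarrow> dist (T (z n)) l < d" using lim[OF d(1)] by blast
    have "dist (z p) (z q) < \<epsilon>" if "p \<ge> N" "q \<ge> N" for p q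
    proof -
      have "norm (2 *\<^sub>R l) - norm (2 *\<^sub>R l - (T (z p) + T (z q))) \<le> norm (T (z p) + T (z q))"
      proof -
        have "norm (2 *\<^sub>R l) - norm (2 *\<^sub>R l - w) \<le> norm w" for w
          using norm_triangle_ineq2[of "2 *\<^sub>R l" "2 *\<^sub>R l - w"] by simp
        then show ?thesis .
      qed
      moreover have "norm (2 *\<^sub>R l - (T (z p) + T (z q))) < 2 * d"
      proof -
        have "2 *\<^sub>R l - (T (z p) + T (z q)) = (l - T (z p)) + (l - T (z q))" by (simp add: scaleR_2)
        then have "norm (2 *\<^sub>R l - (T (z p) + T (z q))) \<le> norm (l - T (z p)) + norm (l - T (z q))"
          by (metis norm_triangle_ineq)
        then show ?thesis using N[OF that(1)] N[OF that(2)] by (simp add: dist_norm norm_minus_commute)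
      qed
      ultimately have "2 * m - 2 * d < norm (T (z p) + T (z q))" using l by simp
      also have "\<dots> = norm (T (z p + z q))" by (simp add: bounded_clinear_add[OF lin])
      also have "\<dots> \<le> m * norm (z p + z q)" by (rule nrm) (simp add: add z)
      finally have lt: "2 * (m - d) < m * norm (z p + z q)" by simp
      then have "2 * (1 - d / m) < norm (z p + z q)" using m0 by (simp add: field_simps)
      moreover have "d / m \<le> \<epsilon>\<^sup>2 / 8" "d / m \<le> 1" using d m0 by (auto simp: field_simps)
      ultimately have "2 * (1 - d/m) < norm (z p + z q)" "0 \<le> 2 * (1 - d / m)" by auto
      then have "(2 * (1 - d/m))\<^sup>2 < (norm (z p + z q))\<^sup>2" by (intro power_strict_mono) auto
      moreover have "4 - 8 * (d/m) \<le> (2 * (1 - d/m))\<^sup>2" by (simp add: power2_eq_square algebra_simps)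
      ultimately have "(norm (z p - z q))\<^sup>2 < \<epsilon>\<^sup>2"
        using \<open>d / m \<le> \<epsilon>\<^sup>2 / 8\<close> by (simp add: parallelogram z(2))
      then show ?thesis using \<epsilon> by (simp add: dist_norm power2_less_imp_less)
    qed
    then show "\<exists>M. \<forall>p\<ge>M. \<forall>q\<ge>M. dist (z p) (z q) < \<epsilon>" by blast
  qed
  then obtain y where y: "z \<longlonglongrightarrow> y" using Cauchy_convergent convergent_def by blast
  have yM: "y \<in> M" using closed_sequentially[OF M _ y] z by blast
  have ny: "norm y = 1"
    using tendsto_norm[OF y] z(2) by (simp add: LIMSEQ_const_iff)
  have "(\<lambda>n. T (z n)) \<longlonglongrightarrow> T y" using y lin by (simp add: bounded_clinear_def bounded_linear.tendsto)
  then have "T y = l" using Tz LIMSEQ_unique by blast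
  then have "norm (T y) = m" using l by simp
  then show thesis using that[of y] yM ny nrm m0 by auto
qed

text \<open>
  The form \<open>\<parallel>T y\<parallel>\<^sup>2 \<parallel>x\<parallel>\<^sup>2 - \<parallel>T x\<parallel>\<^sup>2\<close> is non-negative for \<open>x\<close> in \<open>M\<close> and vanishes at \<open>y\<close>, so its
  first variation at \<open>y\<close> vanishes in every direction \<open>v\<close> of \<open>M\<close>.
\<close>

lemma maximizer_is_singular_vector:
  fixes T :: "'a::complex_hilbert_space \<Rightarrow> 'a"
  assumes lin: "bounded_clinear T"
    and add: "\<And>x y. x \<in> M \<Longrightarrow> y \<in> M \<Longrightarrow> x + y \<in> M"
    and sc: "\<And>c x. x \<in> M \<Longrightarrow> c *\<^sub>C x \<in> M"
    and y: "y \<in> M" "norm y = 1" "\<And>x. x \<in> M \<Longrightarrow> norm (T x) \<le> norm (T y) * norm x"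
    and v: "v \<in> M"
  shows "cinner (T y) (T v) = complex_of_real ((norm (T y))\<^sup>2) * cinner y v"
proof -
  define m where "m = norm (T y)"
  define q where "q = complex_of_real (m\<^sup>2) * cinner y v - cinner (T y) (T v)"
  define Q where "Q = m\<^sup>2 * (norm v)\<^sup>2 - (norm (T v))\<^sup>2"
  have ineq: "2 * Re (c * q) + (cmod c)\<^sup>2 * Q \<ge> 0" for c
  proof -
    have "norm (T (y + c *\<^sub>C v)) \<le> m * norm (y + c *\<^sub>C v)"
      unfolding m_def by (rule y(3)) (simp add: add sc y(1) v)
    then have "(norm (T (y + c *\<^sub>C v)))\<^sup>2 \<le> (m * norm (y + c *\<^sub>C v))\<^sup>2" by (rule power_mono) simp
    moreover have ex: "(norm (a + c *\<^sub>C b))\<^sup>2 = (norm a)\<^sup>2 + 2 * Re (c * cinner a b) + (cmod c)\<^sup>2 * (norm b)\<^sup>2"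
      for a b :: 'a
      using norm_diff_sq[of a "(- c) *\<^sub>C b"] by (simp add: norm_scaleC cinner_scaleC_right power_mult_distrib scaleC.minus_left cinner.minus_right)
    ultimately have "m\<^sup>2 + 2 * Re (c * cinner (T y) (T v)) + (cmod c)\<^sup>2 * (norm (T v))\<^sup>2
       \<le> m\<^sup>2 * (1 + 2 * Re (c * cinner y v) + (cmod c)\<^sup>2 * (norm v)\<^sup>2)"
      by (simp add: bounded_clinear_add[OF lin] bounded_clinear_scaleC[OF lin] ex power_mult_distrib y(2) flip: m_def)
    moreover have "Re (c * q) = m\<^sup>2 * Re (c * cinner y v) - Re (c * cinner (T y) (T v))"
      by (simp add: q_def algebra_simps del: of_real_power)
    ultimately show ?thesis by (simp add: Q_def algebra_simps)
  qed
  \<comment> \<open>the variation in the direction \<open>- \<epsilon> q\<^sup>* v\<close> shows that \<open>q\<close> vanishes\<close>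
  have "2 * (cmod q)\<^sup>2 \<le> \<epsilon> * ((cmod q)\<^sup>2 * Q)" if "\<epsilon> > 0" for \<epsilon>
  proof -
    have "0 \<le> 2 * Re (- complex_of_real \<epsilon> * cnj q * q) + (cmod (- complex_of_real \<epsilon> * cnj q))\<^sup>2 * Q" by (rule ineq)
    moreover have "- complex_of_real \<epsilon> * cnj q * q = - complex_of_real (\<epsilon> * (cmod q)\<^sup>2)"
      by (simp add: of_real_cmod_square mult.commute mult.left_commute)
    ultimately have "0 \<le> 2 * (- (\<epsilon> * (cmod q)\<^sup>2)) + (cmod (- complex_of_real \<epsilon> * cnj q))\<^sup>2 * Q"
      by (metis Re_complex_of_real of_real_minus)
    then have "0 \<le> \<epsilon> * (- 2 * (cmod q)\<^sup>2 + \<epsilon> * ((cmod q)\<^sup>2 * Q))"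
      by (simp add: norm_mult power_mult_distrib power2_eq_square[of \<epsilon>] algebra_simps)
    then show ?thesis using that by (simp add: zero_le_mult_iff)
  qed
  then have "2 * (cmod q)\<^sup>2 \<le> 0" by (rule le_of_le_all_pos[OF zero_less_one])
  then show ?thesis by (simp add: q_def m_def)
qed

text \<open>
  Unit eigenvectors of \<open>T*T\<close> for a positive eigenvalue, in a form that does not mention the
  adjoint.
\<close>

definition singular_vector :: "('a::complex_hilbert_space \<Rightarrow> 'a) \<Rightarrow> 'a \<Rightarrow> bool" where
  "singular_vector T b \<longleftrightarrow> norm b = 1 \<and> T b \<noteq> 0 \<and>
     (\<forall>x. cinner (T b) (T x) = complex_of_real ((norm (T b))\<^sup>2) * cinner b x)"

lemma maximal_singular_vectors:
  obtains B where "orthonormal_on B (\<lambda>b. b)" "\<And>b. b \<in> B \<Longrightarrow> singular_vector T b"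
    "\<And>y. singular_vector T y \<Longrightarrow> \<exists>b\<in>B. cinner b y \<noteq> 0"
proof -
  define \<A> where "\<A> = {B. orthonormal_on B (\<lambda>b. b) \<and> (\<forall>b\<in>B. singular_vector T b)}"
  have "\<exists>M\<in>\<A>. \<forall>X\<in>\<A>. M \<subseteq> X \<longrightarrow> X = M"
  proof (rule subset_Zorn')
    fix C assume C: "subset.chain \<A> C"
    have "orthonormal_on (\<Union>C) (\<lambda>b. b)"
      unfolding orthonormal_on_def
    proof (intro ballI)
      fix i j assume "i \<in> \<Union>C" "j \<in> \<Union>C"
      then obtain X Y where XY: "X \<in> C" "Y \<in> C" "i \<in> X" "j \<in> Y" by blast
      then have "X \<subseteq> Y \<or> Y \<subseteq> X" using C by (meson subset_chain_def)
      then obtain Z where "Z \<in> C" "i \<in> Z" "j \<in> Z" using XY by blast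
      then show "cinner i j = (if i = j then 1 else 0)"
        using C by (auto simp: subset_chain_def \<A>_def orthonormal_on_def)
    qed
    then show "\<Union>C \<in> \<A>" using C by (auto simp: subset_chain_def \<A>_def)
  qed
  then obtain B where B: "B \<in> \<A>" "\<And>X. X \<in> \<A> \<Longrightarrow> B \<subseteq> X \<Longrightarrow> X = B" by blast
  show thesis
  proof (rule that[of B])
    fix y assume y: "singular_vector T y"
    show "\<exists>b\<in>B. cinner b y \<noteq> 0"
    proof (rule ccontr)
      assume "\<not> (\<exists>b\<in>B. cinner b y \<noteq> 0)"
      then have o: "\<And>b. b \<in> B \<Longrightarrow> cinner b y = 0" by blast
      have yy: "cinner y y = 1" using y by (simp add: cinner_self singular_vector_def)
      have "cinner y b = 0" if "b \<in> B" for b using o[OF that] cinner_commute[of y b] by simp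
      then have "insert y B \<in> \<A>" using B(1) y yy o by (auto simp: \<A>_def orthonormal_on_def)
      then have "y \<in> B" using B(2)[of "insert y B"] by blast
      then show False using o yy by force
    qed
  qed (use B(1) in \<open>auto simp: \<A>_def\<close>)
qed

text \<open>
  Take a maximal orthonormal set \<open>B\<close> of singular vectors, with weights \<open>\<parallel>T b\<parallel>\<close>. If the truncation
  at level \<open>\<epsilon>\<close> had an error larger than \<open>\<epsilon>\<close>, then \<open>T\<close> would have norm larger than \<open>\<epsilon>\<close> on the
  orthogonal complement \<open>M\<close> of the vectors of weight above \<open>\<epsilon>\<close>. A vector at which this norm is
  attained is a singular vector. It is orthogonal to the vectors of weight above \<open>\<epsilon>\<close> by its choice
  and to the others because it belongs to a different eigenvalue, which contradicts the maximality
  of \<open>B\<close>.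
\<close>

lemma compact_op_has_singular_system:
  fixes T :: "'a::complex_hilbert_space \<Rightarrow> 'a"
  assumes T: "compact_op T"
  shows "\<exists>(I::'a set) e f s. singular_system T I e f s"
proof -
  have lin: "bounded_clinear T" using T by (simp add: compact_op_def)
  obtain B where B: "orthonormal_on B (\<lambda>b. b)" "\<And>b. b \<in> B \<Longrightarrow> singular_vector T b"
    "\<And>y. singular_vector T y \<Longrightarrow> \<exists>b\<in>B. cinner b y \<noteq> 0"
    using maximal_singular_vectors[of T] by blast
  define s where "s b = norm (T b)" for b
  define f where "f b = complex_of_real (1 / s b) *\<^sub>C T b" for b
  have spos: "s b > 0" if "b \<in> B" for b using B(2)[OF that] by (simp add: s_def singular_vector_def)
  have sv: "cinner (T b) (T x) = complex_of_real ((s b)\<^sup>2) * cinner b x" if "b \<in> B" for b x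
    using B(2)[OF that] by (simp add: s_def singular_vector_def)
  \<comment> \<open>infinitely many images \<open>T b\<close> of norm above \<open>\<epsilon>\<close>, being pairwise orthogonal, would have no convergent subsequence\<close>
  have fin: "finite {b\<in>B. \<epsilon> < s b}" if \<epsilon>: "\<epsilon> > 0" for \<epsilon>
  proof (rule ccontr)
    assume inf: "infinite {b\<in>B. \<epsilon> < s b}"
    then obtain b :: "nat \<Rightarrow> 'a" where b: "inj b" "range b \<subseteq> {b\<in>B. \<epsilon> < s b}"
      using infinite_countable_subset by blast
    have bB: "b n \<in> B" "\<epsilon> < s (b n)" for n using b(2) by auto
    have "norm (b n) \<le> 1" for n using orthonormal_on_norm[OF B(1) bB(1)] by simp
    then obtain r l where r: "strict_mono (r :: nat \<Rightarrow> nat)" "(\<lambda>n. T (b (r n))) \<longlonglongrightarrow> l"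
      using compact_op_subseq[OF T, of b] by blast
    have "Cauchy (\<lambda>n. T (b (r n)))" using r(2) by (rule LIMSEQ_imp_Cauchy)
    then obtain N where N: "\<And>m n. m \<ge> N \<Longrightarrow> n \<ge> N \<Longrightarrow> dist (T (b (r m))) (T (b (r n))) < \<epsilon>"
      using \<epsilon> unfolding Cauchy_def by blast
    define p q where "p = b (r N)" and "q = b (r (Suc N))"
    have "p \<noteq> q" using b(1) r(1) by (auto simp: p_def q_def inj_eq strict_mono_eq)
    then have "cinner p q = 0" using B(1) bB by (auto simp: orthonormal_on_def p_def q_def)
    then have "cinner (T p) (T q) = 0" using sv bB by (simp add: p_def)
    then have "(norm (T p - T q))\<^sup>2 = (s p)\<^sup>2 + (s q)\<^sup>2" by (simp add: norm_diff_sq s_def)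
    moreover have "\<epsilon>\<^sup>2 < (s p)\<^sup>2" using bB[of "r N"] \<epsilon> by (simp add: p_def power_strict_mono)
    ultimately have "\<epsilon>\<^sup>2 < (norm (T p - T q))\<^sup>2" using zero_le_power2[of "s q"] by linarith
    then have "\<epsilon> < norm (T p - T q)" by (rule power2_less_imp_less) simp
    then show False using N[of N "Suc N"] by (simp add: p_def q_def dist_norm)
  qed
  have v: "vanishing_on B s" using spos fin by (simp add: vanishing_on_def)
  have f: "orthonormal_on B f"
    unfolding orthonormal_on_def
  proof (intro ballI)
    fix i j assume ij: "i \<in> B" "j \<in> B"
    have "cinner (f i) (f j) = complex_of_real (1 / s i) * complex_of_real (1 / s j) * (complex_of_real ((s i)\<^sup>2) * cinner i j)"
      using sv ij by (simp add: f_def cinner_scaleC_left cinner_scaleC_right)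
    then show "cinner (f i) (f j) = (if i = j then 1 else 0)"
      using B(1) ij spos[OF ij(1)] by (auto simp: orthonormal_on_def power2_eq_square)
  qed
  have bound: "norm (T y) \<le> \<epsilon> * norm y" if \<epsilon>: "\<epsilon> > 0" and y: "\<And>b. b \<in> B \<Longrightarrow> \<epsilon> < s b \<Longrightarrow> cinner b y = 0" for y \<epsilon>
  proof (rule ccontr)
    assume neg: "\<not> norm (T y) \<le> \<epsilon> * norm y"
    define M where "M = {y. \<forall>b\<in>{b\<in>B. \<epsilon> < s b}. cinner b y = 0}"
    have add: "x \<in> M \<Longrightarrow> z \<in> M \<Longrightarrow> x + z \<in> M" for x z by (simp add: M_def cinner_add_right)
    have sc: "x \<in> M \<Longrightarrow> c *\<^sub>C x \<in> M" for c x by (simp add: M_def cinner_scaleC_right)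
    have "M = (\<Inter>b\<in>{b\<in>B. \<epsilon> < s b}. {y. cinner b y = 0})" by (auto simp: M_def)
    moreover have "closed {y. cinner b y = 0}" for b :: 'a
      by (intro closed_Collect_eq continuous_intros cinner.continuous_on)
    ultimately have cl: "closed M" by auto
    have yM: "y \<in> M" "T y \<noteq> 0"
    proof -
      show "y \<in> M" using y by (simp add: M_def)
      have "0 \<le> \<epsilon> * norm y" using \<epsilon> by simp
      then show "T y \<noteq> 0" using neg by force
    qed
    obtain u where u: "u \<in> M" "norm u = 1" "T u \<noteq> 0" "\<And>x. x \<in> M \<Longrightarrow> norm (T x) \<le> norm (T u) * norm x"
      using compact_op_attains_norm[OF T cl add sc yM] by blast
    have big: "\<epsilon> < norm (T u)"
    proof (rule ccontr)
      assume "\<not> \<epsilon> < norm (T u)"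
      then have "norm (T u) * norm y \<le> \<epsilon> * norm y" by (intro mult_right_mono) auto
      then show False using u(4)[OF yM(1)] neg by simp
    qed
    have max: "cinner (T u) (T v) = complex_of_real ((norm (T u))\<^sup>2) * cinner u v" if "v \<in> M" for v
      by (rule maximizer_is_singular_vector[OF lin add sc u(1,2,4) that])
    define F where "F = {b\<in>B. \<epsilon> < s b}"
    have F: "finite F" "F \<subseteq> B" using fin[OF \<epsilon>] by (auto simp: F_def)
    have uF: "cinner b u = 0" if "b \<in> F" for b using u(1) that by (simp add: M_def F_def)
    have uF': "cinner u b = 0" if "b \<in> F" for b using uF[OF that] cinner_commute[of u b] by simp
    have TuF: "cinner (T u) (T b) = 0" if "b \<in> F" for b
      using sv[of b u] uF[OF that] that F cinner_commute[of "T u" "T b"] by auto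
    have sing: "cinner (T u) (T x) = complex_of_real ((norm (T u))\<^sup>2) * cinner u x" for x
    proof -
      define p where "p = (\<Sum>b\<in>F. cinner b x *\<^sub>C b)"
      have "x - p \<in> M"
        using orthonormal_cinner_sum[OF B(1) F(2,1), of _ "\<lambda>b. cinner b x"] F
        by (auto simp: M_def p_def cinner.diff_right F_def)
      then have "cinner (T u) (T (x - p)) = complex_of_real ((norm (T u))\<^sup>2) * cinner u (x - p)" by (rule max)
      moreover have "cinner u p = 0" unfolding p_def cinner.sum_right
        by (rule sum.neutral) (simp add: cinner_scaleC_right uF')
      moreover have "cinner (T u) (T p) = 0"
        unfolding p_def bounded_clinear_sum[OF lin] cinner.sum_right
        by (rule sum.neutral) (simp add: cinner_scaleC_right bounded_clinear_scaleC[OF lin] TuF)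
      ultimately show ?thesis by (simp add: bounded_clinear_diff[OF lin] cinner.diff_right)
    qed
    have "singular_vector T u" using u sing by (simp add: singular_vector_def)
    then obtain b where b: "b \<in> B" "cinner b u \<noteq> 0" using B(3) by blast
    then have "\<not> \<epsilon> < s b" using uF by (auto simp: F_def)
    then have lt: "s b < norm (T u)" using big by simp
    have "complex_of_real ((s b)\<^sup>2) * cinner b u = cinner (T b) (T u)" using sv[OF b(1)] by simp
    also have "\<dots> = cnj (cinner (T u) (T b))" by (rule cinner_commute)
    also have "\<dots> = complex_of_real ((norm (T u))\<^sup>2) * cinner b u"
      unfolding sing by (simp add: cinner_commute[of b u])
    finally have "(s b)\<^sup>2 = (norm (T u))\<^sup>2" using b(2) by (metis mult_cancel_right of_real_eq_iff)
    then show False using lt spos[OF b(1)] by (simp add: power2_eq_iff_nonneg)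
  qed
  have approx: "norm (T x - sv_sum {b\<in>B. \<epsilon> < s b} (\<lambda>b. b) f s x) \<le> \<epsilon> * norm x" if \<epsilon>: "\<epsilon> > 0" for \<epsilon> x
  proof -
    define F where "F = {b\<in>B. \<epsilon> < s b}"
    have F: "finite F" "F \<subseteq> B" using fin[OF \<epsilon>] by (auto simp: F_def)
    define p where "p = (\<Sum>b\<in>F. cinner b x *\<^sub>C b)"
    have "cinner b (x - p) = 0" if "b \<in> B" "\<epsilon> < s b" for b
      using orthonormal_cinner_sum[OF B(1) F(2,1) that(1), of "\<lambda>b. cinner b x"] that
      by (simp add: p_def F_def cinner.diff_right)
    then have "norm (T (x - p)) \<le> \<epsilon> * norm (x - p)" by (rule bound[OF \<epsilon>])
    moreover have "norm (x - p) \<le> norm x"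
    proof (rule power2_le_imp_le)
      have "0 \<le> (\<Sum>b\<in>F. (cmod (cinner b x))\<^sup>2)" by (rule sum_nonneg) simp
      then show "(norm (x - p))\<^sup>2 \<le> (norm x)\<^sup>2"
        using orthonormal_residual[OF B(1) F(2,1), of x] by (simp add: p_def)
    qed simp
    moreover have "T p = sv_sum F (\<lambda>b. b) f s x"
      unfolding p_def sv_sum_def bounded_clinear_sum[OF lin]
    proof (rule sum.cong)
      fix b assume "b \<in> F"
      then have "s b > 0" using F spos by auto
      then show "T (cinner b x *\<^sub>C b) = (complex_of_real (s b) * cinner b x) *\<^sub>C f b"
        by (simp add: f_def bounded_clinear_scaleC[OF lin] scaleC_scaleC)
    qed simp
    ultimately show ?thesis using \<epsilon> by (simp add: bounded_clinear_diff[OF lin] F_def)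
        (meson less_imp_le mult_left_mono order_trans)
  qed
  have "singular_system T B (\<lambda>b. b) f s"
    using lin v B(1) f approx by (simp add: singular_system_def)
  then show ?thesis by blast
qed

lemma singular_system_reindex:
  fixes T :: "'a::complex_hilbert_space \<Rightarrow> 'a"
  assumes S: "singular_system T I e f s" and h: "bij_betw h N I" "\<And>n. n \<in> N \<Longrightarrow> s (h n) = \<mu> n"
  shows "singular_system T N (e \<circ> h) (f \<circ> h) \<mu>"
proof -
  have hI: "h n \<in> I" if "n \<in> N" for n using bij_betwE[OF h(1)] that by blast
  have inj: "inj_on h N" using h(1) by (rule bij_betw_imp_inj_on)
  have im: "h ` {n\<in>N. \<epsilon> < \<mu> n} = {i\<in>I. \<epsilon> < s i}" for \<epsilon>
    using bij_betw_imp_surj_on[OF h(1)] h(2) by (auto simp: image_iff)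
  have inj': "inj_on h {n\<in>N. \<epsilon> < \<mu> n}" for \<epsilon> using inj by (rule inj_on_subset) auto
  have sv: "sv_sum {n\<in>N. \<epsilon> < \<mu> n} (e \<circ> h) (f \<circ> h) \<mu> x = sv_sum {i\<in>I. \<epsilon> < s i} e f s x" for \<epsilon> x
    unfolding sv_sum_def im[symmetric] sum.reindex[OF inj'] by (rule sum.cong) (use h(2) in auto)
  have on: "orthonormal_on N (g \<circ> h)" if "orthonormal_on I g" for g :: "_ \<Rightarrow> 'a"
    using that hI inj by (auto simp: orthonormal_on_def inj_on_eq_iff)
  have "vanishing_on N \<mu>"
    unfolding vanishing_on_def
  proof (intro conjI ballI allI impI)
    show "0 < \<mu> n" if "n \<in> N" for n
      using S hI[OF that] h(2)[OF that] by (auto simp: singular_system_def vanishing_on_def)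
    show "finite {n\<in>N. \<epsilon> < \<mu> n}" if "\<epsilon> > 0" for \<epsilon>
      using S that finite_imageD[OF _ inj', of \<epsilon>] by (simp add: im singular_system_def vanishing_on_def)
  qed
  then show ?thesis using S on by (simp add: singular_system_def sv)
qed

text \<open>
  Indexing by \<open>nat\<close> gives all operators index sets of one type, as the products over the factors of
  a tensor product require.
\<close>

lemma compact_op_sorted_system:
  assumes "compact_op T"
  shows "\<exists>e f. singular_system T {n. 0 < singular_value n T} e f (\<lambda>n. singular_value n T)"
proof -
  obtain I :: "'a set" and e f s where S: "singular_system T I e f s"
    using compact_op_has_singular_system[OF assms] by blast
  then obtain h where "bij_betw h {n. 0 < singular_value n T} I" "\<And>n. 0 < singular_value n T \<Longrightarrow> s (h n) = singular_value n T"
    using same_level_counts_bij[OF _ singular_system_singular_value[OF S]] by (auto simp: singular_system_def)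
  then have "singular_system T {n. 0 < singular_value n T} (e \<circ> h) (f \<circ> h) (\<lambda>n. singular_value n T)"
    by (intro singular_system_reindex[OF S]) auto
  then show ?thesis by blast
qed

lemma singular_value_nonneg:
  assumes "compact_op T" shows "0 \<le> singular_value n T"
proof -
  obtain I :: "'a set" and e f s where "singular_system T I e f s"
    using compact_op_has_singular_system[OF assms] by blast
  then have "same_level_counts I s (\<lambda>n. singular_value n T)" by (rule singular_system_singular_value)
  then show ?thesis
    using decseq_null_nonneg[of "\<lambda>n. singular_value n T"] by (simp add: same_level_counts_def)
qed

section \<open>Approximation by operators of finite rank\<close>

text \<open>
  \<open>T\<close> is within \<open>\<epsilon>\<close>, in operator norm, of an operator of rank at most \<open>n\<close>. Ranks and errors
  add up under sums of operators, which is hard to see for singular values directly.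
\<close>

definition approx_rank :: "('a::complex_hilbert_space \<Rightarrow> 'a) \<Rightarrow> nat \<Rightarrow> real \<Rightarrow> bool" where
  "approx_rank T n \<epsilon> \<longleftrightarrow>
     (\<exists>u v. \<forall>x. norm (T x - (\<Sum>i<n. cinner (u i) x *\<^sub>C v i)) \<le> \<epsilon> * norm x)"

lemma approx_rank_sv_sum:
  assumes F: "finite F" and app: "\<And>x. norm (T x - sv_sum F e f s x) \<le> \<epsilon> * norm x"
  shows "approx_rank T (card F) \<epsilon>"
proof -
  obtain h where h: "bij_betw h {..<card F} F"
    using ex_bij_betw_nat_finite[OF F] by (auto simp: lessThan_atLeast0)
  have "sv_sum F e f s x =
      (\<Sum>i<card F. cinner (complex_of_real (s (h i)) *\<^sub>C e (h i)) x *\<^sub>C f (h i))" for x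
    unfolding sv_sum_def by (subst sum.reindex_bij_betw[OF h, symmetric]) (simp add: cinner_scaleC_left)
  then show ?thesis
    unfolding approx_rank_def using app
    by (intro exI[of _ "\<lambda>i. complex_of_real (s (h i)) *\<^sub>C e (h i)"] exI[of _ "\<lambda>i. f (h i)"]) simp
qed

lemma singular_system_approx_rank:
  assumes "singular_system T I e f s" "\<epsilon> > 0"
  shows "approx_rank T (upper_count I s \<epsilon>) \<epsilon>"
  unfolding upper_count_def
  by (rule approx_rank_sv_sum[of _ T e f s]) (use assms in \<open>auto simp: singular_system_def vanishing_on_def\<close>)

lemma approx_rank_mono:
  assumes "approx_rank T n \<delta>" "\<delta> \<le> \<epsilon>" shows "approx_rank T n \<epsilon>"
proof -
  obtain u v where uv: "\<And>x. norm (T x - (\<Sum>i<n. cinner (u i) x *\<^sub>C v i)) \<le> \<delta> * norm x"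
    using assms(1) unfolding approx_rank_def by (elim exE) auto
  have "norm (T x - (\<Sum>i<n. cinner (u i) x *\<^sub>C v i)) \<le> \<epsilon> * norm x" for x
    using uv[of x] mult_right_mono[OF assms(2) norm_ge_zero[of x]] by linarith
  then show ?thesis
    unfolding approx_rank_def by (intro exI[of _ u] exI[of _ v] allI)
qed

lemma approx_rank_add:
  assumes "approx_rank S m \<delta>" "approx_rank T n \<epsilon>"
  shows "approx_rank (\<lambda>x. S x + T x) (m + n) (\<delta> + \<epsilon>)"
proof -
  obtain u v where uv: "\<And>x. norm (S x - (\<Sum>i<m. cinner (u i) x *\<^sub>C v i)) \<le> \<delta> * norm x"
    using assms(1) unfolding approx_rank_def by (elim exE) auto
  obtain w z where wz: "\<And>x. norm (T x - (\<Sum>i<n. cinner (w i) x *\<^sub>C z i)) \<le> \<epsilon> * norm x"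
    using assms(2) unfolding approx_rank_def by (elim exE) auto
  define p where "p i = (if i < m then u i else w (i - m))" for i
  define q where "q i = (if i < m then v i else z (i - m))" for i
  have "norm (S x + T x - (\<Sum>i<m + n. cinner (p i) x *\<^sub>C q i)) \<le> (\<delta> + \<epsilon>) * norm x" for x
  proof -
    have "(\<Sum>i<m + n. cinner (p i) x *\<^sub>C q i) =
        (\<Sum>i<m. cinner (p i) x *\<^sub>C q i) + (\<Sum>i\<in>{m..<m + n}. cinner (p i) x *\<^sub>C q i)"
      unfolding lessThan_atLeast0 by (rule sum.atLeastLessThan_concat[symmetric]) auto
    also have "(\<Sum>i<m. cinner (p i) x *\<^sub>C q i) = (\<Sum>i<m. cinner (u i) x *\<^sub>C v i)"
      by (rule sum.cong) (auto simp: p_def q_def)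
    also have "(\<Sum>i\<in>{m..<m + n}. cinner (p i) x *\<^sub>C q i) = (\<Sum>i<n. cinner (w i) x *\<^sub>C z i)"
      by (rule sum.reindex_bij_witness[of _ "\<lambda>i. i + m" "\<lambda>i. i - m"]) (auto simp: p_def q_def)
    finally have "S x + T x - (\<Sum>i<m + n. cinner (p i) x *\<^sub>C q i) =
        (S x - (\<Sum>i<m. cinner (u i) x *\<^sub>C v i)) + (T x - (\<Sum>i<n. cinner (w i) x *\<^sub>C z i))"
      by simp
    then have "norm (S x + T x - (\<Sum>i<m + n. cinner (p i) x *\<^sub>C q i)) \<le>
        norm (S x - (\<Sum>i<m. cinner (u i) x *\<^sub>C v i)) + norm (T x - (\<Sum>i<n. cinner (w i) x *\<^sub>C z i))"
      by (simp only: norm_triangle_ineq)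
    then show ?thesis using uv[of x] wz[of x] by (simp add: distrib_right)
  qed
  then show ?thesis
    unfolding approx_rank_def by (intro exI[of _ p] exI[of _ q] allI)
qed

lemma approx_rank_scale:
  assumes "approx_rank T n \<epsilon>"
  shows "approx_rank (\<lambda>x. c *\<^sub>C T x) n (cmod c * \<epsilon>)"
proof -
  obtain u v where uv: "\<And>x. norm (T x - (\<Sum>i<n. cinner (u i) x *\<^sub>C v i)) \<le> \<epsilon> * norm x"
    using assms unfolding approx_rank_def by (elim exE) auto
  have "norm (c *\<^sub>C T x - (\<Sum>i<n. cinner (u i) x *\<^sub>C c *\<^sub>C v i)) \<le> cmod c * \<epsilon> * norm x" for x
  proof -
    have "c *\<^sub>C T x - (\<Sum>i<n. cinner (u i) x *\<^sub>C c *\<^sub>C v i) =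
        c *\<^sub>C (T x - (\<Sum>i<n. cinner (u i) x *\<^sub>C v i))"
      by (simp add: scaleC.diff_right scaleC.sum_right scaleC_scaleC mult.commute)
    then show ?thesis using mult_left_mono[OF uv[of x], of "cmod c"] by (simp add: norm_scaleC mult.assoc)
  qed
  then show ?thesis
    unfolding approx_rank_def by (intro exI[of _ u] exI[of _ "\<lambda>i. c *\<^sub>C v i"] allI)
qed

lemma compact_bounded_combinations:
  fixes v :: "'i \<Rightarrow> 'a::complex_hilbert_space"
  assumes "finite F"
  shows "compact {\<Sum>i\<in>F. c i *\<^sub>C v i | c. \<forall>i\<in>F. cmod (c i) \<le> C}"
  using assms
proof induction
  case empty
  then show ?case by simp
next
  case (insert j F)
  let ?K = "{\<Sum>i\<in>F. c i *\<^sub>C v i | c. \<forall>i\<in>F. cmod (c i) \<le> C}"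
  have "compact ((\<lambda>a. a *\<^sub>C v j) ` cball 0 C)"
    by (intro compact_continuous_image continuous_intros scaleC.continuous_on compact_cball)
  then have "compact {x + y | x y. x \<in> (\<lambda>a. a *\<^sub>C v j) ` cball 0 C \<and> y \<in> ?K}"
    using insert.IH by (rule compact_sums)
  moreover have "{x + y | x y. x \<in> (\<lambda>a. a *\<^sub>C v j) ` cball 0 C \<and> y \<in> ?K} =
      {\<Sum>i\<in>insert j F. c i *\<^sub>C v i | c. \<forall>i\<in>insert j F. cmod (c i) \<le> C}" (is "?L = ?R")
  proof (intro equalityI subsetI)
    fix z assume "z \<in> ?L"
    then obtain a c where z: "z = a *\<^sub>C v j + (\<Sum>i\<in>F. c i *\<^sub>C v i)" "cmod a \<le> C" "\<forall>i\<in>F. cmod (c i) \<le> C"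
      by auto
    have "(\<Sum>i\<in>F. (c(j := a)) i *\<^sub>C v i) = (\<Sum>i\<in>F. c i *\<^sub>C v i)"
      by (rule sum.cong) (use insert.hyps in auto)
    then have "z = (\<Sum>i\<in>insert j F. (c(j := a)) i *\<^sub>C v i)" using insert.hyps z(1) by simp
    moreover have "\<forall>i\<in>insert j F. cmod ((c(j := a)) i) \<le> C" using z by simp
    ultimately show "z \<in> ?R" by blast
  next
    fix z assume "z \<in> ?R"
    then obtain c where c: "z = (\<Sum>i\<in>insert j F. c i *\<^sub>C v i)" "\<forall>i\<in>insert j F. cmod (c i) \<le> C" by blast
    then have "z = c j *\<^sub>C v j + (\<Sum>i\<in>F. c i *\<^sub>C v i)" using insert.hyps by simp
    moreover have "c j *\<^sub>C v j \<in> (\<lambda>a. a *\<^sub>C v j) ` cball 0 C" using c(2) by auto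
    moreover have "(\<Sum>i\<in>F. c i *\<^sub>C v i) \<in> ?K" using c(2) by blast
    ultimately show "z \<in> ?L" by blast
  qed
  ultimately show ?case by simp
qed

lemma compact_op_approxI:
  fixes T :: "'a::complex_hilbert_space \<Rightarrow> 'a"
  assumes T: "bounded_clinear T" and approx: "\<And>\<epsilon>. \<epsilon> > 0 \<Longrightarrow> \<exists>n. approx_rank T n \<epsilon>"
  shows "compact_op T"
proof -
  have "compact (closure (T ` cball 0 1))"
    unfolding compact_eq_totally_bounded
  proof (intro conjI allI impI)
    show "complete (closure (T ` cball 0 1))" by (simp add: complete_eq_closed)
    fix e :: real assume e: "e > 0"
    then have e4: "e / 4 > 0" by simp
    obtain n where n: "approx_rank T n (e / 4)" using approx[OF e4] by blast
    obtain u v where uv: "\<And>x. norm (T x - (\<Sum>i<n. cinner (u i) x *\<^sub>C v i)) \<le> e/4 * norm x"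
      using n unfolding approx_rank_def by (elim exE) auto
    define C where "C = (\<Sum>i<n. norm (u i))"
    have C: "norm (u i) \<le> C" if "i < n" for i
      unfolding C_def using that by (intro member_le_sum) auto
    let ?K = "{\<Sum>i<n. c i *\<^sub>C v i | c. \<forall>i\<in>{..<n}. cmod (c i) \<le> C}"
    obtain k where k: "finite k" "?K \<subseteq> (\<Union>x\<in>k. ball x (e/4))"
      using compact_bounded_combinations[of "{..<n}" v C] e4 unfolding compact_eq_totally_bounded by blast
    have "T ` cball 0 1 \<subseteq> (\<Union>x\<in>k. cball x (e/2))"
    proof
      fix y assume "y \<in> T ` cball 0 1"
      then obtain x where x: "norm x \<le> 1" "y = T x" by auto
      define p where "p = (\<Sum>i<n. cinner (u i) x *\<^sub>C v i)"
      have "cmod (cinner (u i) x) \<le> C" if "i < n" for i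
      proof -
        have "cmod (cinner (u i) x) \<le> norm (u i) * norm x" by (rule norm_cinner_le)
        also have "\<dots> \<le> norm (u i)" using x(1) by (simp add: mult_left_le)
        finally show ?thesis using C[OF that] by simp
      qed
      then have "p \<in> ?K" unfolding p_def by (intro CollectI exI[of _ "\<lambda>i. cinner (u i) x"]) auto
      then obtain q where q: "q \<in> k" "dist q p < e/4" using k(2) by auto
      have "dist p y \<le> e/4 * norm x" using uv[of x] by (simp add: p_def x(2) dist_norm norm_minus_commute)
      also have "\<dots> \<le> e/4" using e x(1) by (simp add: mult_left_le)
      finally have "dist q y \<le> e/2" using q(2) dist_triangle[of q y p] by simp
      then show "y \<in> (\<Union>x\<in>k. cball x (e/2))" using q(1) by auto
    qed
    then have "closure (T ` cball 0 1) \<subseteq> (\<Union>x\<in>k. cball x (e/2))"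
      using k(1) by (intro closure_minimal closed_UN) auto
    also have "\<dots> \<subseteq> (\<Union>x\<in>k. ball x e)" using e by fastforce
    finally show "\<exists>k. finite k \<and> closure (T ` cball 0 1) \<subseteq> (\<Union>x\<in>k. ball x e)" using k(1) by blast
  qed
  then show ?thesis using T by (simp add: compact_op_def)
qed

lemma singular_system_compact:
  assumes "singular_system T I e f s" shows "compact_op T"
  using assms singular_system_approx_rank[OF assms]
  by (intro compact_op_approxI) (auto simp: singular_system_def)

lemma card_le_of_independent_family:
  fixes w :: "'j \<Rightarrow> 'a::complex_hilbert_space"
  assumes E: "finite E" and F: "finite F" and w: "\<And>j. j \<in> E \<Longrightarrow> w j \<in> cspan (v ` F)"
    and ind: "\<And>c. (\<Sum>j\<in>E. c j *\<^sub>C w j) = 0 \<Longrightarrow> \<forall>j\<in>E. c j = 0"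
  shows "card E \<le> card F"
proof -
  have inj: "inj_on w E"
  proof (rule inj_onI, rule ccontr)
    fix i j assume ij: "i \<in> E" "j \<in> E" "w i = w j" "i \<noteq> j"
    define c :: "'j \<Rightarrow> complex" where "c k = (if k = i then 1 else 0) - (if k = j then 1 else 0)" for k
    have "(\<Sum>k\<in>E. c k *\<^sub>C w k) = (\<Sum>k\<in>E. (if k = i then w k else 0) - (if k = j then w k else 0))"
      by (rule sum.cong) (auto simp: c_def scaleC.diff_left scaleC.zero_left complex_vector.scale_one)
    also have "\<dots> = 0" using ij E by (simp add: sum_subtractf sum.delta')
    finally have "c i = 0" using ind ij(1) by blast
    then show False using ij(4) by (simp add: c_def)
  qed
  have "complex_vector.independent (w ` E)"
  proof (rule complex_vector.independent_if_scalars_zero)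
    fix g x assume "(\<Sum>x\<in>w ` E. g x *\<^sub>C x) = 0" "x \<in> w ` E"
    then show "g x = 0" using ind[of "\<lambda>j. g (w j)"] by (auto simp: sum.reindex[OF inj])
  qed (use E in simp)
  moreover have "w ` E \<subseteq> cspan (v ` F)" using w by blast
  ultimately have "card (w ` E) \<le> card (v ` F)"
    using complex_vector.independent_span_bound[of "v ` F" "w ` E"] F by simp
  then show ?thesis using card_image[OF inj] card_image_le[OF F, of v] by linarith
qed

text \<open>
  An approximant \<open>L\<close> is injective on the span of the \<open>e\<^sub>j\<close> with \<open>s\<^sub>j > \<epsilon>\<close>: the operator expands
  every nonzero vector there by a factor larger than \<open>\<epsilon>\<close>, while \<open>L x = 0\<close> bounds its norm at \<open>x\<close>
  by \<open>\<epsilon> \<parallel>x\<parallel>\<close>. So the dimension of this span is at most the rank of \<open>L\<close>.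
\<close>

lemma upper_count_le_rank:
  fixes P :: "'a::complex_hilbert_space \<Rightarrow> 'a"
  assumes S: "singular_system P J e f s" and \<epsilon>: "\<epsilon> > 0" and app: "approx_rank P n \<epsilon>"
  shows "upper_count J s \<epsilon> \<le> n"
proof -
  have e: "orthonormal_on J e" and f: "orthonormal_on J f" and vs: "vanishing_on J s"
    and P: "bounded_clinear P" using S by (auto simp: singular_system_def)
  obtain u v where approx: "\<And>x. norm (P x - (\<Sum>i<n. cinner (u i) x *\<^sub>C v i)) \<le> \<epsilon> * norm x"
    using app unfolding approx_rank_def by (elim exE) auto
  define E where "E = {j\<in>J. \<epsilon> < s j}"
  have E: "finite E" "E \<subseteq> J" using vanishing_on_finite[OF vs \<epsilon>] by (auto simp: E_def)
  define L where "L x = (\<Sum>i<n. cinner (u i) x *\<^sub>C v i)" for x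
  have "card E \<le> card {..<n}"
  proof (rule card_le_of_independent_family[OF E(1) finite_lessThan])
    show "L (e j) \<in> cspan (v ` {..<n})" for j unfolding L_def
      by (intro complex_vector.span_sum complex_vector.span_scale complex_vector.span_base) auto
    fix c assume c: "(\<Sum>j\<in>E. c j *\<^sub>C L (e j)) = 0"
    define x where "x = (\<Sum>j\<in>E. c j *\<^sub>C e j)"
    have "L x = (\<Sum>i<n. \<Sum>j\<in>E. (c j * cinner (u i) (e j)) *\<^sub>C v i)"
      by (simp add: L_def x_def cinner.sum_right cinner_scaleC_right scaleC.sum_left)
    also have "\<dots> = (\<Sum>j\<in>E. c j *\<^sub>C L (e j))"
      unfolding L_def scaleC.sum_right scaleC_scaleC by (rule sum.swap)
    finally have "L x = 0" using c by simp
    then have "norm (P x) \<le> \<epsilon> * norm x" using approx[of x, folded L_def] by simp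
    then have "(norm (P x))\<^sup>2 \<le> (\<epsilon> * norm x)\<^sup>2" by (rule power_mono) simp
    moreover have "P x = (\<Sum>j\<in>E. (c j * complex_of_real (s j)) *\<^sub>C f j)"
      unfolding x_def bounded_clinear_sum[OF P]
      by (rule sum.cong) (use E singular_system_apply[OF S] in \<open>auto simp: bounded_clinear_scaleC[OF P] scaleC_scaleC\<close>)
    ultimately have "(\<Sum>j\<in>E. (cmod (c j))\<^sup>2 * (s j)\<^sup>2) \<le> (\<Sum>j\<in>E. (cmod (c j))\<^sup>2 * \<epsilon>\<^sup>2)"
      using orthonormal_norm_sum[OF f E(2,1), of "\<lambda>j. c j * complex_of_real (s j)"]
        orthonormal_norm_sum[OF e E(2,1), of c]
      by (simp add: x_def power_mult_distrib norm_mult sum_distrib_right mult.commute flip: sum_distrib_left)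
    then have le: "(\<Sum>j\<in>E. (cmod (c j))\<^sup>2 * ((s j)\<^sup>2 - \<epsilon>\<^sup>2)) \<le> 0"
      by (simp add: right_diff_distrib sum_subtractf)
    have pos: "(s j)\<^sup>2 - \<epsilon>\<^sup>2 > 0" if "j \<in> E" for j
      using that \<epsilon> by (simp add: E_def power_strict_mono)
    then have nn: "0 \<le> (cmod (c j))\<^sup>2 * ((s j)\<^sup>2 - \<epsilon>\<^sup>2)" if "j \<in> E" for j
      using that by (simp add: less_imp_le)
    have "(\<Sum>j\<in>E. (cmod (c j))\<^sup>2 * ((s j)\<^sup>2 - \<epsilon>\<^sup>2)) = 0"
      by (rule antisym[OF le sum_nonneg[OF nn]])
    then have z: "\<forall>j\<in>E. (cmod (c j))\<^sup>2 * ((s j)\<^sup>2 - \<epsilon>\<^sup>2) = 0"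
      by (subst (asm) sum_nonneg_eq_0_iff[OF E(1) nn])
    show "\<forall>j\<in>E. c j = 0"
    proof
      fix j assume "j \<in> E"
      then show "c j = 0" using z pos[of j] by fastforce
    qed
  qed
  then show ?thesis by (simp add: upper_count_def E_def)
qed

section \<open>Counting and summing large singular values\<close>

text \<open>
  Sums over a level set are what multiplies well when families of weights are multiplied. They replace
  the partial sums of the rearranged sequence in all computations with products.
\<close>

definition upper_sum :: "'i set \<Rightarrow> ('i \<Rightarrow> real) \<Rightarrow> real \<Rightarrow> real" where
  "upper_sum I s \<epsilon> = (\<Sum>i\<in>{i\<in>I. \<epsilon> < s i}. s i)"

lemma upper_sum_nonneg: "\<epsilon> \<ge> 0 \<Longrightarrow> 0 \<le> upper_sum I s \<epsilon>"
  unfolding upper_sum_def by (rule sum_nonneg) auto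

lemma upper_sum_antimono:
  assumes "vanishing_on I s" "0 < \<delta>" "\<delta> \<le> \<epsilon>" shows "upper_sum I s \<epsilon> \<le> upper_sum I s \<delta>"
  unfolding upper_sum_def
  by (rule sum_mono2) (use assms in \<open>auto simp: vanishing_on_finite vanishing_on_def less_imp_le\<close>)

lemma upper_sum_sequence:
  assumes s: "vanishing_on I s" and m: "same_level_counts I s \<mu>" and \<epsilon>: "\<epsilon> > 0"
  shows "upper_sum I s \<epsilon> = (\<Sum>n<upper_count I s \<epsilon>. \<mu> n)"
proof -
  obtain h where h: "bij_betw h {n. 0 < \<mu> n} I" "\<And>n. 0 < \<mu> n \<Longrightarrow> s (h n) = \<mu> n"
    using same_level_counts_bij[OF s m] by blast
  have im: "h ` {n. \<epsilon> < \<mu> n} = {i\<in>I. \<epsilon> < s i}"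
  proof (intro equalityI subsetI)
    fix i assume i: "i \<in> {i\<in>I. \<epsilon> < s i}"
    then obtain n where "0 < \<mu> n" "i = h n" using bij_betw_imp_surj_on[OF h(1)] by blast
    then show "i \<in> h ` {n. \<epsilon> < \<mu> n}" using i h(2) by auto
  qed (use h \<epsilon> bij_betwE[OF h(1)] in auto)
  have inj: "inj_on h {n. \<epsilon> < \<mu> n}"
    using bij_betw_imp_inj_on[OF h(1)] by (rule inj_on_subset) (use \<epsilon> in auto)
  have "upper_sum I s \<epsilon> = (\<Sum>n\<in>{n. \<epsilon> < \<mu> n}. \<mu> n)"
    unfolding upper_sum_def im[symmetric] sum.reindex[OF inj] by (rule sum.cong) (use h(2) \<epsilon> in auto)
  also have "{n. \<epsilon> < \<mu> n} = {..<upper_count I s \<epsilon>}"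
    using same_level_counts_upper[OF s m \<epsilon>] by auto
  finally show ?thesis .
qed

lemma upper_reindex:
  assumes h: "bij_betw h A B" "\<And>a. a \<in> A \<Longrightarrow> w (h a) = w' a"
  shows "upper_count B w \<epsilon> = upper_count A w' \<epsilon>" "upper_sum B w \<epsilon> = upper_sum A w' \<epsilon>"
proof -
  have im: "h ` {a\<in>A. \<epsilon> < w' a} = {b\<in>B. \<epsilon> < w b}"
    using bij_betw_imp_surj_on[OF h(1)] h(2) by (auto simp: image_iff)
  have inj: "inj_on h {a\<in>A. \<epsilon> < w' a}"
    using bij_betw_imp_inj_on[OF h(1)] by (rule inj_on_subset) auto
  show "upper_count B w \<epsilon> = upper_count A w' \<epsilon>"
    unfolding upper_count_def im[symmetric] by (rule card_image[OF inj])
  show "upper_sum B w \<epsilon> = upper_sum A w' \<epsilon>"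
    unfolding upper_sum_def im[symmetric] sum.reindex[OF inj] by (rule sum.cong) (use h(2) in auto)
qed

text \<open>
  A version of the logarithm that is at least \<open>1\<close> on \<open>[0, \<infinity>)\<close> and submultiplicative, so that
  changes of scale cost only a constant factor.
\<close>

definition log_weight :: "real \<Rightarrow> real" where "log_weight x = 1 + ln (1 + x)"

lemma log_weight_ge_1: "x \<ge> 0 \<Longrightarrow> 1 \<le> log_weight x"
  by (simp add: log_weight_def)

lemma log_weight_mono: "0 \<le> x \<Longrightarrow> x \<le> y \<Longrightarrow> log_weight x \<le> log_weight y"
  by (simp add: log_weight_def)

lemma log_weight_mult:
  assumes "c \<ge> 0" "x \<ge> 0"
  shows "log_weight (c * x) \<le> log_weight c * log_weight x"
proof -
  have "ln (1 + c * x) \<le> ln ((1 + c) * (1 + x))"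
    using assms by (subst ln_le_cancel_iff) (auto simp: algebra_simps intro!: add_pos_nonneg mult_pos_pos)
  also have "\<dots> = ln (1 + c) + ln (1 + x)" using assms by (simp add: ln_mult)
  finally have "log_weight (c * x) \<le> 1 + ln (1 + c) + ln (1 + x)" by (simp add: log_weight_def)
  also have "\<dots> \<le> log_weight c * log_weight x" using assms by (simp add: log_weight_def algebra_simps)
  finally show ?thesis .
qed

lemma log_weight_power_mult:
  assumes "c \<ge> 0" "x \<ge> 0"
  shows "log_weight (c * x) ^ p \<le> log_weight c ^ p * log_weight x ^ p"
  unfolding power_mult_distrib[symmetric]
  by (rule power_mono[OF log_weight_mult[OF assms]]) (use assms log_weight_ge_1[of "c * x"] in auto)

lemma log_weight_at_top: "filterlim (\<lambda>n. log_weight (real n)) at_top sequentially"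
  unfolding log_weight_def
  by (intro filterlim_tendsto_add_at_top[OF tendsto_const] filterlim_compose[OF ln_at_top] filterlim_real_sequentially)

lemma log_weight_over_ln: "(\<lambda>n. log_weight (real n) / ln (real n + 1)) \<longlonglongrightarrow> 1"
proof -
  have "filterlim (\<lambda>n. ln (1 + real n)) at_top sequentially"
    by (intro filterlim_compose[OF ln_at_top] filterlim_tendsto_add_at_top[OF tendsto_const] filterlim_real_sequentially)
  then have "filterlim (\<lambda>n. ln (real n + 1)) at_top sequentially" by (simp add: add.commute)
  then have "(\<lambda>n. 1 + inverse (ln (real n + 1))) \<longlonglongrightarrow> 1 + 0"
    by (rule tendsto_add[OF tendsto_const tendsto_inverse_0_at_top])
  moreover have "\<forall>\<^sub>F n in sequentially. 1 + inverse (ln (real n + 1)) = log_weight (real n) / ln (real n + 1)"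
    by (rule eventually_sequentiallyI[of 1]) (simp add: log_weight_def add_divide_distrib add.commute inverse_eq_divide)
  ultimately show ?thesis by (simp add: tendsto_cong)
qed

lemma log_weight_le_ln:
  assumes "n \<ge> 1" shows "log_weight (real n) \<le> 3 * ln (real n + 1)"
proof -
  have "1 \<le> 2 * ln (2::real)" using ln2_ge_two_thirds by simp
  also have "\<dots> \<le> 2 * ln (real n + 1)" using assms by simp
  finally show ?thesis by (simp add: log_weight_def add.commute)
qed

text \<open>
  Each summand is at most \<open>ln (j + 1) - ln j\<close>, and these differences telescope.
\<close>

lemma sum_inverse_le_ln:
  assumes "1 \<le> a" "a \<le> b"
  shows "(\<Sum>j\<in>{a..<b}. 1 / (real j + 1)) \<le> ln (real b / real a)"
  using assms(2)
proof (induction b rule: dec_induct)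
  case base
  then show ?case using assms by simp
next
  case (step b)
  have b: "real b > 0" using assms(1) step by simp
  have "ln (real b / (real b + 1)) \<le> real b / (real b + 1) - 1" using b by (intro ln_le_minus_one) simp
  also have "\<dots> = - (1 / (real b + 1))" by (simp add: field_simps)
  finally have "1 / (real b + 1) \<le> ln (real b + 1) - ln (real b)" using b by (simp add: ln_div)
  then show ?case using step b assms(1) by (simp add: ln_div add.commute)
qed

text \<open>
  The weights of a tensor product of \<open>p\<close> operators of the weak trace class have this growth
  (\<open>log_growth_prod\<close>).
\<close>

definition log_growth :: "nat \<Rightarrow> 'i set \<Rightarrow> ('i \<Rightarrow> real) \<Rightarrow> bool" where
  "log_growth p I s \<longleftrightarrow> vanishing_on I s \<and> (\<exists>K\<ge>0. \<forall>x>0. upper_sum I s (1 / x) \<le> K * log_weight x ^ p)"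

text \<open>
  For \<open>p = k\<close> this is the membership condition of \<open>\<I>\<^sub>k\<close>, stated in terms of the counting function
  \<open>N \<epsilon> = O(\<epsilon>\<^sup>-\<^sup>1 log\<^sup>k (1/\<epsilon>))\<close> instead of the rearranged sequence.
\<close>

definition log_count :: "nat \<Rightarrow> 'i set \<Rightarrow> ('i \<Rightarrow> real) \<Rightarrow> bool" where
  "log_count p I s \<longleftrightarrow> vanishing_on I s \<and>
     (\<exists>C\<ge>0. \<forall>\<epsilon>>0. real (upper_count I s \<epsilon>) \<le> C / \<epsilon> * log_weight (1 / \<epsilon>) ^ p)"

text \<open>
  If \<open>\<mu>\<^sub>n\<close> exceeded \<open>\<epsilon> = D log_weight(n)\<^sup>p / (n + 1)\<close> with a large constant \<open>D\<close>, there would be more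
  than \<open>n\<close> weights above \<open>\<epsilon>\<close>. Since \<open>1/\<epsilon> \<le> n + 1\<close>, this contradicts the bound on the number of
  weights above \<open>\<epsilon>\<close>.
\<close>

lemma log_count_sequence:
  assumes I: "log_count p I s" and m: "same_level_counts I s \<mu>"
  obtains C where "C \<ge> 0" "\<And>n. \<mu> n \<le> C * log_weight (real n) ^ p / (real n + 1)"
proof -
  obtain C where v: "vanishing_on I s" and C: "C \<ge> 0"
    "\<And>\<epsilon>. \<epsilon> > 0 \<Longrightarrow> real (upper_count I s \<epsilon>) \<le> C / \<epsilon> * log_weight (1 / \<epsilon>) ^ p"
    using I by (auto simp: log_count_def)
  define D where "D = 1 + 2 ^ p * C"
  have D: "D \<ge> 1" "D > 0" using C(1) by (auto simp: D_def intro: add_pos_nonneg)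
  have "\<mu> n \<le> D * log_weight (real n) ^ p / (real n + 1)" for n
  proof (rule ccontr)
    define L where "L = log_weight (real n)"
    define \<epsilon> where "\<epsilon> = D * L ^ p / (real n + 1)"
    assume "\<not> \<mu> n \<le> D * log_weight (real n) ^ p / (real n + 1)"
    then have lt: "\<epsilon> < \<mu> n" by (simp add: \<epsilon>_def L_def)
    have L: "L \<ge> 1" by (simp add: L_def log_weight_ge_1)
    then have Lp: "L ^ p \<ge> 1" by simp
    have \<epsilon>: "\<epsilon> > 0" using D L by (simp add: \<epsilon>_def)
    have DL: "1 \<le> D * L ^ p" using D Lp mult_mono[of 1 D 1 "L ^ p"] by simp
    have inv: "1 / \<epsilon> \<le> real n + 1"
    proof -
      have "1 / \<epsilon> = (real n + 1) / (D * L ^ p)" by (simp add: \<epsilon>_def)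
      also have "\<dots> \<le> (real n + 1) / 1" using DL by (intro divide_left_mono) auto
      finally show ?thesis by simp
    qed
    have "log_weight (1 / \<epsilon>) \<le> log_weight (real n + 1)" using inv \<epsilon> by (intro log_weight_mono) auto
    also have "\<dots> \<le> 2 * L"
    proof -
      have "ln (1 + (real n + 1)) \<le> ln (2 * (1 + real n))" by (subst ln_le_cancel_iff) auto
      also have "\<dots> = ln 2 + ln (1 + real n)" by (subst ln_mult) auto
      finally have "ln (1 + (real n + 1)) \<le> ln 2 + ln (1 + real n)" .
      moreover have "0 \<le> ln (1 + real n)" by simp
      moreover have "ln 2 < (1::real)" using ln_le_minus_one[of "2::real"] ln_2_less_1 by simp
      ultimately have "1 + ln (1 + (real n + 1)) \<le> 2 * (1 + ln (1 + real n))" by argo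
      then show ?thesis by (simp add: L_def log_weight_def)
    qed
    finally have "log_weight (1 / \<epsilon>) ^ p \<le> (2 * L) ^ p" using \<epsilon> log_weight_ge_1[of "1/\<epsilon>"] by (intro power_mono) auto
    then have "C / \<epsilon> * log_weight (1 / \<epsilon>) ^ p \<le> C / \<epsilon> * (2 * L) ^ p" using C(1) \<epsilon> by (intro mult_left_mono) auto
    moreover have "n < upper_count I s \<epsilon>" using same_level_counts_upper[OF v m \<epsilon>] lt by simp
    ultimately have "real n + 1 \<le> C / \<epsilon> * (2 * L) ^ p" using C(2)[OF \<epsilon>] by linarith
    also have "\<dots> = (real n + 1) * (2 ^ p * C / D)"
      using L D by (simp add: \<epsilon>_def power_mult_distrib)
    finally have "1 \<le> 2 ^ p * C / D" using mult_le_cancel_left_pos[of "real n + 1" 1 "2 ^ p * C / D"] by simp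
    then show False using D by (simp add: D_def)
  qed
  then show thesis using that[of D] D by auto
qed

lemma log_count_0_growth:
  assumes I: "log_count 0 I s" shows "log_growth 1 I s"
proof -
  obtain C where v: "vanishing_on I s" and C: "C \<ge> 0" "\<And>\<epsilon>. \<epsilon> > 0 \<Longrightarrow> real (upper_count I s \<epsilon>) \<le> C / \<epsilon>"
    using I by (auto simp: log_count_def)
  obtain \<mu> where m: "same_level_counts I s \<mu>" using same_level_counts_exists[OF v] by blast
  obtain D where D: "D \<ge> 0" "\<And>n. \<mu> n \<le> D / (real n + 1)" using log_count_sequence[OF I m] by auto
  have "upper_sum I s (1 / x) \<le> D * log_weight C * log_weight x" if x: "x > 0" for x
  proof -
    define N where "N = upper_count I s (1 / x)"
    have Nx: "real N \<le> C * x" using C(2)[of "1/x"] x by (simp add: N_def)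
    have U: "upper_sum I s (1 / x) = (\<Sum>n<N. \<mu> n)"
      using upper_sum_sequence[OF v m, of "1/x"] x by (simp add: N_def)
    show ?thesis
    proof (cases "N = 0")
      case True
      then show ?thesis using U D x log_weight_ge_1[OF C(1)] log_weight_ge_1[of x] by simp
    next
      case False
      have "(\<Sum>n<N. \<mu> n) \<le> (\<Sum>n<N. D * (1 / (real n + 1)))" using D(2) by (intro sum_mono) simp
      also have "\<dots> = D * (\<Sum>n<N. 1 / (real n + 1))" by (rule sum_distrib_left[symmetric])
      also have "\<dots> = D * (1 + (\<Sum>n\<in>{1..<N}. 1 / (real n + 1)))"
        using False by (simp add: lessThan_atLeast0 sum.atLeast_Suc_lessThan)
      also have "\<dots> \<le> D * (1 + ln (real N))"
        using sum_inverse_le_ln[of 1 N] False D by (intro mult_left_mono) auto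
      also have "\<dots> \<le> D * log_weight (C * x)"
      proof -
        have "ln (real N) \<le> ln (1 + C * x)" using Nx False C x by (subst ln_le_cancel_iff) auto
        then show ?thesis using D by (auto simp: log_weight_def intro: mult_left_mono)
      qed
      also have "\<dots> \<le> D * (log_weight C * log_weight x)"
        using C(1) D x by (intro mult_left_mono log_weight_mult) auto
      finally show ?thesis using U by simp
    qed
  qed
  then show ?thesis using v D(1) log_weight_ge_1[OF C(1)]
    unfolding log_growth_def by (intro conjI exI[of _ "D * log_weight C"]) auto
qed

text \<open>
  If the level set of \<open>1/x\<close> has at most \<open>x + 1\<close> elements, the indices missing from it contribute at
  most \<open>1/x\<close> each. Otherwise the difference is the tail on the right.
\<close>

lemma partial_sum_upper_sum_gap:
  assumes s: "vanishing_on I s" and m: "same_level_counts I s \<mu>" and x: "x \<ge> 1"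
  shows "\<bar>upper_sum I s (1 / x) - (\<Sum>j\<le>nat \<lfloor>x\<rfloor>. \<mu> j)\<bar>
    \<le> 2 + (\<Sum>j\<in>{Suc (nat \<lfloor>x\<rfloor>)..<upper_count I s (1 / x)}. \<mu> j)"
proof -
  define p where "p = nat \<lfloor>x\<rfloor>"
  have p: "real p \<le> x" using x by (simp add: p_def)
  define M where "M = upper_count I s (1 / x)"
  have U: "upper_sum I s (1 / x) = (\<Sum>j<M. \<mu> j)" using upper_sum_sequence[OF s m] x by (simp add: M_def)
  have nn: "0 \<le> \<mu> j" for j using m by (simp add: same_level_counts_def decseq_null_nonneg)
  have small: "\<mu> j \<le> 1 / x" if "M \<le> j" for j
    using same_level_counts_upper[OF s m, of "1/x" j] x that by (auto simp: M_def)
  have "\<bar>upper_sum I s (1 / x) - (\<Sum>j\<le>p. \<mu> j)\<bar> \<le> 2 + (\<Sum>j\<in>{Suc p..<M}. \<mu> j)"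
  proof (cases "M \<le> Suc p")
    case True
    have "{..<Suc p} = {..<M} \<union> {M..<Suc p}" using True by auto
    then have "(\<Sum>j\<le>p. \<mu> j) = (\<Sum>j<M. \<mu> j) + (\<Sum>j\<in>{M..<Suc p}. \<mu> j)"
      unfolding lessThan_Suc_atMost[symmetric] by (simp add: sum.union_disjoint ivl_disj_int)
    moreover have "(\<Sum>j\<in>{M..<Suc p}. \<mu> j) \<le> (\<Sum>j\<in>{M..<Suc p}. 1 / x)"
      by (rule sum_mono) (use small in auto)
    moreover have "(\<Sum>j\<in>{M..<Suc p}. 1 / x) \<le> 2"
    proof -
      have "real (card {M..<Suc p}) \<le> real p + 1" by simp
      also have "\<dots> \<le> 2 * x" using p x by simp
      finally show ?thesis using x by (simp add: pos_divide_le_eq)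
    qed
    moreover have "0 \<le> (\<Sum>j\<in>{M..<Suc p}. \<mu> j)" "0 \<le> (\<Sum>j\<in>{Suc p..<M}. \<mu> j)"
      by (rule sum_nonneg, rule nn)+
    ultimately show ?thesis using U by linarith
  next
    case False
    have "{..<M} = {..<Suc p} \<union> {Suc p..<M}" using False by auto
    then have "(\<Sum>j<M. \<mu> j) = (\<Sum>j\<le>p. \<mu> j) + (\<Sum>j\<in>{Suc p..<M}. \<mu> j)"
      unfolding lessThan_Suc_atMost[symmetric] by (simp add: sum.union_disjoint ivl_disj_int)
    moreover have "0 \<le> (\<Sum>j\<in>{Suc p..<M}. \<mu> j)" by (rule sum_nonneg) (rule nn)
    ultimately show ?thesis using U by linarith
  qed
  then show ?thesis by (simp add: p_def M_def)
qed

lemma partial_sum_upper_sum_bounded: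
  assumes I: "log_count 0 I s" and m: "same_level_counts I s \<mu>"
  obtains K where "K \<ge> 0" "\<And>x. x \<ge> 1 \<Longrightarrow> \<bar>upper_sum I s (1 / x) - (\<Sum>j\<le>nat \<lfloor>x\<rfloor>. \<mu> j)\<bar> \<le> K"
proof -
  obtain C where v: "vanishing_on I s" and C: "C \<ge> 0" "\<And>\<epsilon>. \<epsilon> > 0 \<Longrightarrow> real (upper_count I s \<epsilon>) \<le> C / \<epsilon>"
    using I by (auto simp: log_count_def)
  obtain D where D: "D \<ge> 0" "\<And>n. \<mu> n \<le> D / (real n + 1)" using log_count_sequence[OF I m] by auto
  have "\<bar>upper_sum I s (1 / x) - (\<Sum>j\<le>nat \<lfloor>x\<rfloor>. \<mu> j)\<bar> \<le> 2 + C * D" if x: "x \<ge> 1" for x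
  proof -
    define p where "p = nat \<lfloor>x\<rfloor>"
    define M where "M = upper_count I s (1 / x)"
    have px: "x < real p + 1" using x by (simp add: p_def)
    have Mx: "real M \<le> C * x" using C(2)[of "1/x"] x by (simp add: M_def)
    have "(\<Sum>j\<in>{Suc p..<M}. \<mu> j) \<le> (\<Sum>j\<in>{Suc p..<M}. D / x)"
    proof (rule sum_mono)
      fix j assume "j \<in> {Suc p..<M}"
      then have "x \<le> real j + 1" using px by auto
      then have "D / (real j + 1) \<le> D / x" using D x by (intro divide_left_mono) auto
      then show "\<mu> j \<le> D / x" using D(2)[of j] by simp
    qed
    also have "\<dots> \<le> C * D"
    proof -
      have "real (M - Suc p) * (D / x) \<le> C * x * (D / x)" using Mx D x by (intro mult_right_mono) auto
      then show ?thesis using x by simp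
    qed
    finally show ?thesis using partial_sum_upper_sum_gap[OF v m x] by (simp add: p_def M_def)
  qed
  then show thesis using that[of "2 + C * D"] C(1) D(1) by simp
qed

text \<open>
  The level set of \<open>1/n\<close> has at most \<open>C n L\<^sup>p\<close> elements, where \<open>L\<close> is of the order of \<open>log n\<close>. On
  the indices between \<open>n\<close> and this number \<open>\<mu>\<^sub>j\<close> is \<open>O(L\<^sup>p / j)\<close>, and these terms sum to
  \<open>O(L\<^sup>p log (C L\<^sup>p))\<close>, which is of smaller order than \<open>L\<^sup>p\<^sup>+\<^sup>1\<close>.
\<close>

lemma partial_sum_upper_sum_asymptotic:
  assumes I: "log_count p I s" and m: "same_level_counts I s \<mu>"
  shows "(\<lambda>n. ((\<Sum>j\<le>n. \<mu> j) - upper_sum I s (1 / real n)) / ln (real n + 1) ^ (p + 1)) \<longlonglongrightarrow> 0"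
proof -
  obtain C where v: "vanishing_on I s" and C: "C \<ge> 0"
    "\<And>\<epsilon>. \<epsilon> > 0 \<Longrightarrow> real (upper_count I s \<epsilon>) \<le> C / \<epsilon> * log_weight (1 / \<epsilon>) ^ p"
    using I by (auto simp: log_count_def)
  obtain D where D: "D \<ge> 0" "\<And>n. \<mu> n \<le> D * log_weight (real n) ^ p / (real n + 1)"
    using log_count_sequence[OF I m] by blast
  define L where "L n = log_weight (real n)" for n
  have L1: "L n \<ge> 1" for n by (simp add: L_def log_weight_ge_1)
  define K1 where "K1 = log_weight C + real p"
  have K1: "K1 \<ge> 0" using log_weight_ge_1[OF C(1)] by (simp add: K1_def)
  have bound: "\<bar>(\<Sum>j\<le>n. \<mu> j) - upper_sum I s (1 / real n)\<bar> \<le>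
      L n ^ p * ((2 + D * K1 ^ p * ln (1 + C)) + D * K1 ^ p * real p * ln (L n))" if n: "n \<ge> 1" for n
  proof -
    define M where "M = upper_count I s (1 / real n)"
    have Mn: "real M \<le> C * real n * L n ^ p" using C(2)[of "1 / real n"] n by (simp add: M_def L_def)
    have gap: "\<bar>(\<Sum>j\<le>n. \<mu> j) - upper_sum I s (1 / real n)\<bar> \<le> 2 + (\<Sum>j\<in>{Suc n..<M}. \<mu> j)"
      using partial_sum_upper_sum_gap[OF v m, of "real n"] n by (simp add: M_def abs_minus_commute)
    have lnL: "0 \<le> ln (L n)" using L1 by simp
    have lnC: "0 \<le> ln (1 + C)" using C by simp
    have rest: "0 \<le> D * K1 ^ p * ln (1 + C)" "0 \<le> D * K1 ^ p * real p * ln (L n)" using D(1) K1 lnL lnC by auto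
    have tail: "(\<Sum>j\<in>{Suc n..<M}. \<mu> j) \<le> L n ^ p * (D * K1 ^ p * ln (1 + C) + D * K1 ^ p * real p * ln (L n))"
    proof (cases "M \<le> Suc n")
      case True
      then show ?thesis using rest L1[of n] by simp
    next
      case False
      then have M: "Suc n < M" by simp
      have CL: "1 + C * real n * L n ^ p \<le> (1 + C) * (1 + real n) * L n ^ p"
      proof -
        have "1 \<le> L n ^ p" using L1 by simp
        then have "1 + C * real n * L n ^ p \<le> L n ^ p + C * real n * L n ^ p" by simp
        also have "\<dots> \<le> (1 + C) * (1 + real n) * L n ^ p"
          using C(1) L1[of n] by (simp add: algebra_simps)
        finally show ?thesis .
      qed
      have LM: "log_weight (real M) \<le> K1 * L n"
      proof -
        have "ln (1 + real M) \<le> ln ((1 + C) * (1 + real n) * L n ^ p)"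
          using Mn CL C(1) L1[of n] by (subst ln_le_cancel_iff) (auto intro!: mult_pos_pos zero_less_power)
        also have "\<dots> = ln (1 + C) + ln (1 + real n) + real p * ln (L n)"
          using C(1) L1[of n] by (simp add: ln_mult ln_realpow)
        finally have "log_weight (real M) \<le> log_weight C + L n - 1 + real p * ln (L n)"
          by (simp add: log_weight_def L_def)
        also have "\<dots> \<le> log_weight C * L n + real p * L n"
        proof -
          have "log_weight C + L n - 1 \<le> log_weight C * L n"
            using mult_nonneg_nonneg[of "log_weight C - 1" "L n - 1"] log_weight_ge_1[OF C(1)] L1[of n]
            by (simp add: algebra_simps)
          moreover have "ln (L n) \<le> L n" using L1[of n] ln_le_minus_one[of "L n"] by simp
          ultimately show ?thesis by (intro add_mono mult_left_mono) auto
        qed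
        finally show ?thesis by (simp add: K1_def algebra_simps)
      qed
      have "(\<Sum>j\<in>{Suc n..<M}. \<mu> j) \<le> (\<Sum>j\<in>{Suc n..<M}. D * (K1 * L n) ^ p * (1 / (real j + 1)))"
      proof (rule sum_mono)
        fix j assume "j \<in> {Suc n..<M}"
        then have "log_weight (real j) \<le> K1 * L n" using LM log_weight_mono[of "real j" "real M"] by auto
        then have "log_weight (real j) ^ p \<le> (K1 * L n) ^ p" using log_weight_ge_1[of "real j"] by (intro power_mono) auto
        then have "D * log_weight (real j) ^ p / (real j + 1) \<le> D * (K1 * L n) ^ p / (real j + 1)"
          using D(1) by (intro divide_right_mono mult_left_mono) auto
        then show "\<mu> j \<le> D * (K1 * L n) ^ p * (1 / (real j + 1))" using D(2)[of j] by simp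
      qed
      also have "\<dots> \<le> D * (K1 * L n) ^ p * ln (real M / real (Suc n))"
        unfolding sum_distrib_left[symmetric]
        by (intro mult_left_mono sum_inverse_le_ln) (use M D(1) K1 L1[of n] in auto)
      also have "\<dots> \<le> D * (K1 * L n) ^ p * (ln (1 + C) + real p * ln (L n))"
      proof (intro mult_left_mono)
        have "real M / real (Suc n) \<le> (1 + C) * L n ^ p"
        proof -
          have "real M \<le> C * real n * L n ^ p" by (rule Mn)
          also have "\<dots> \<le> (1 + C) * (1 + real n) * L n ^ p" using CL by linarith
          finally show ?thesis by (simp add: pos_divide_le_eq mult_ac)
        qed
        then have "ln (real M / real (Suc n)) \<le> ln ((1 + C) * L n ^ p)"
          using M C(1) L1[of n] by (subst ln_le_cancel_iff) (auto intro!: mult_pos_pos zero_less_power)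
        then show "ln (real M / real (Suc n)) \<le> ln (1 + C) + real p * ln (L n)"
          using C(1) L1[of n] by (simp add: ln_mult ln_realpow)
      qed (use D(1) K1 L1[of n] in auto)
      also have "\<dots> = L n ^ p * (D * K1 ^ p * ln (1 + C) + D * K1 ^ p * real p * ln (L n))"
        by (simp add: power_mult_distrib algebra_simps)
      finally show ?thesis .
    qed
    have "2 \<le> L n ^ p * 2" using L1[of n] by simp
    then show ?thesis using gap tail by (simp add: distrib_left)
  qed
  define a b where "a = 2 + D * K1 ^ p * ln (1 + C)" and "b = D * K1 ^ p * real p"
  have Linf: "filterlim L at_top sequentially" unfolding L_def by (rule log_weight_at_top)
  have inv: "(\<lambda>n. inverse (L n)) \<longlonglongrightarrow> 0" by (rule tendsto_inverse_0_at_top[OF Linf])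
  have lnL: "(\<lambda>n. ln (L n) / L n) \<longlonglongrightarrow> 0" by (rule filterlim_compose[OF ln_x_over_x_tendsto_0 Linf])
  have lim: "(\<lambda>n. (L n / ln (real n + 1)) ^ (p + 1) * (a * inverse (L n) + b * (ln (L n) / L n))) \<longlonglongrightarrow>
      1 ^ (p + 1) * (a * 0 + b * 0)"
    by (intro tendsto_mult tendsto_power tendsto_add tendsto_const log_weight_over_ln[folded L_def] inv lnL)
  show ?thesis
  proof (rule Lim_null_comparison)
    show "(\<lambda>n. (L n / ln (real n + 1)) ^ (p + 1) * (a * inverse (L n) + b * (ln (L n) / L n))) \<longlonglongrightarrow> 0"
      using lim by simp
    show "\<forall>\<^sub>F n in sequentially. norm (((\<Sum>j\<le>n. \<mu> j) - upper_sum I s (1 / real n)) / ln (real n + 1) ^ (p + 1))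
       \<le> (L n / ln (real n + 1)) ^ (p + 1) * (a * inverse (L n) + b * (ln (L n) / L n))"
    proof (rule eventually_sequentiallyI[of 1])
      fix n :: nat assume n: "n \<ge> 1"
      define l where "l = ln (real n + 1)"
      have l: "l > 0" using n by (simp add: l_def)
      have "\<bar>(\<Sum>j\<le>n. \<mu> j) - upper_sum I s (1 / real n)\<bar> / l ^ (p + 1) \<le> L n ^ p * (a + b * ln (L n)) / l ^ (p + 1)"
        using bound[OF n] l by (intro divide_right_mono) (auto simp: a_def b_def)
      also have "L n ^ p * (a + b * ln (L n)) / l ^ (p + 1) = (L n / l) ^ (p + 1) * (a * inverse (L n) + b * (ln (L n) / L n))"
      proof -
        have "L n \<noteq> 0" using L1[of n] by auto
        then show ?thesis using l by (simp add: power_divide field_simps)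
      qed
      finally show "norm (((\<Sum>j\<le>n. \<mu> j) - upper_sum I s (1 / real n)) / ln (real n + 1) ^ (p + 1))
       \<le> (L n / ln (real n + 1)) ^ (p + 1) * (a * inverse (L n) + b * (ln (L n) / L n))"
        using l by (simp add: l_def)
    qed
  qed
qed

section \<open>Products of families of singular values\<close>

lemma product_level_set:
  assumes r: "vanishing_on J r" and s: "\<And>p. p \<in> I \<Longrightarrow> 0 < s p \<and> s p \<le> c" and c: "c > 0" and \<epsilon>: "\<epsilon> > 0"
  shows "{z\<in>J \<times> I. \<epsilon> < (case z of (q, p) \<Rightarrow> r q * s p)} =
    (SIGMA q:{q\<in>J. \<epsilon> / c < r q}. {p\<in>I. \<epsilon> / r q < s p})" (is "?L = ?R")
proof (intro equalityI subsetI)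
  fix z assume "z \<in> ?L"
  then obtain q p where z: "z = (q, p)" "q \<in> J" "p \<in> I" "\<epsilon> < r q * s p" by auto
  have rq: "r q > 0" using r z(2) by (simp add: vanishing_on_def)
  have "r q * s p \<le> r q * c" using s[OF z(3)] rq by (intro mult_left_mono) auto
  then have "\<epsilon> < r q * c" using z(4) by simp
  then show "z \<in> ?R" using z rq c by (simp add: pos_divide_less_eq mult.commute)
next
  fix z assume "z \<in> ?R"
  then obtain q p where z: "z = (q, p)" "q \<in> J" "p \<in> I" "\<epsilon> / r q < s p" by auto
  have rq: "r q > 0" using r z(2) by (simp add: vanishing_on_def)
  then show "z \<in> ?L" using z by (simp add: pos_divide_less_eq mult.commute)
qed

text \<open>
  Fubini for the level sets of a product. Only those \<open>q\<close> with \<open>r\<^sub>q > \<epsilon> / c\<close> matter, where \<open>c\<close> bounds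
  the other factor; they are finitely many.
\<close>

lemma product_upper:
  assumes r: "vanishing_on J r" and s: "vanishing_on I s" "\<And>p. p \<in> I \<Longrightarrow> s p \<le> c" and c: "c > 0" and \<epsilon>: "\<epsilon> > 0"
  shows "upper_count (J \<times> I) (\<lambda>(q, p). r q * s p) \<epsilon> = (\<Sum>q\<in>{q\<in>J. \<epsilon> / c < r q}. upper_count I s (\<epsilon> / r q))"
    and "upper_sum (J \<times> I) (\<lambda>(q, p). r q * s p) \<epsilon> = (\<Sum>q\<in>{q\<in>J. \<epsilon> / c < r q}. r q * upper_sum I s (\<epsilon> / r q))"
proof -
  have sp: "0 < s p \<and> s p \<le> c" if "p \<in> I" for p using s that by (simp add: vanishing_on_def)
  have rp: "r q > 0" if "q \<in> J" for q using r that by (simp add: vanishing_on_def)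
  have eq: "{z\<in>J \<times> I. \<epsilon> < (case z of (q, p) \<Rightarrow> r q * s p)} =
      (SIGMA q:{q\<in>J. \<epsilon> / c < r q}. {p\<in>I. \<epsilon> / r q < s p})"
    by (rule product_level_set[OF r sp c \<epsilon>])
  have fin: "finite {q\<in>J. \<epsilon> / c < r q}" using vanishing_on_finite[OF r] c \<epsilon> by simp
  have fin': "finite {p\<in>I. \<epsilon> / r q < s p}" if "q \<in> {q\<in>J. \<epsilon> / c < r q}" for q
    using vanishing_on_finite[OF s(1)] rp that \<epsilon> by simp
  show "upper_count (J \<times> I) (\<lambda>(q, p). r q * s p) \<epsilon> = (\<Sum>q\<in>{q\<in>J. \<epsilon> / c < r q}. upper_count I s (\<epsilon> / r q))"
    unfolding upper_count_def eq using fin fin' by (subst card_SigmaI) auto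
  have "upper_sum (J \<times> I) (\<lambda>(q, p). r q * s p) \<epsilon> =
      (\<Sum>q\<in>{q\<in>J. \<epsilon> / c < r q}. \<Sum>p\<in>{p\<in>I. \<epsilon> / r q < s p}. r q * s p)"
    unfolding upper_sum_def eq using fin fin' by (subst sum.Sigma) auto
  then show "upper_sum (J \<times> I) (\<lambda>(q, p). r q * s p) \<epsilon> = (\<Sum>q\<in>{q\<in>J. \<epsilon> / c < r q}. r q * upper_sum I s (\<epsilon> / r q))"
    by (simp add: upper_sum_def sum_distrib_left)
qed

text \<open>
  Summing \<open>N(\<epsilon> / r\<^sub>q) \<le> C r\<^sub>q / \<epsilon>\<close> over the finitely many relevant \<open>q\<close> leaves a constant multiple of
  \<open>1/\<epsilon>\<close> times a sum of large \<open>r\<^sub>q\<close>.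
\<close>

lemma log_count_product:
  assumes J: "log_growth p J r" and I: "log_count 0 I s"
  shows "log_count p (J \<times> I) (\<lambda>(q, p). r q * s p)"
proof -
  obtain C where s: "vanishing_on I s" and C: "C \<ge> 0" "\<And>\<epsilon>. \<epsilon> > 0 \<Longrightarrow> real (upper_count I s \<epsilon>) \<le> C / \<epsilon>"
    using I by (auto simp: log_count_def)
  obtain K where r: "vanishing_on J r" and K: "K \<ge> 0" "\<And>x. x > 0 \<Longrightarrow> upper_sum J r (1 / x) \<le> K * log_weight x ^ p"
    using J by (auto simp: log_growth_def)
  obtain c where c: "c > 0" "\<And>i. i \<in> I \<Longrightarrow> s i \<le> c" using vanishing_on_bounded[OF s] by blast
  have rp: "r q > 0" if "q \<in> J" for q using r that by (simp add: vanishing_on_def)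
  have bound: "real (upper_count (J \<times> I) (\<lambda>(q, p). r q * s p) \<epsilon>) \<le> C * K * log_weight c ^ p / \<epsilon> * log_weight (1 / \<epsilon>) ^ p"
    if \<epsilon>: "\<epsilon> > 0" for \<epsilon>
  proof -
    have "real (upper_count (J \<times> I) (\<lambda>(q, p). r q * s p) \<epsilon>) = (\<Sum>q\<in>{q\<in>J. \<epsilon> / c < r q}. real (upper_count I s (\<epsilon> / r q)))"
      using product_upper(1)[OF r s c(2) c(1) \<epsilon>] by simp
    also have "\<dots> \<le> (\<Sum>q\<in>{q\<in>J. \<epsilon> / c < r q}. C / \<epsilon> * r q)"
    proof (rule sum_mono)
      fix q assume "q \<in> {q\<in>J. \<epsilon> / c < r q}"
      then have "\<epsilon> / r q > 0" using rp \<epsilon> by simp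
      then show "real (upper_count I s (\<epsilon> / r q)) \<le> C / \<epsilon> * r q" using C(2)[of "\<epsilon> / r q"] by simp
    qed
    also have "\<dots> = C / \<epsilon> * upper_sum J r (1 / (c * (1 / \<epsilon>)))"
      by (simp add: upper_sum_def sum_distrib_left)
    also have "\<dots> \<le> C / \<epsilon> * (K * log_weight (c * (1 / \<epsilon>)) ^ p)"
      using C(1) \<epsilon> c by (intro mult_left_mono K(2)) auto
    also have "\<dots> \<le> C / \<epsilon> * (K * (log_weight c ^ p * log_weight (1 / \<epsilon>) ^ p))"
      using C(1) \<epsilon> c K(1) by (intro mult_left_mono log_weight_power_mult) auto
    finally show ?thesis by (simp add: mult_ac)
  qed
  have "vanishing_on (J \<times> I) (\<lambda>(q, p). r q * s p)"
    unfolding vanishing_on_def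
  proof (intro conjI ballI allI impI)
    have sp: "0 < s p \<and> s p \<le> c" if "p \<in> I" for p using s c(2) that by (simp add: vanishing_on_def)
    show "0 < (case z of (q, p) \<Rightarrow> r q * s p)" if "z \<in> J \<times> I" for z using that rp sp by auto
    fix \<epsilon> :: real assume \<epsilon>: "\<epsilon> > 0"
    have "{z\<in>J \<times> I. \<epsilon> < (case z of (q, p) \<Rightarrow> r q * s p)} =
        (SIGMA q:{q\<in>J. \<epsilon> / c < r q}. {p\<in>I. \<epsilon> / r q < s p})"
      by (rule product_level_set[OF r sp c(1) \<epsilon>])
    also have "finite \<dots>"
      using vanishing_on_finite[OF r] vanishing_on_finite[OF s] c(1) \<epsilon> rp by (intro finite_SigmaI) auto
    finally show "finite {z\<in>J \<times> I. \<epsilon> < (case z of (q, p) \<Rightarrow> r q * s p)}" .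
  qed
  moreover have "0 \<le> C * K * log_weight c ^ p" using C(1) K(1) c(1) log_weight_ge_1[of c] by simp
  ultimately show ?thesis using bound unfolding log_count_def by blast
qed

definition prod_weight :: "nat set \<Rightarrow> (nat \<Rightarrow> 'i \<Rightarrow> real) \<Rightarrow> (nat \<Rightarrow> 'i) \<Rightarrow> real" where
  "prod_weight S s m = (\<Prod>i\<in>S. s i (m i))"

lemma common_bound:
  fixes I :: "nat \<Rightarrow> 'i set"
  assumes "finite S" "\<And>i. i \<in> S \<Longrightarrow> vanishing_on (I i) (s i)"
  obtains c where "c \<ge> (1::real)" "\<And>i j. i \<in> S \<Longrightarrow> j \<in> I i \<Longrightarrow> s i j \<le> c"
proof -
  have "\<exists>c>0. \<forall>j\<in>I i. s i j \<le> c" if "i \<in> S" for i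
    using vanishing_on_bounded[OF assms(2)[OF that]] by metis
  then obtain c where c: "\<And>i. i \<in> S \<Longrightarrow> 0 < c i" "\<And>i j. i \<in> S \<Longrightarrow> j \<in> I i \<Longrightarrow> s i j \<le> c i" by metis
  have "c i \<le> 1 + sum c S" if "i \<in> S" for i
    using member_le_sum[of i S c] c(1) that assms(1) by (simp add: less_imp_le)
  moreover have "sum c S \<ge> 0" using c(1) by (simp add: sum_nonneg less_imp_le)
  ultimately show thesis using that[of "1 + sum c S"] c(2) by fastforce
qed

lemma prod_weight_factor_bound:
  assumes S: "finite S" and c: "c \<ge> 1" "\<And>i j. i \<in> S \<Longrightarrow> j \<in> I i \<Longrightarrow> 0 < s i j \<and> s i j \<le> c"
    and m: "m \<in> PiE S I" and i: "i \<in> S"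
  shows "prod_weight S s m \<le> s i (m i) * c ^ card S"
proof -
  have mi: "0 < s j (m j)" "s j (m j) \<le> c" if "j \<in> S" for j using c(2) m that by auto
  have eq: "prod_weight S s m = s i (m i) * (\<Prod>j\<in>S - {i}. s j (m j))"
    unfolding prod_weight_def by (rule prod.remove[OF S i])
  have "(\<Prod>j\<in>S - {i}. s j (m j)) \<le> (\<Prod>j\<in>S - {i}. c)"
    by (rule prod_mono) (use mi in \<open>auto simp: less_imp_le\<close>)
  also have "(\<Prod>j\<in>S - {i}. c) = c ^ card (S - {i})" by simp
  also have "c ^ card (S - {i}) \<le> c ^ card S"
    using c(1) S by (intro power_increasing card_mono) auto
  finally show ?thesis unfolding eq using mi[OF i] by (intro mult_left_mono) auto
qed

lemma prod_weight_level_subset: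
  assumes S: "finite S" and c: "c \<ge> 1" "\<And>i j. i \<in> S \<Longrightarrow> j \<in> I i \<Longrightarrow> 0 < s i j \<and> s i j \<le> c"
  shows "{m\<in>PiE S I. \<epsilon> < prod_weight S s m} \<subseteq> PiE S (\<lambda>i. {j\<in>I i. \<epsilon> / c ^ card S < s i j})"
proof
  fix m assume m: "m \<in> {m\<in>PiE S I. \<epsilon> < prod_weight S s m}"
  have "\<epsilon> / c ^ card S < s i (m i)" if "i \<in> S" for i
  proof -
    have "\<epsilon> < s i (m i) * c ^ card S"
    proof -
      have "prod_weight S s m \<le> s i (m i) * c ^ card S"
        by (rule prod_weight_factor_bound[where I=I, OF S c(1)]) (use c(2) m that in auto)
      then show ?thesis using m by auto
    qed
    then show ?thesis using c(1) by (simp add: divide_less_eq)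
  qed
  then show "m \<in> PiE S (\<lambda>i. {j\<in>I i. \<epsilon> / c ^ card S < s i j})" using m by (auto simp: PiE_iff)
qed

lemma vanishing_on_prod_weight:
  assumes S: "finite S" and v: "\<And>i. i \<in> S \<Longrightarrow> vanishing_on (I i) (s i)"
  shows "vanishing_on (PiE S I) (prod_weight S s)"
proof -
  obtain c where c: "c \<ge> (1::real)" "\<And>i j. i \<in> S \<Longrightarrow> j \<in> I i \<Longrightarrow> s i j \<le> c"
    using common_bound[of S I s] S v by metis
  have pos: "0 < s i j" if "i \<in> S" "j \<in> I i" for i j using v that by (auto simp: vanishing_on_def)
  have "0 < prod_weight S s m" if "m \<in> PiE S I" for m
    unfolding prod_weight_def by (rule prod_pos) (use pos that in auto)
  moreover have "finite {m\<in>PiE S I. \<epsilon> < prod_weight S s m}" if "\<epsilon> > 0" for \<epsilon>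
  proof (rule finite_subset[OF prod_weight_level_subset[OF S c(1)]])
    show "finite (PiE S (\<lambda>i. {j\<in>I i. \<epsilon> / c ^ card S < s i j}))"
      using S v c(1) that by (intro finite_PiE) (auto simp: vanishing_on_def)
  qed (use c pos in auto)
  ultimately show ?thesis by (auto simp: vanishing_on_def)
qed

text \<open>
  A product of weights bounded by \<open>c\<close> can only be large if every factor is, so its level set lies in
  a product of level sets, over which the sum of products is a product of sums.
\<close>

lemma log_growth_prod:
  fixes I :: "nat \<Rightarrow> 'i set"
  assumes S: "finite S" and g: "\<And>i. i \<in> S \<Longrightarrow> log_growth 1 (I i) (s i)"
  shows "log_growth (card S) (PiE S I) (prod_weight S s)"
proof -
  have v: "vanishing_on (I i) (s i)" if "i \<in> S" for i using g[OF that] by (simp add: log_growth_def)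
  have pos: "0 < s i j" if "i \<in> S" "j \<in> I i" for i j using v[OF that(1)] that by (auto simp: vanishing_on_def)
  obtain c where c: "c \<ge> (1::real)" "\<And>i j. i \<in> S \<Longrightarrow> j \<in> I i \<Longrightarrow> s i j \<le> c"
    using common_bound[of S I s] S v by metis
  have "\<forall>i\<in>S. \<exists>K\<ge>0. \<forall>x>0. upper_sum (I i) (s i) (1 / x) \<le> K * log_weight x"
    using g by (simp add: log_growth_def)
  then obtain K where K: "\<And>i. i \<in> S \<Longrightarrow> K i \<ge> 0"
    "\<And>i x. i \<in> S \<Longrightarrow> x > 0 \<Longrightarrow> upper_sum (I i) (s i) (1 / x) \<le> K i * log_weight x" by metis
  define d where "d = c ^ card S"
  have d: "d > 0" using c(1) by (simp add: d_def)
  have "upper_sum (PiE S I) (prod_weight S s) (1 / x) \<le> (\<Prod>i\<in>S. K i) * log_weight d ^ card S * log_weight x ^ card S"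
    if x: "x > 0" for x
  proof -
    define G where "G i = {j\<in>I i. 1 / (d * x) < s i j}" for i
    have fin: "finite (PiE S G)" using S v d x by (intro finite_PiE) (auto simp: G_def vanishing_on_def)
    have sub: "{m\<in>PiE S I. 1 / x < prod_weight S s m} \<subseteq> PiE S G"
    proof -
      have "G = (\<lambda>i. {j\<in>I i. 1 / x / c ^ card S < s i j})"
        by (auto simp: G_def d_def fun_eq_iff mult.commute)
      then show ?thesis by (simp only:) (rule prod_weight_level_subset[OF S c(1)], use c(2) pos in auto)
    qed
    have "upper_sum (PiE S I) (prod_weight S s) (1 / x) \<le> (\<Sum>m\<in>PiE S G. prod_weight S s m)"
      unfolding upper_sum_def
    proof (rule sum_mono2[OF fin sub])
      fix m assume "m \<in> PiE S G - {m\<in>PiE S I. 1 / x < prod_weight S s m}"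
      then have "0 \<le> s i (m i)" if "i \<in> S" for i using that pos by (auto simp: G_def PiE_iff less_imp_le)
      then show "0 \<le> prod_weight S s m" unfolding prod_weight_def by (rule prod_nonneg)
    qed
    also have "\<dots> = (\<Prod>i\<in>S. upper_sum (I i) (s i) (1 / (d * x)))"
      unfolding prod_weight_def upper_sum_def G_def
      by (rule prod_sum_PiE[symmetric]) (use S v d x in \<open>auto simp: vanishing_on_def\<close>)
    also have "\<dots> \<le> (\<Prod>i\<in>S. K i * (log_weight d * log_weight x))"
    proof (rule prod_mono)
      fix i assume i: "i \<in> S"
      have "upper_sum (I i) (s i) (1 / (d * x)) \<le> K i * log_weight (d * x)" using K(2)[OF i] d x by simp
      also have "\<dots> \<le> K i * (log_weight d * log_weight x)"
        using K(1)[OF i] d x by (intro mult_left_mono log_weight_mult) auto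
      finally show "0 \<le> upper_sum (I i) (s i) (1 / (d * x)) \<and>
          upper_sum (I i) (s i) (1 / (d * x)) \<le> K i * (log_weight d * log_weight x)"
        using d x by (simp add: upper_sum_nonneg)
    qed
    also have "\<dots> = (\<Prod>i\<in>S. K i) * log_weight d ^ card S * log_weight x ^ card S"
      by (simp add: prod.distrib power_mult_distrib)
    finally show ?thesis .
  qed
  moreover have "0 \<le> (\<Prod>i\<in>S. K i) * log_weight d ^ card S"
    using K(1) d log_weight_ge_1[of d] by (intro mult_nonneg_nonneg prod_nonneg) auto
  moreover have "vanishing_on (PiE S I) (prod_weight S s)" by (rule vanishing_on_prod_weight[OF S v])
  ultimately show ?thesis unfolding log_growth_def by blast
qed

lemma slot_split:
  fixes I :: "nat \<Rightarrow> 'i set"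
  assumes S: "finite S" "i \<notin> S"
  shows "upper_count (PiE (insert i S) I) (prod_weight (insert i S) s) \<epsilon> =
      upper_count (PiE S I \<times> I i) (\<lambda>(q, p). prod_weight S s q * s i p) \<epsilon>"
    and "upper_sum (PiE (insert i S) I) (prod_weight (insert i S) s) \<epsilon> =
      upper_sum (PiE S I \<times> I i) (\<lambda>(q, p). prod_weight S s q * s i p) \<epsilon>"
proof -
  have bij: "bij_betw (\<lambda>(q, p). q(i := p)) (PiE S I \<times> I i) (PiE (insert i S) I)"
  proof (rule bij_betw_imageI)
    show "inj_on (\<lambda>(q, p). q(i := p)) (PiE S I \<times> I i)"
    proof (rule inj_onI, clarify)
      fix q p q' p' assume q: "q \<in> PiE S I" "q' \<in> PiE S I" and eq: "q(i := p) = q'(i := p')"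
      have "q j = q' j" if "j \<in> S" for j using fun_cong[OF eq, of j] S(2) that by (auto split: if_splits)
      then show "q = q' \<and> p = p'" using PiE_ext[OF q] fun_cong[OF eq, of i] by auto
    qed
    show "(\<lambda>(q, p). q(i := p)) ` (PiE S I \<times> I i) = PiE (insert i S) I"
      unfolding PiE_insert_eq by force
  qed
  have w: "prod_weight (insert i S) s (q(i := p)) = prod_weight S s q * s i p" for q p
  proof -
    have "(\<Prod>j\<in>S. s j ((q(i := p)) j)) = (\<Prod>j\<in>S. s j (q j))" by (rule prod.cong) (use S(2) in auto)
    then show ?thesis using S by (simp add: prod_weight_def)
  qed
  have w': "prod_weight (insert i S) s ((\<lambda>(q, p). q(i := p)) z) = (\<lambda>(q, p). prod_weight S s q * s i p) z" for z
    by (cases z) (simp add: w)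
  show "upper_count (PiE (insert i S) I) (prod_weight (insert i S) s) \<epsilon> =
      upper_count (PiE S I \<times> I i) (\<lambda>(q, p). prod_weight S s q * s i p) \<epsilon>"
    using upper_reindex(1)[OF bij, of "prod_weight (insert i S) s" "\<lambda>(q, p). prod_weight S s q * s i p" \<epsilon>] w' by blast
  show "upper_sum (PiE (insert i S) I) (prod_weight (insert i S) s) \<epsilon> =
      upper_sum (PiE S I \<times> I i) (\<lambda>(q, p). prod_weight S s q * s i p) \<epsilon>"
    using upper_reindex(2)[OF bij, of "prod_weight (insert i S) s" "\<lambda>(q, p). prod_weight S s q * s i p" \<epsilon>] w' by blast
qed

lemma log_growth_slots:
  fixes I :: "nat \<Rightarrow> 'i set"
  assumes "i \<le> k" "\<And>j. j \<le> k \<Longrightarrow> j \<noteq> i \<Longrightarrow> log_count 0 (I j) (s j)"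
  shows "log_growth k (PiE ({..k} - {i}) I) (prod_weight ({..k} - {i}) s)"
proof -
  have "log_growth (card ({..k} - {i})) (PiE ({..k} - {i}) I) (prod_weight ({..k} - {i}) s)"
    by (rule log_growth_prod, simp, rule log_count_0_growth, rule assms(2)) auto
  then show ?thesis using assms(1) by simp
qed

lemma log_count_slots:
  fixes I :: "nat \<Rightarrow> 'i set"
  assumes I: "\<And>i. i \<le> k \<Longrightarrow> log_count 0 (I i) (s i)"
  shows "log_count k (PiE {..k} I) (prod_weight {..k} s)"
proof -
  define S where "S = {..k} - {k}"
  have S: "finite S" "k \<notin> S" "{..k} = insert k S" by (auto simp: S_def)
  have g: "log_growth k (PiE S I) (prod_weight S s)" unfolding S_def by (rule log_growth_slots) (use I in auto)
  have "log_count k (PiE S I \<times> I k) (\<lambda>(q, p). prod_weight S s q * s k p)"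
    by (rule log_count_product[OF g I]) simp
  moreover have "vanishing_on (PiE {..k} I) (prod_weight {..k} s)"
    by (rule vanishing_on_prod_weight) (use I in \<open>auto simp: log_count_def\<close>)
  ultimately show ?thesis unfolding log_count_def S(3) slot_split[OF S(1,2)] by blast
qed

section \<open>The ideals and their positive elements\<close>

lemma log_count_I_ideal:
  assumes S: "singular_system T I e f s" and c: "log_count k I s"
  shows "T \<in> I_ideal k"
proof -
  have T: "compact_op T" by (rule singular_system_compact[OF S])
  obtain C where C: "C \<ge> 0" "\<And>n. singular_value n T \<le> C * log_weight (real n) ^ k / (real n + 1)"
    using log_count_sequence[OF c singular_system_singular_value[OF S]] by blast
  have "(\<lambda>n. singular_value n T) \<in> O(\<lambda>n. g_fun k (real n))"
  proof (rule bigoI[of _ "C * 3 ^ k"])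
    have "\<forall>\<^sub>F n in sequentially. real n \<ge> exp 1 ^ k"
      using filterlim_real_sequentially unfolding filterlim_at_top by blast
    then show "\<forall>\<^sub>F n in sequentially. norm (singular_value n T) \<le> C * 3 ^ k * norm (g_fun k (real n))"
      using eventually_ge_at_top[of 3]
    proof eventually_elim
      case (elim n)
      have n0: "real n > 0" using elim by simp
      have g: "g_fun k (real n) = ln (real n) ^ k / real n" using elim by (simp add: g_fun_def indicator_def)
      have l1: "1 \<le> ln (real n)"
      proof -
        have "exp 1 \<le> real n" using exp_le elim by linarith
        then show ?thesis using ln_ge_iff n0 by blast
      qed
      have "ln (1 + real n) \<le> ln (real n ^ 2)"
      proof -
        have "real n * 3 \<le> real n * real n" using elim by (intro mult_left_mono) auto
        moreover have "1 + real n \<le> real n * 3" using elim by simp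
        ultimately have "1 + real n \<le> real n ^ 2" unfolding power2_eq_square by (rule order_trans[rotated])
        then show ?thesis using n0 by (subst ln_le_cancel_iff) auto
      qed
      then have "log_weight (real n) \<le> 3 * ln (real n)" using l1 n0 by (simp add: log_weight_def ln_realpow)
      then have "log_weight (real n) ^ k \<le> (3 * ln (real n)) ^ k" using log_weight_ge_1[of "real n"] by (intro power_mono) auto
      then have "C * log_weight (real n) ^ k / (real n + 1) \<le> C * (3 * ln (real n)) ^ k / real n"
        using C(1) n0 l1 by (intro frac_le mult_left_mono) auto
      then have "singular_value n T \<le> C * 3 ^ k * (ln (real n) ^ k / real n)" using C(2)[of n] by (simp add: power_mult_distrib)
      then show ?case using singular_value_nonneg[OF T] l1 n0 by (simp add: g)
    qed
  qed
  then show ?thesis using T by (simp add: I_ideal_def)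
qed

lemma I_ideal_0: "I_ideal 0 = weak_trace_class"
proof -
  have g: "g_fun 0 (real n) = 1 / real n" if "n \<ge> 1" for n
    using that by (simp add: g_fun_def indicator_def)
  have "(\<lambda>n. g_fun 0 (real n)) \<in> \<Theta>(\<lambda>n. 1 / (real n + 1))"
  proof (rule bigthetaI')
    show "0 < (1::real)" "0 < (2::real)" by simp_all
    show "\<forall>\<^sub>F n in sequentially. 1 * norm (1 / (real n + 1)) \<le> norm (g_fun 0 (real n)) \<and>
        norm (g_fun 0 (real n)) \<le> 2 * norm (1 / (real n + 1))"
    proof (rule eventually_sequentiallyI[of 1])
      fix n :: nat assume "n \<ge> 1"
      then show "1 * norm (1 / (real n + 1)) \<le> norm (g_fun 0 (real n)) \<and>
        norm (g_fun 0 (real n)) \<le> 2 * norm (1 / (real n + 1))"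
        by (simp add: g field_simps)
    qed
  qed
  then have "O(\<lambda>n. g_fun 0 (real n)) = O(\<lambda>n. 1 / (real n + 1))"
    by (rule landau_o.big.cong_bigtheta)
  then show ?thesis by (simp add: I_ideal_def weak_trace_class_def)
qed

lemma weak_trace_class_log_count:
  assumes T: "T \<in> weak_trace_class" and S: "singular_system T I e f s"
  shows "log_count 0 I s"
proof -
  have v: "vanishing_on I s" using S by (simp add: singular_system_def)
  let ?\<mu> = "\<lambda>n. singular_value n T"
  have nn: "0 \<le> ?\<mu> n" for n using T by (simp add: weak_trace_class_def singular_value_nonneg)
  have "?\<mu> \<in> O(\<lambda>n. 1 / (real n + 1))" using T by (simp add: weak_trace_class_def)
  then obtain c where c: "c > 0" "\<forall>\<^sub>F n in sequentially. norm (?\<mu> n) \<le> c * norm (1 / (real n + 1))"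
    using landau_o.bigE by blast
  then obtain N where N: "\<And>n. n \<ge> N \<Longrightarrow> ?\<mu> n \<le> c / (real n + 1)"
    using nn by (auto simp: eventually_sequentially)
  \<comment> \<open>the finitely many terms before \<open>N\<close> are absorbed into the constant\<close>
  define C where "C = c + (\<Sum>n<N. ?\<mu> n * (real n + 1))"
  have Cc: "c \<le> C" using nn by (simp add: C_def sum_nonneg)
  have decay: "?\<mu> n * (real n + 1) \<le> C" for n
  proof (cases "n < N")
    case True
    then have "?\<mu> n * (real n + 1) \<le> (\<Sum>n<N. ?\<mu> n * (real n + 1))"
      by (intro member_le_sum) (use nn in auto)
    then show ?thesis using c(1) by (simp add: C_def)
  next
    case False
    then show ?thesis using N[of n] Cc by (simp add: pos_le_divide_eq)
  qed
  have "real (upper_count I s \<epsilon>) \<le> C / \<epsilon>" if \<epsilon>: "\<epsilon> > 0" for \<epsilon>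
  proof (cases "upper_count I s \<epsilon>")
    case (Suc m)
    then have "\<epsilon> < ?\<mu> m"
      using same_level_counts_upper[OF v singular_system_singular_value[OF S] \<epsilon>] by simp
    then have "\<epsilon> * (real m + 1) \<le> C" using mult_right_mono[of \<epsilon> "?\<mu> m" "real m + 1"] decay[of m] by linarith
    then show ?thesis using \<epsilon> Suc by (simp add: pos_le_divide_eq mult.commute add.commute)
  qed (use c(1) Cc \<epsilon> in simp)
  then show ?thesis using v c(1) Cc unfolding log_count_def by (intro conjI exI[of _ C]) auto
qed

lemma weak_trace_classI:
  assumes "singular_system T I e f s" "log_count 0 I s" shows "T \<in> weak_trace_class"
  using log_count_I_ideal[OF assms] by (simp only: I_ideal_0)

lemma weak_trace_class_approx_rank:
  assumes T: "T \<in> weak_trace_class"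
  obtains C where "C \<ge> 0" "\<And>\<epsilon>. \<epsilon> > 0 \<Longrightarrow> \<exists>n. real n \<le> C / \<epsilon> \<and> approx_rank T n \<epsilon>"
proof -
  have "compact_op T" using T by (simp add: weak_trace_class_def)
  then obtain I :: "'a set" and e f s where S: "singular_system T I e f s"
    using compact_op_has_singular_system by blast
  obtain C where "C \<ge> 0" "\<And>\<epsilon>. \<epsilon> > 0 \<Longrightarrow> real (upper_count I s \<epsilon>) \<le> C / \<epsilon>"
    using weak_trace_class_log_count[OF T S] by (auto simp: log_count_def)
  then show thesis using singular_system_approx_rank[OF S] that by blast
qed

text \<open>
  Approximation by finite rank with the right dependence on \<open>\<epsilon>\<close> characterises the weak trace class.
  This makes it a linear space, which is needed to apply linear functionals to linear combinations.
\<close>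

lemma weak_trace_class_approxI:
  assumes P: "bounded_clinear P"
    and approx: "\<And>\<epsilon>. \<epsilon> > 0 \<Longrightarrow> \<exists>n. real n \<le> C / \<epsilon> \<and> approx_rank P n \<epsilon>"
  shows "P \<in> weak_trace_class"
proof -
  have "compact_op P" using P approx by (intro compact_op_approxI) blast+
  then obtain I :: "'a set" and e f s where S: "singular_system P I e f s"
    using compact_op_has_singular_system by blast
  have bound: "real (upper_count I s \<epsilon>) \<le> C / \<epsilon>" if \<epsilon>: "\<epsilon> > 0" for \<epsilon>
  proof -
    obtain n where n: "real n \<le> C / \<epsilon>" "approx_rank P n \<epsilon>" using approx[OF \<epsilon>] by blast
    show ?thesis using upper_count_le_rank[OF S \<epsilon> n(2)] n(1) by linarith
  qed
  have "C \<ge> 0" using bound[of 1] of_nat_0_le_iff[of "upper_count I s 1"] by linarith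
  then have "log_count 0 I s"
    using bound S unfolding log_count_def singular_system_def by (intro conjI exI[of _ C]) auto
  then show ?thesis by (rule weak_trace_classI[OF S])
qed

lemma weak_trace_class_add:
  assumes S: "S \<in> weak_trace_class" and T: "T \<in> weak_trace_class"
  shows "(\<lambda>x. S x + T x) \<in> weak_trace_class"
proof -
  obtain C where C: "\<And>\<epsilon>. \<epsilon> > 0 \<Longrightarrow> \<exists>n. real n \<le> C / \<epsilon> \<and> approx_rank S n \<epsilon>"
    using weak_trace_class_approx_rank[OF S] by blast
  obtain D where D: "\<And>\<epsilon>. \<epsilon> > 0 \<Longrightarrow> \<exists>n. real n \<le> D / \<epsilon> \<and> approx_rank T n \<epsilon>"
    using weak_trace_class_approx_rank[OF T] by blast
  show ?thesis
  proof (rule weak_trace_class_approxI[where C="2 * (C + D)"])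
    show "bounded_clinear (\<lambda>x. S x + T x)"
      using S T by (intro bounded_clinear_sum_op) (auto simp: weak_trace_class_def compact_op_def)
    fix \<epsilon> :: real assume "\<epsilon> > 0"
    then have \<epsilon>: "\<epsilon> / 2 > 0" by simp
    obtain m n where mn: "real m \<le> C / (\<epsilon>/2)" "approx_rank S m (\<epsilon>/2)" "real n \<le> D / (\<epsilon>/2)" "approx_rank T n (\<epsilon>/2)"
      using C[OF \<epsilon>] D[OF \<epsilon>] by blast
    have "real (m + n) \<le> 2 * (C + D) / \<epsilon>" using mn(1,3) by (simp add: add_divide_distrib mult.commute distrib_left)
    moreover have "approx_rank (\<lambda>x. S x + T x) (m + n) \<epsilon>" using approx_rank_add[OF mn(2,4)] by simp
    ultimately show "\<exists>n. real n \<le> 2 * (C + D) / \<epsilon> \<and> approx_rank (\<lambda>x. S x + T x) n \<epsilon>" by blast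
  qed
qed

lemma weak_trace_class_scale:
  assumes T: "T \<in> weak_trace_class"
  shows "(\<lambda>x. c *\<^sub>C T x) \<in> weak_trace_class"
proof -
  obtain C where C: "\<And>\<epsilon>. \<epsilon> > 0 \<Longrightarrow> \<exists>n. real n \<le> C / \<epsilon> \<and> approx_rank T n \<epsilon>"
    using weak_trace_class_approx_rank[OF T] by blast
  define d where "d = cmod c + 1"
  have d: "d > 0" "cmod c \<le> d" by (auto simp: d_def add_nonneg_pos)
  show ?thesis
  proof (rule weak_trace_class_approxI[where C="C * d"])
    show "bounded_clinear (\<lambda>x. c *\<^sub>C T x)"
      using T by (intro bounded_clinear_scale_op) (auto simp: weak_trace_class_def compact_op_def)
    fix \<epsilon> :: real assume \<epsilon>: "\<epsilon> > 0"
    then have \<epsilon>d: "\<epsilon> / d > 0" using d by simp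
    then obtain n where n: "real n \<le> C / (\<epsilon> / d)" "approx_rank T n (\<epsilon> / d)" using C by blast
    have "cmod c * (\<epsilon> / d) \<le> d * (\<epsilon> / d)" using d \<epsilon>d by (intro mult_right_mono) auto
    then have "cmod c * (\<epsilon> / d) \<le> \<epsilon>" using d by simp
    then have "approx_rank (\<lambda>x. c *\<^sub>C T x) n \<epsilon>" by (rule approx_rank_mono[OF approx_rank_scale[OF n(2)]])
    then show "\<exists>n. real n \<le> C * d / \<epsilon> \<and> approx_rank (\<lambda>x. c *\<^sub>C T x) n \<epsilon>" using n(1) by auto
  qed
qed

lemma positive_op_symmetric:
  assumes T: "positive_op T"
  shows "cinner (T x) y = cinner x (T y)"
proof -
  have lin: "bounded_clinear T" using T by (simp add: positive_op_def)
  have real: "Im (cinner z (T z)) = 0" for z using T by (auto simp: positive_op_def complex_is_Real_iff)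
  have ex: "cinner (x + c *\<^sub>C y) (T (x + c *\<^sub>C y)) = cinner x (T x) + c * cinner x (T y)
      + cnj c * cinner y (T x) + cnj c * c * cinner y (T y)" for c
    by (simp add: bounded_clinear_add[OF lin] bounded_clinear_scaleC[OF lin] cinner_add_left cinner_add_right
        cinner_scaleC_left cinner_scaleC_right algebra_simps)
  have "Im (cinner x (T y) + cinner y (T x)) = 0"
    using real[of "x + 1 *\<^sub>C y"] unfolding ex using real[of x] real[of y] by simp
  moreover have "Re (cinner x (T y) - cinner y (T x)) = 0"
    using real[of "x + \<i> *\<^sub>C y"] unfolding ex using real[of x] real[of y] by simp
  ultimately have "cinner x (T y) = cnj (cinner y (T x))" by (simp add: complex_eq_iff)
  then show ?thesis using cinner_commute[of "T x" y] by simp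
qed

text \<open>
  With \<open>d = e\<^sub>i - f\<^sub>i\<close> symmetry gives \<open>T d = - s\<^sub>i d\<close>, and positivity of \<open>\<langle>d, T d\<rangle>\<close> forces
  \<open>d = 0\<close>.
\<close>

lemma positive_op_singular_system:
  assumes T: "positive_op T" and S: "singular_system T I e f s" and i: "i \<in> I"
  shows "f i = e i"
proof -
  have lin: "bounded_clinear T" using T by (simp add: positive_op_def)
  have si: "s i > 0" using S i by (auto simp: singular_system_def vanishing_on_def)
  have Te: "T (e i) = complex_of_real (s i) *\<^sub>C f i" by (rule singular_system_apply[OF S i])
  have "cinner (T (f i)) z = cinner (complex_of_real (s i) *\<^sub>C e i) z" for z
    using singular_system_cinner_right[OF S i, of z] by (simp add: positive_op_symmetric[OF T] cinner_scaleC_left)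
  then have Tf: "T (f i) = complex_of_real (s i) *\<^sub>C e i"
    by (intro cinner_extensionality) (metis cinner_commute)
  define d where "d = e i - f i"
  have "T d = complex_of_real (- s i) *\<^sub>C d"
    by (simp add: d_def bounded_clinear_diff[OF lin] Te Tf scaleC.diff_right scaleC.minus_left)
  then have "Re (cinner d (T d)) = - s i * (norm d)\<^sup>2"
    by (simp add: cinner_scaleC_right cinner_self Re_power2 cinner.minus_right)
  moreover have "0 \<le> Re (cinner d (T d))" using T by (simp add: positive_op_def)
  ultimately have "0 \<le> - s i * (norm d)\<^sup>2" by linarith
  then have "norm d = 0" using si by (simp add: mult_le_0_iff)
  then show ?thesis by (simp add: d_def)
qed

lemma positive_op_approxI:
  fixes T :: "'a::complex_hilbert_space \<Rightarrow> 'a"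
  assumes lin: "bounded_clinear T"
    and approx: "\<And>\<epsilon>. \<epsilon> > 0 \<Longrightarrow> \<exists>(F::'i set) u s. (\<forall>i\<in>F. 0 \<le> s i) \<and> (\<forall>x. norm (T x - sv_sum F u u s x) \<le> \<epsilon> * norm x)"
  shows "positive_op T"
  unfolding positive_op_def
proof (intro conjI allI lin)
  fix x
  have ex: "\<exists>r\<ge>0. cmod (cinner x (T x) - complex_of_real r) \<le> \<epsilon> * (norm x)\<^sup>2" if \<epsilon>: "\<epsilon> > 0" for \<epsilon>
  proof -
    obtain F :: "'i set" and u s where F: "\<And>i. i \<in> F \<Longrightarrow> 0 \<le> s i" "norm (T x - sv_sum F u u s x) \<le> \<epsilon> * norm x"
      using approx[OF \<epsilon>] by blast
    define r where "r = (\<Sum>i\<in>F. s i * (cmod (cinner (u i) x))\<^sup>2)"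
    have "cinner x (sv_sum F u u s x) = complex_of_real r"
      unfolding sv_sum_def r_def cinner.sum_right of_real_sum
      by (rule sum.cong) (simp_all add: cinner_scaleC_right of_real_cmod_square cinner_commute[of x "u _"])
    then have "cmod (cinner x (T x) - complex_of_real r) = cmod (cinner x (T x - sv_sum F u u s x))"
      by (simp add: cinner.diff_right)
    also have "\<dots> \<le> norm x * norm (T x - sv_sum F u u s x)" by (rule norm_cinner_le)
    also have "\<dots> \<le> norm x * (\<epsilon> * norm x)" using F(2) by (rule mult_left_mono) simp
    finally have "cmod (cinner x (T x) - complex_of_real r) \<le> \<epsilon> * (norm x)\<^sup>2"
      by (simp add: power2_eq_square mult_ac)
    moreover have "r \<ge> 0" unfolding r_def by (rule sum_nonneg) (use F(1) in simp)
    ultimately show ?thesis by blast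
  qed
  have "\<bar>Im (cinner x (T x))\<bar> \<le> \<epsilon> * (norm x)\<^sup>2" if "\<epsilon> > 0" for \<epsilon>
    using ex[OF that] abs_Im_le_cmod[of "cinner x (T x) - complex_of_real _"] by (auto intro: order_trans)
  then have "\<bar>Im (cinner x (T x))\<bar> \<le> 0" by (rule le_of_le_all_pos[OF zero_less_one])
  then show "cinner x (T x) \<in> \<real>" by (simp add: complex_is_Real_iff)
  have "- Re (cinner x (T x)) \<le> \<epsilon> * (norm x)\<^sup>2" if \<epsilon>: "\<epsilon> > 0" for \<epsilon>
  proof -
    obtain r where r: "r \<ge> 0" "cmod (cinner x (T x) - complex_of_real r) \<le> \<epsilon> * (norm x)\<^sup>2" using ex[OF \<epsilon>] by blast
    then show ?thesis using abs_Re_le_cmod[of "cinner x (T x) - complex_of_real r"] by simp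
  qed
  then have "- Re (cinner x (T x)) \<le> 0" by (rule le_of_le_all_pos[OF zero_less_one])
  then show "0 \<le> Re (cinner x (T x))" by simp
qed

lemma singular_system_positive:
  fixes e :: "'i \<Rightarrow> 'a::complex_hilbert_space"
  assumes S: "singular_system T I e e s"
  shows "positive_op T"
proof (rule positive_op_approxI[where 'i='i])
  show "bounded_clinear T" using S by (simp add: singular_system_def)
  fix \<epsilon> :: real assume "\<epsilon> > 0"
  then have "\<forall>i\<in>{i\<in>I. \<epsilon> < s i}. 0 \<le> s i" "\<forall>x. norm (T x - sv_sum {i\<in>I. \<epsilon> < s i} e e s x) \<le> \<epsilon> * norm x"
    using S by (auto simp: singular_system_def)
  then show "\<exists>(F::'i set) u s. (\<forall>i\<in>F. 0 \<le> s i) \<and> (\<forall>x. norm (T x - sv_sum F u u s x) \<le> \<epsilon> * norm x)" by blast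
qed

lemma sv_sum_polarize:
  fixes e f :: "'i \<Rightarrow> 'a::complex_hilbert_space"
  assumes z: "cmod \<zeta> = 1" and u: "\<And>i. u i = f i + \<zeta> *\<^sub>C e i"
  shows "sv_sum F u u s x = sv_sum F f f s x + \<zeta> *\<^sub>C sv_sum F f e s x
     + cnj \<zeta> *\<^sub>C sv_sum F e f s x + sv_sum F e e s x"
proof -
  have "\<zeta> * cnj \<zeta> = 1" using of_real_cmod_square[of \<zeta>] z by simp
  then have 1: "cnj \<zeta> * \<zeta> = 1" by (simp add: mult.commute)
  have "(complex_of_real a * cinner (p + \<zeta> *\<^sub>C q) x) *\<^sub>C (p + \<zeta> *\<^sub>C q) =
     (complex_of_real a * cinner p x) *\<^sub>C p + \<zeta> *\<^sub>C ((complex_of_real a * cinner p x) *\<^sub>C q)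
     + cnj \<zeta> *\<^sub>C ((complex_of_real a * cinner q x) *\<^sub>C p) + (complex_of_real a * cinner q x) *\<^sub>C q"
    for a and p q :: 'a
  proof -
    have "(complex_of_real a * (cnj \<zeta> * cinner q x)) * \<zeta> = (cnj \<zeta> * \<zeta>) * (complex_of_real a * cinner q x)"
      by (simp only: mult_ac)
    then have "(complex_of_real a * (cnj \<zeta> * cinner q x)) * \<zeta> = complex_of_real a * cinner q x" using 1 by simp
    then show ?thesis
      by (simp add: cinner_add_left cinner_scaleC_left scaleC_add_left scaleC_add_right scaleC_scaleC
          distrib_left mult_ac)
  qed
  then show ?thesis
    unfolding sv_sum_def u by (simp add: sum.distrib scaleC.sum_right)
qed

text \<open>
  Polarisation of the singular value expansion. For a fourth root of unity \<open>\<zeta>\<close> put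
  \<open>P\<^sub>\<zeta> = \<Sum> s\<^sub>i \<langle>u\<^sub>i, \<cdot>\<rangle> u\<^sub>i\<close> with \<open>u\<^sub>i = f\<^sub>i + \<zeta> e\<^sub>i\<close>. It is positive, and
  \<open>\<Sum> \<zeta> P\<^sub>\<zeta> = 4 A\<close> because \<open>\<Sum> \<zeta> = \<Sum> \<zeta>\<^sup>2 = 0\<close>. The \<open>u\<^sub>i\<close> are not orthogonal, so \<open>P\<^sub>\<zeta>\<close> is
  written as a combination of four operators that have singular systems with the weights of \<open>A\<close>.
\<close>

lemma weak_trace_class_positive_parts:
  assumes A: "A \<in> weak_trace_class"
  shows "\<exists>P. (\<forall>q<4. P q \<in> weak_trace_class \<and> positive_op (P q)) \<and>
     (\<forall>x. A x = (\<Sum>q<4::nat. (\<i> ^ q / 4) *\<^sub>C P q x))"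
proof -
  have "compact_op A" using A by (simp add: weak_trace_class_def)
  then obtain I :: "nat set" and e f s where S: "singular_system A I e f s"
    using compact_op_sorted_system by blast
  have e: "orthonormal_on I e" and f: "orthonormal_on I f" and v: "vanishing_on I s"
    using S by (auto simp: singular_system_def)
  have lc: "log_count 0 I s" by (rule weak_trace_class_log_count[OF A S])
  obtain Dff where ff: "singular_system Dff I f f s" using singular_system_exists[OF v f f] by blast
  obtain Dfe where fe: "singular_system Dfe I f e s" using singular_system_exists[OF v f e] by blast
  obtain Dee where ee: "singular_system Dee I e e s" using singular_system_exists[OF v e e] by blast
  note w = weak_trace_classI[OF ff lc] weak_trace_classI[OF fe lc] weak_trace_classI[OF ee lc] A
  define P where "P q x = Dff x + \<i> ^ q *\<^sub>C Dfe x + cnj (\<i> ^ q) *\<^sub>C A x + Dee x" for q :: nat and x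
  have Pw: "P q \<in> weak_trace_class" for q
    unfolding P_def by (intro weak_trace_class_add weak_trace_class_scale w)
  have "positive_op (P q)" for q
  proof -
    define \<zeta> where "\<zeta> = \<i> ^ q"
    have z: "cmod \<zeta> = 1" by (simp add: \<zeta>_def norm_power)
    define u where "u i = f i + \<zeta> *\<^sub>C e i" for i
    \<comment> \<open>\<open>P q\<close> is the limit of the positive finite sums with the vectors \<open>u i\<close>, although these are not orthogonal\<close>
    have app: "norm (P q x - sv_sum {i\<in>I. \<epsilon>/4 < s i} u u s x) \<le> \<epsilon> * norm x" if \<epsilon>: "\<epsilon> > 0" for \<epsilon> x
    proof -
      let ?F = "{i\<in>I. \<epsilon>/4 < s i}"
      have b: "norm (Dff x - sv_sum ?F f f s x) \<le> \<epsilon>/4 * norm x" "norm (Dfe x - sv_sum ?F f e s x) \<le> \<epsilon>/4 * norm x"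
        "norm (A x - sv_sum ?F e f s x) \<le> \<epsilon>/4 * norm x" "norm (Dee x - sv_sum ?F e e s x) \<le> \<epsilon>/4 * norm x"
        using ff fe S ee \<epsilon> unfolding singular_system_def by (meson zero_less_divide_iff zero_less_numeral)+
      have "P q x - sv_sum ?F u u s x = (Dff x - sv_sum ?F f f s x) + \<zeta> *\<^sub>C (Dfe x - sv_sum ?F f e s x)
         + cnj \<zeta> *\<^sub>C (A x - sv_sum ?F e f s x) + (Dee x - sv_sum ?F e e s x)"
        unfolding sv_sum_polarize[OF z u_def] P_def \<zeta>_def[symmetric] by (simp add: scaleC.diff_right)
      then have "norm (P q x - sv_sum ?F u u s x) \<le> norm (Dff x - sv_sum ?F f f s x) + norm (\<zeta> *\<^sub>C (Dfe x - sv_sum ?F f e s x))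
         + norm (cnj \<zeta> *\<^sub>C (A x - sv_sum ?F e f s x)) + norm (Dee x - sv_sum ?F e e s x)"
        by (metis (no_types, lifting) add_mono_thms_linordered_semiring(3) norm_triangle_le norm_triangle_ineq)
      then show ?thesis using b by (simp add: norm_scaleC z)
    qed
    show ?thesis
    proof (rule positive_op_approxI[where 'i=nat])
      show "bounded_clinear (P q)" using Pw by (simp add: weak_trace_class_def compact_op_def)
      fix \<epsilon> :: real assume \<epsilon>: "\<epsilon> > 0"
      have "\<forall>i\<in>{i\<in>I. \<epsilon>/4 < s i}. 0 \<le> s i" using \<epsilon> by auto
      then show "\<exists>(F::nat set) u s. (\<forall>i\<in>F. 0 \<le> s i) \<and> (\<forall>x. norm (P q x - sv_sum F u u s x) \<le> \<epsilon> * norm x)"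
        using app[OF \<epsilon>] by blast
    qed
  qed
  moreover have "A x = (\<Sum>q<4::nat. (\<i> ^ q / 4) *\<^sub>C P q x)" for x
  proof -
    have 4: "(4::nat) = Suc (Suc (Suc (Suc 0)))" by simp
    have "(\<Sum>q<4::nat. (\<i> ^ q / 4) *\<^sub>C P q x) = (\<Sum>q<4::nat. (\<i> ^ q / 4)) *\<^sub>C (Dff x + Dee x)
       + (\<Sum>q<4::nat. \<i> ^ q / 4 * \<i> ^ q) *\<^sub>C Dfe x + (\<Sum>q<4::nat. \<i> ^ q / 4 * cnj (\<i> ^ q)) *\<^sub>C A x"
      by (simp add: P_def scaleC_add_right scaleC_scaleC sum.distrib scaleC.sum_left)
    also have "(\<Sum>q<4::nat. (\<i> ^ q / 4)) = 0" by (simp add: 4 complex_eq_iff)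
    also have "(\<Sum>q<4::nat. \<i> ^ q / 4 * \<i> ^ q) = 0" by (simp add: 4 complex_eq_iff)
    also have "(\<Sum>q<4::nat. \<i> ^ q / 4 * cnj (\<i> ^ q)) = 1" by (simp add: 4 complex_eq_iff)
    finally show ?thesis by (simp add: scaleC.zero_left complex_vector.scale_one)
  qed
  ultimately show ?thesis using Pw by blast
qed

section \<open>Tensor products of compact operators\<close>

definition tensor_vec :: "((nat \<Rightarrow> 'a) \<Rightarrow> 'b) \<Rightarrow> (nat \<Rightarrow> 'i \<Rightarrow> 'a) \<Rightarrow> (nat \<Rightarrow> 'i) \<Rightarrow> 'b" where
  "tensor_vec t e m = t (\<lambda>i. e i (m i))"

locale tensor_power =
  fixes k :: nat and t :: "(nat \<Rightarrow> 'a::complex_hilbert_space) \<Rightarrow> 'b::complex_hilbert_space"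
  assumes tensor: "hilbert_tensor_power k t"

begin

lemma t_cong: "(\<And>i. i \<le> k \<Longrightarrow> x i = y i) \<Longrightarrow> t x = t y"
  using tensor unfolding hilbert_tensor_power_def by blast

lemma t_add: "i \<le> k \<Longrightarrow> t (x(i := u + v)) = t (x(i := u)) + t (x(i := v))"
  using tensor unfolding hilbert_tensor_power_def by blast

lemma t_scaleC: "i \<le> k \<Longrightarrow> t (x(i := c *\<^sub>C u)) = c *\<^sub>C t (x(i := u))"
  using tensor unfolding hilbert_tensor_power_def by blast

lemma cinner_t: "cinner (t x) (t y) = (\<Prod>i\<le>k. cinner (x i) (y i))"
  using tensor unfolding hilbert_tensor_power_def by blast

lemma norm_t: "(norm (t x))\<^sup>2 = (\<Prod>i\<le>k. (norm (x i))\<^sup>2)"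
proof -
  have "complex_of_real ((norm (t x))\<^sup>2) = complex_of_real (\<Prod>i\<le>k. (norm (x i))\<^sup>2)"
    unfolding cinner_self[symmetric] cinner_t of_real_prod ..
  then show ?thesis using of_real_eq_iff by blast
qed

text \<open>
  Elementary tensors have dense span.
\<close>

lemma bounded_clinear_tensor_unique:
  assumes B: "bounded_clinear B" "bounded_clinear B'" and eq: "\<And>x. B (t x) = B' (t x)"
  shows "B = (B' :: 'b \<Rightarrow> 'b)"
proof -
  define D where "D = {x. B x = B' x}"
  have "complex_vector.subspace D"
    by (rule complex_vector.subspaceI)
      (auto simp: D_def bounded_clinear_add[OF B(1)] bounded_clinear_add[OF B(2)] bounded_clinear_zero[OF B(1)]
        bounded_clinear_zero[OF B(2)] bounded_clinear_scaleC[OF B(1)] bounded_clinear_scaleC[OF B(2)])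
  then have "cspan (range t) \<subseteq> D" using eq by (intro complex_vector.span_minimal) (auto simp: D_def)
  moreover have "closed D"
    unfolding D_def using B
    by (intro closed_Collect_eq linear_continuous_on) (auto simp: bounded_clinear_def)
  ultimately have "closure (cspan (range t)) \<subseteq> D" by (rule closure_minimal)
  then have "D = UNIV" using tensor by (auto simp: hilbert_tensor_power_def)
  then show ?thesis by (auto simp: D_def)
qed

lemma tensor_op_eqI:
  assumes "bounded_clinear B" "\<And>x. B (t x) = t (\<lambda>i. A i (x i))"
  shows "tensor_op t A = B"
  unfolding tensor_op_def
proof (rule the_equality)
  fix C assume C: "bounded_clinear C \<and> (\<forall>x. C (t x) = t (\<lambda>i. A i (x i)))"
  then show "C = B" by (intro bounded_clinear_tensor_unique) (use assms in auto)
qed (use assms in simp)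

lemma orthonormal_tensor_vec:
  assumes "\<And>i. i \<le> k \<Longrightarrow> orthonormal_on (I i) (e i)"
  shows "orthonormal_on (PiE {..k} I) (tensor_vec t e)"
  unfolding orthonormal_on_def
proof (intro ballI)
  fix m n assume m: "m \<in> PiE {..k} I" and n: "n \<in> PiE {..k} I"
  have "cinner (tensor_vec t e m) (tensor_vec t e n) = (\<Prod>i\<le>k. if m i = n i then 1 else 0)"
    unfolding tensor_vec_def cinner_t
    by (rule prod.cong) (use assms m n in \<open>auto simp: orthonormal_on_def PiE_iff\<close>)
  also have "\<dots> = (if m = n then 1 else 0)"
  proof (cases "m = n")
    case False
    then obtain i where "i \<le> k" "m i \<noteq> n i" using PiE_ext[OF m n] by blast
    then show ?thesis using False by (auto intro!: prod_zero)
  qed simp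
  finally show "cinner (tensor_vec t e m) (tensor_vec t e n) = (if m = n then 1 else 0)" .
qed

text \<open>
  Let \<open>y = t (\<lambda>i. A i (x i))\<close>. The vectors \<open>y\<close> and \<open>B (t x)\<close> have the same coefficients with respect to
  the \<open>f\<^sub>m\<close>, so a partial sum for \<open>B (t x)\<close> is the projection of \<open>y\<close> to the corresponding finite
  span. The norm of this projection is, up to a smaller index set, a product of sums, one for each
  factor, which tends to the product of the \<open>\<parallel>A i (x i)\<parallel>\<^sup>2\<close>, that is, to \<open>\<parallel>y\<parallel>\<^sup>2\<close>. Hence the
  projections converge to \<open>y\<close>.
\<close>

lemma tensor_system_apply:
  fixes I :: "nat \<Rightarrow> 'i set"
  assumes S: "\<And>i. i \<le> k \<Longrightarrow> singular_system (A i) (I i) (e i) (f i) (s i)"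
    and B: "singular_system B (PiE {..k} I) (tensor_vec t e) (tensor_vec t f) (prod_weight {..k} s)"
  shows "B (t x) = t (\<lambda>i. A i (x i))"
proof -
  define M where "M = PiE {..k} I"
  define w where "w = prod_weight {..k} s"
  define y where "y = t (\<lambda>i. A i (x i))"
  have f: "orthonormal_on (I i) (f i)" and v: "vanishing_on (I i) (s i)" if "i \<le> k" for i
    using S[OF that] by (auto simp: singular_system_def)
  have fM: "orthonormal_on M (tensor_vec t f)" unfolding M_def by (rule orthonormal_tensor_vec) (rule f)
  have wv: "vanishing_on M w" using B by (simp add: singular_system_def M_def w_def)
  have coef: "complex_of_real (w m) * cinner (tensor_vec t e m) (t x) = cinner (tensor_vec t f m) y" if "m \<in> M" for m
  proof -
    have "cinner (tensor_vec t f m) y = (\<Prod>i\<le>k. complex_of_real (s i (m i)) * cinner (e i (m i)) (x i))"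
      unfolding tensor_vec_def y_def cinner_t
    proof (rule prod.cong)
      fix i assume "i \<in> {..k}"
      then have i: "i \<le> k" "m i \<in> I i" using that by (auto simp: M_def)
      show "cinner (f i (m i)) (A i (x i)) = complex_of_real (s i (m i)) * cinner (e i (m i)) (x i)"
        by (rule singular_system_cinner_right[OF S[OF i(1)] i(2)])
    qed simp
    then show ?thesis by (simp add: tensor_vec_def cinner_t w_def prod_weight_def prod.distrib)
  qed
  define a where "a \<delta> i = (norm (A i (x i)))\<^sup>2 - (norm (A i (x i) - sv_sum {j\<in>I i. \<delta> < s i j} (e i) (f i) (s i) (x i)))\<^sup>2" for \<delta> i
  have bound: "norm (y - B (t x)) \<le> sqrt ((norm y)\<^sup>2 - (\<Prod>i\<le>k. a \<delta> i)) + \<delta> ^ (k + 1) * norm (t x)" if \<delta>: "\<delta> > 0" for \<delta>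
  proof -
    define G where "G i = {j\<in>I i. \<delta> < s i j}" for i
    define E where "E = {m\<in>M. \<delta> ^ (k + 1) < w m}"
    have G: "finite (G i)" "G i \<subseteq> I i" if "i \<le> k" for i using v[OF that] \<delta> by (auto simp: G_def vanishing_on_def)
    have E: "finite E" "E \<subseteq> M" using vanishing_on_finite[OF wv, of "\<delta> ^ (k+1)"] \<delta> by (auto simp: E_def)
    \<comment> \<open>the level \<open>\<delta>\<^bsup>k+1\<^esup>\<close> of \<open>E\<close> is chosen for this inclusion\<close>
    have "PiE {..k} G \<subseteq> E"
    proof
      fix m assume m: "m \<in> PiE {..k} G"
      have "(\<Prod>i\<in>{..k}. \<delta>) < (\<Prod>i\<in>{..k}. s i (m i))"
      proof -
        have lt: "\<delta> < s i (m i)" if "i \<le> k" for i using m that by (auto simp: G_def PiE_iff)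
        show ?thesis by (rule prod_mono_strict[of 0]) (use lt \<delta> in \<open>auto simp: less_imp_le dest: less_trans\<close>)
      qed
      then show "m \<in> E" using m G(2) by (auto simp: E_def M_def w_def prod_weight_def PiE_iff)
    qed
    then have "(\<Sum>m\<in>PiE {..k} G. (cmod (cinner (tensor_vec t f m) y))\<^sup>2) \<le> (\<Sum>m\<in>E. (cmod (cinner (tensor_vec t f m) y))\<^sup>2)"
      by (intro sum_mono2 E) auto
    moreover have "(\<Sum>m\<in>PiE {..k} G. (cmod (cinner (tensor_vec t f m) y))\<^sup>2) = (\<Prod>i\<le>k. a \<delta> i)"
    proof -
      have "(\<Sum>m\<in>PiE {..k} G. (cmod (cinner (tensor_vec t f m) y))\<^sup>2) =
          (\<Sum>m\<in>PiE {..k} G. \<Prod>i\<le>k. (cmod (cinner (f i (m i)) (A i (x i))))\<^sup>2)"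
        by (simp add: tensor_vec_def y_def cinner_t prod_norm[symmetric] prod_power_distrib)
      also have "\<dots> = (\<Prod>i\<le>k. \<Sum>j\<in>G i. (cmod (cinner (f i j) (A i (x i))))\<^sup>2)"
        by (rule prod_sum_PiE[symmetric]) (use G in auto)
      also have "\<dots> = (\<Prod>i\<le>k. a \<delta> i)"
      proof (rule prod.cong)
        fix i assume "i \<in> {..k}"
        then have i: "i \<le> k" by simp
        have "sv_sum (G i) (e i) (f i) (s i) (x i) = (\<Sum>j\<in>G i. cinner (f i j) (A i (x i)) *\<^sub>C f i j)"
          unfolding sv_sum_def
          by (rule sum.cong) (use singular_system_cinner_right[OF S[OF i]] G(2)[OF i] in auto)
        then show "(\<Sum>j\<in>G i. (cmod (cinner (f i j) (A i (x i))))\<^sup>2) = a \<delta> i"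
          using orthonormal_residual[OF f[OF i] G(2)[OF i] G(1)[OF i], of "A i (x i)"]
          by (simp add: a_def G_def)
      qed simp
      finally show ?thesis .
    qed
    moreover have svE: "sv_sum E (tensor_vec t e) (tensor_vec t f) w (t x) = (\<Sum>m\<in>E. cinner (tensor_vec t f m) y *\<^sub>C tensor_vec t f m)"
      unfolding sv_sum_def by (rule sum.cong) (use coef E(2) in auto)
    ultimately have "(norm (y - sv_sum E (tensor_vec t e) (tensor_vec t f) w (t x)))\<^sup>2 \<le> (norm y)\<^sup>2 - (\<Prod>i\<le>k. a \<delta> i)"
      using orthonormal_residual[OF fM E(2,1), of y] by simp
    then have 1: "norm (y - sv_sum E (tensor_vec t e) (tensor_vec t f) w (t x)) \<le> sqrt ((norm y)\<^sup>2 - (\<Prod>i\<le>k. a \<delta> i))"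
      by (rule real_le_rsqrt)
    have 2: "norm (B (t x) - sv_sum E (tensor_vec t e) (tensor_vec t f) w (t x)) \<le> \<delta> ^ (k+1) * norm (t x)"
      using B \<delta> unfolding singular_system_def E_def M_def w_def by (meson zero_less_power)
    have "norm (y - B (t x)) \<le> norm (y - sv_sum E (tensor_vec t e) (tensor_vec t f) w (t x))
        + norm (B (t x) - sv_sum E (tensor_vec t e) (tensor_vec t f) w (t x))"
      by (metis dist_norm dist_triangle2)
    then show ?thesis using 1 2 by linarith
  qed
  define d where "d = (\<lambda>n. 1 / real (Suc n))"
  have d: "d \<longlonglongrightarrow> 0" "\<And>n. d n > 0"
    using LIMSEQ_inverse_real_of_nat by (auto simp: d_def inverse_eq_divide)
  have alim: "(\<lambda>n. a (d n) i) \<longlonglongrightarrow> (norm (A i (x i)))\<^sup>2" if i: "i \<le> k" for i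
  proof -
    have "(\<lambda>n. norm (A i (x i) - sv_sum {j\<in>I i. d n < s i j} (e i) (f i) (s i) (x i))) \<longlonglongrightarrow> 0"
    proof (rule tendsto_sandwich[of "\<lambda>_. 0" _ _ "\<lambda>n. d n * norm (x i)"])
      show "\<forall>\<^sub>F n in sequentially. norm (A i (x i) - sv_sum {j \<in> I i. d n < s i j} (e i) (f i) (s i) (x i)) \<le> d n * norm (x i)"
        using S[OF i] d(2) by (simp add: singular_system_def)
      show "(\<lambda>n. d n * norm (x i)) \<longlonglongrightarrow> 0" using tendsto_mult_right[OF d(1)] by simp
    qed auto
    then have "(\<lambda>n. (norm (A i (x i)))\<^sup>2 - (norm (A i (x i) - sv_sum {j\<in>I i. d n < s i j} (e i) (f i) (s i) (x i)))\<^sup>2)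
        \<longlonglongrightarrow> (norm (A i (x i)))\<^sup>2 - 0\<^sup>2" by (intro tendsto_intros)
    then show ?thesis by (simp add: a_def)
  qed
  have "(\<lambda>n. sqrt ((norm y)\<^sup>2 - (\<Prod>i\<le>k. a (d n) i)) + d n ^ (k + 1) * norm (t x))
      \<longlonglongrightarrow> sqrt ((norm y)\<^sup>2 - (\<Prod>i\<le>k. (norm (A i (x i)))\<^sup>2)) + 0 ^ (k + 1) * norm (t x)"
    by (intro tendsto_intros d(1) alim) auto
  then have "(\<lambda>n. sqrt ((norm y)\<^sup>2 - (\<Prod>i\<le>k. a (d n) i)) + d n ^ (k + 1) * norm (t x)) \<longlonglongrightarrow> 0"
    by (simp add: y_def norm_t)
  then have "norm (y - B (t x)) \<le> 0" by (rule LIMSEQ_le_const) (use bound d(2) in blast)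
  then show ?thesis by (simp add: y_def)
qed

text \<open>
  The operator with the product system is bounded and acts factorwise on elementary tensors, so it is
  the tensor product. In particular the tensor product of compact operators exists.
\<close>

lemma tensor_op_singular_system:
  fixes I :: "nat \<Rightarrow> 'i set"
  assumes S: "\<And>i. i \<le> k \<Longrightarrow> singular_system (A i) (I i) (e i) (f i) (s i)"
  shows "singular_system (tensor_op t A) (PiE {..k} I) (tensor_vec t e) (tensor_vec t f) (prod_weight {..k} s)"
    and "tensor_op t A (t x) = t (\<lambda>i. A i (x i))"
proof -
  have e: "orthonormal_on (I i) (e i)" and f: "orthonormal_on (I i) (f i)" and v: "vanishing_on (I i) (s i)"
    if "i \<le> k" for i using S[OF that] by (auto simp: singular_system_def)
  have vT: "vanishing_on (PiE {..k} I) (prod_weight {..k} s)" by (rule vanishing_on_prod_weight) (use v in auto)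
  have eT: "orthonormal_on (PiE {..k} I) (tensor_vec t e)" by (rule orthonormal_tensor_vec) (rule e)
  have fT: "orthonormal_on (PiE {..k} I) (tensor_vec t f)" by (rule orthonormal_tensor_vec) (rule f)
  obtain B where B: "singular_system B (PiE {..k} I) (tensor_vec t e) (tensor_vec t f) (prod_weight {..k} s)"
    using singular_system_exists[OF vT eT fT] by (rule exE)
  have app: "B (t x) = t (\<lambda>i. A i (x i))" for x by (rule tensor_system_apply[OF S B])
  have "tensor_op t A = B" by (rule tensor_op_eqI) (use B app in \<open>auto simp: singular_system_def\<close>)
  then show "singular_system (tensor_op t A) (PiE {..k} I) (tensor_vec t e) (tensor_vec t f) (prod_weight {..k} s)"
    "tensor_op t A (t x) = t (\<lambda>i. A i (x i))" using B app by auto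
qed

lemma tensor_op_compact:
  assumes "\<And>i. i \<le> k \<Longrightarrow> compact_op (A i)"
  shows "bounded_clinear (tensor_op t A)" "tensor_op t A (t x) = t (\<lambda>i. A i (x i))"
proof -
  have "\<exists>e f. singular_system (A i) {n. 0 < singular_value n (A i)} e f (\<lambda>n. singular_value n (A i))" if "i \<le> k" for i
    by (rule compact_op_sorted_system) (rule assms[OF that])
  then obtain e f where S: "\<And>i. i \<le> k \<Longrightarrow>
      singular_system (A i) {n. 0 < singular_value n (A i)} (e i) (f i) (\<lambda>n. singular_value n (A i))"
    by metis
  show "bounded_clinear (tensor_op t A)"
    using tensor_op_singular_system(1)[where A=A and e=e and f=f, OF S] by (simp add: singular_system_def)
  show "tensor_op t A (t x) = t (\<lambda>i. A i (x i))"
    by (rule tensor_op_singular_system(2)[where A=A and e=e and f=f, OF S])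
qed

lemma tensor_op_slot_sum:
  assumes i: "i \<le> k" and A: "\<And>j. j \<le> k \<Longrightarrow> j \<noteq> i \<Longrightarrow> compact_op (A j)"
    and P: "compact_op P" "compact_op Q"
  shows "tensor_op t (A(i := (\<lambda>x. P x + Q x))) = (\<lambda>x. tensor_op t (A(i := P)) x + tensor_op t (A(i := Q)) x)"
proof (rule tensor_op_eqI)
  have c: "\<And>j. j \<le> k \<Longrightarrow> compact_op ((A(i := P)) j)" "\<And>j. j \<le> k \<Longrightarrow> compact_op ((A(i := Q)) j)"
    using A P by auto
  show "bounded_clinear (\<lambda>x. tensor_op t (A(i := P)) x + tensor_op t (A(i := Q)) x)"
    by (intro bounded_clinear_sum_op tensor_op_compact c)
  fix x
  have u: "(\<lambda>j. (A(i := R)) j (x j)) = (\<lambda>j. A j (x j))(i := R (x i))" for R by auto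
  have "tensor_op t (A(i := P)) (t x) = t (\<lambda>j. (A(i := P)) j (x j))"
    "tensor_op t (A(i := Q)) (t x) = t (\<lambda>j. (A(i := Q)) j (x j))"
    by (rule tensor_op_compact(2), rule c, assumption)+
  then show "tensor_op t (A(i := P)) (t x) + tensor_op t (A(i := Q)) (t x) = t (\<lambda>j. (A(i := (\<lambda>x. P x + Q x))) j (x j))"
    unfolding u t_add[OF i] by simp
qed

lemma tensor_op_slot_scale:
  assumes i: "i \<le> k" and A: "\<And>j. j \<le> k \<Longrightarrow> j \<noteq> i \<Longrightarrow> compact_op (A j)" and P: "compact_op P"
  shows "tensor_op t (A(i := (\<lambda>x. c *\<^sub>C P x))) = (\<lambda>x. c *\<^sub>C tensor_op t (A(i := P)) x)"
proof (rule tensor_op_eqI)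
  have c: "\<And>j. j \<le> k \<Longrightarrow> compact_op ((A(i := P)) j)" using A P by auto
  show "bounded_clinear (\<lambda>x. c *\<^sub>C tensor_op t (A(i := P)) x)"
    by (intro bounded_clinear_scale_op tensor_op_compact c)
  fix x
  have u: "(\<lambda>j. (A(i := R)) j (x j)) = (\<lambda>j. A j (x j))(i := R (x i))" for R by auto
  have "tensor_op t (A(i := P)) (t x) = t (\<lambda>j. (A(i := P)) j (x j))"
    by (rule tensor_op_compact(2), rule c, assumption)
  then show "c *\<^sub>C tensor_op t (A(i := P)) (t x) = t (\<lambda>j. (A(i := (\<lambda>x. c *\<^sub>C P x))) j (x j))"
    unfolding u t_scaleC[OF i] by simp
qed

lemma tensor_op_cong:
  assumes "\<And>i. i \<le> k \<Longrightarrow> A i = B i"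
  shows "tensor_op t A = tensor_op t B"
proof -
  have "t (\<lambda>i. A i (x i)) = t (\<lambda>i. B i (x i))" for x by (rule t_cong) (simp add: assms)
  then show ?thesis by (simp add: tensor_op_def)
qed

lemma tensor_op_positive:
  assumes A: "\<And>i. i \<le> k \<Longrightarrow> compact_op (A i)" "\<And>i. i \<le> k \<Longrightarrow> positive_op (A i)"
  shows "positive_op (tensor_op t A)"
proof -
  have "\<exists>e f. singular_system (A i) {n. 0 < singular_value n (A i)} e f (\<lambda>n. singular_value n (A i))" if "i \<le> k" for i
    by (rule compact_op_sorted_system) (rule A(1)[OF that])
  then obtain e f where S: "\<And>i. i \<le> k \<Longrightarrow>
      singular_system (A i) {n. 0 < singular_value n (A i)} (e i) (f i) (\<lambda>n. singular_value n (A i))"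
    by metis
  have T: "singular_system (A i) {n. 0 < singular_value n (A i)} (e i) (e i) (\<lambda>n. singular_value n (A i))" if i: "i \<le> k" for i
  proof -
    have "f i n = e i n" if "n \<in> {n. 0 < singular_value n (A i)}" for n
      by (rule positive_op_singular_system[OF A(2)[OF i] S[OF i] that])
    then have "sv_sum {n\<in>{n. 0 < singular_value n (A i)}. \<epsilon> < singular_value n (A i)} (e i) (f i) (\<lambda>n. singular_value n (A i)) x =
       sv_sum {n\<in>{n. 0 < singular_value n (A i)}. \<epsilon> < singular_value n (A i)} (e i) (e i) (\<lambda>n. singular_value n (A i)) x" for \<epsilon> x
      unfolding sv_sum_def by (intro sum.cong) auto
    then show ?thesis using S[OF i] by (simp add: singular_system_def)
  qed
  show ?thesis
    by (rule singular_system_positive) (rule tensor_op_singular_system(1)[where A=A and e=e and f=e, OF T])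
qed

lemma tensor_op_I_ideal:
  assumes A: "\<And>i. i \<le> k \<Longrightarrow> A i \<in> weak_trace_class"
  shows "tensor_op t A \<in> I_ideal k"
proof -
  have "\<exists>e f. singular_system (A i) {n. 0 < singular_value n (A i)} e f (\<lambda>n. singular_value n (A i))" if "i \<le> k" for i
    by (rule compact_op_sorted_system) (use A[OF that] in \<open>simp add: weak_trace_class_def\<close>)
  then obtain e f where S: "\<And>i. i \<le> k \<Longrightarrow>
      singular_system (A i) {n. 0 < singular_value n (A i)} (e i) (f i) (\<lambda>n. singular_value n (A i))"
    by metis
  show ?thesis
  proof (rule log_count_I_ideal)
    show "singular_system (tensor_op t A) (PiE {..k} (\<lambda>i. {n. 0 < singular_value n (A i)}))
       (tensor_vec t e) (tensor_vec t f) (prod_weight {..k} (\<lambda>i n. singular_value n (A i)))"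
      by (rule tensor_op_singular_system(1)[OF S])
    show "log_count k (PiE {..k} (\<lambda>i. {n. 0 < singular_value n (A i)})) (prod_weight {..k} (\<lambda>i n. singular_value n (A i)))"
      by (rule log_count_slots) (rule weak_trace_class_log_count[OF A S])
  qed
qed

end

section \<open>Logarithmic averages\<close>

text \<open>
  With \<open>r\<close> the singular values of the fixed factors and \<open>x\<^sub>N ln (N + 1)\<close> the partial sums of the
  singular values of the remaining factor, this is the normalised sum of the large products, up to
  lower order terms. The summands with \<open>n r\<^sub>q < 1\<close> are of lower order and are left out.
\<close>

definition log_average :: "nat \<Rightarrow> 'j set \<Rightarrow> ('j \<Rightarrow> real) \<Rightarrow> (nat \<Rightarrow> real) \<Rightarrow> nat \<Rightarrow> real" where
  "log_average k J r x n = (\<Sum>q\<in>{q\<in>J. 1 / real n \<le> r q}.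
     r q * ln (real (nat \<lfloor>real n * r q\<rfloor>) + 1) * x (nat \<lfloor>real n * r q\<rfloor>)) / ln (real n + 1) ^ (k + 1)"

lemma log_average_add: "log_average k J r (\<lambda>n. x n + y n) n = log_average k J r x n + log_average k J r y n"
  by (simp add: log_average_def distrib_left sum.distrib add_divide_distrib)

lemma log_average_scale: "log_average k J r (\<lambda>n. c * x n) n = c * log_average k J r x n"
  by (simp add: log_average_def sum_distrib_left mult.left_commute)

lemma log_average_nonneg:
  assumes "vanishing_on J r" "\<And>n. 0 \<le> x n" shows "0 \<le> log_average k J r x n"
  unfolding log_average_def
  by (intro divide_nonneg_nonneg sum_nonneg mult_nonneg_nonneg zero_le_power)
    (use assms in \<open>auto simp: vanishing_on_def less_imp_le\<close>)

lemma log_average_0: "log_average k J r x 0 = 0"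
  by (simp add: log_average_def)

lemma log_average_index_bounds:
  assumes J: "log_growth k J r"
  obtains K where "K \<ge> 0" "\<And>n. n \<ge> 1 \<Longrightarrow> finite {q\<in>J. 1 / real n \<le> r q}"
    "\<And>n. n \<ge> 1 \<Longrightarrow> (\<Sum>q\<in>{q\<in>J. 1 / real n \<le> r q}. r q) \<le> K * log_weight (real n) ^ k"
    "\<And>n q. n \<ge> 1 \<Longrightarrow> q \<in> J \<Longrightarrow> ln (real (nat \<lfloor>real n * r q\<rfloor>) + 1) \<le> K * log_weight (real n)"
proof -
  obtain K where r: "vanishing_on J r" and K: "K \<ge> 0" "\<And>x. x > 0 \<Longrightarrow> upper_sum J r (1 / x) \<le> K * log_weight x ^ k"
    using J by (auto simp: log_growth_def)
  obtain c where c: "c > 0" "\<And>q. q \<in> J \<Longrightarrow> r q \<le> c" using vanishing_on_bounded[OF r] by blast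
  have rp: "r q > 0" if "q \<in> J" for q using r that by (simp add: vanishing_on_def)
  define K' where "K' = max (K * log_weight 2 ^ k) (log_weight c)"
  have sub: "{q\<in>J. 1 / real n \<le> r q} \<subseteq> {q\<in>J. 1 / (2 * real n) < r q}" if "n \<ge> 1" for n
  proof -
    have "1 / (2 * real n) < 1 / real n" using that by (simp add: field_simps)
    then show ?thesis by auto
  qed
  have fin: "finite {q\<in>J. 1 / (2 * real n) < r q}" if "n \<ge> 1" for n
    using vanishing_on_finite[OF r] that by simp
  show thesis
  proof (rule that[of K'])
    show "K' \<ge> 0" using log_weight_ge_1[of c] c(1) by (simp add: K'_def le_max_iff_disj)
    fix n :: nat assume n: "n \<ge> 1"
    show "finite {q\<in>J. 1 / real n \<le> r q}" using finite_subset[OF sub[OF n] fin[OF n]] .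
    have "(\<Sum>q\<in>{q\<in>J. 1 / real n \<le> r q}. r q) \<le> upper_sum J r (1 / (2 * real n))"
      unfolding upper_sum_def by (rule sum_mono2[OF fin[OF n] sub[OF n]]) (use rp in \<open>auto simp: less_imp_le\<close>)
    also have "\<dots> \<le> K * log_weight (2 * real n) ^ k" using n by (intro K(2)) simp
    also have "\<dots> \<le> K * (log_weight 2 ^ k * log_weight (real n) ^ k)"
      using K(1) by (intro mult_left_mono log_weight_power_mult) auto
    also have "\<dots> \<le> K' * log_weight (real n) ^ k"
      unfolding mult.assoc[symmetric]
      by (intro mult_right_mono) (use log_weight_ge_1[of "real n"] in \<open>auto simp: K'_def\<close>)
    finally show "(\<Sum>q\<in>{q\<in>J. 1 / real n \<le> r q}. r q) \<le> K' * log_weight (real n) ^ k" .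
    fix q assume q: "q \<in> J"
    have "real (nat \<lfloor>real n * r q\<rfloor>) \<le> c * real n"
    proof -
      have "real (nat \<lfloor>real n * r q\<rfloor>) \<le> real n * r q" using rp[OF q] by simp
      also have "\<dots> \<le> real n * c" using c(2)[OF q] by (intro mult_left_mono) auto
      finally show ?thesis by (simp add: mult.commute)
    qed
    then have "ln (real (nat \<lfloor>real n * r q\<rfloor>) + 1) \<le> ln (1 + c * real n)"
      using c(1) by (subst ln_le_cancel_iff) (auto intro: add_pos_nonneg)
    also have "\<dots> \<le> log_weight (c * real n)" by (simp add: log_weight_def)
    also have "\<dots> \<le> log_weight c * log_weight (real n)" using c(1) by (intro log_weight_mult) auto
    also have "\<dots> \<le> K' * log_weight (real n)"
      by (intro mult_right_mono) (use log_weight_ge_1[of "real n"] in \<open>auto simp: K'_def\<close>)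
    finally show "ln (real (nat \<lfloor>real n * r q\<rfloor>) + 1) \<le> K' * log_weight (real n)" .
  qed
qed

text \<open>
  The total weight is \<open>O(ln\<^sup>k\<^sup>+\<^sup>1 n)\<close>, but the indices \<open>N < P\<close> only carry weight
  \<open>O(ln (P + 1) ln\<^sup>k n)\<close>. So the average is controlled by the tail bound \<open>Y\<close> of \<open>x\<close>, whereas the bound
  \<open>X\<close> on all terms enters with a factor that tends to \<open>0\<close>.
\<close>

lemma log_average_estimate:
  assumes J: "log_growth k J r"
  obtains K where "K \<ge> 0"
    "\<And>x X Y P n. n \<ge> 1 \<Longrightarrow> X \<ge> 0 \<Longrightarrow> Y \<ge> 0 \<Longrightarrow> (\<And>p. \<bar>x p\<bar> \<le> X) \<Longrightarrow> (\<And>p. p \<ge> P \<Longrightarrow> \<bar>x p\<bar> \<le> Y) \<Longrightarrow>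
       \<bar>log_average k J r x n\<bar> \<le> K * Y + K * X * ln (real P + 1) / ln (real n + 1)"
proof -
  have r: "vanishing_on J r" using J by (simp add: log_growth_def)
  obtain K where K: "K \<ge> 0" "\<And>n. n \<ge> 1 \<Longrightarrow> finite {q\<in>J. 1 / real n \<le> r q}"
    "\<And>n. n \<ge> 1 \<Longrightarrow> (\<Sum>q\<in>{q\<in>J. 1 / real n \<le> r q}. r q) \<le> K * log_weight (real n) ^ k"
    "\<And>n q. n \<ge> 1 \<Longrightarrow> q \<in> J \<Longrightarrow> ln (real (nat \<lfloor>real n * r q\<rfloor>) + 1) \<le> K * log_weight (real n)"
    using log_average_index_bounds[OF J] by blast
  define M where "M = max (K * K * 3 ^ (k + 1)) (K * 3 ^ k)"
  show thesis
  proof (rule that[of M])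
    show M0: "M \<ge> 0" using K(1) by (simp add: M_def le_max_iff_disj)
    fix x :: "nat \<Rightarrow> real" and X Y :: real and P n :: nat
    assume n: "n \<ge> 1" and X: "X \<ge> 0" "\<And>p. \<bar>x p\<bar> \<le> X" and Y: "Y \<ge> 0" "\<And>p. p \<ge> P \<Longrightarrow> \<bar>x p\<bar> \<le> Y"
    define A where "A = {q\<in>J. 1 / real n \<le> r q}"
    define N where "N q = nat \<lfloor>real n * r q\<rfloor>" for q
    define l where "l = ln (real n + 1)"
    define L where "L = log_weight (real n)"
    have l: "l > 0" using n by (simp add: l_def)
    have L: "L \<ge> 1" "L \<le> 3 * l" using log_weight_ge_1[of "real n"] log_weight_le_ln[OF n] by (auto simp: L_def l_def)
    have rp: "0 \<le> r q" if "q \<in> A" for q using r that by (auto simp: A_def vanishing_on_def less_imp_le)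
    have summand: "\<bar>r q * ln (real (N q) + 1) * x (N q)\<bar> \<le> K * L * Y * r q + X * ln (real P + 1) * r q" if q: "q \<in> A" for q
    proof (cases "N q \<ge> P")
      case True
      have "\<bar>r q * ln (real (N q) + 1) * x (N q)\<bar> = r q * ln (real (N q) + 1) * \<bar>x (N q)\<bar>"
        using rp[OF q] by (simp add: abs_mult)
      also have "\<dots> \<le> r q * (K * L) * Y"
        using rp[OF q] K(4)[OF n, of q] q Y(2)[OF True] Y(1) K(1) L(1)
        by (intro mult_mono mult_left_mono mult_nonneg_nonneg) (auto simp: A_def N_def L_def)
      also have "r q * (K * L) * Y = K * L * Y * r q" by (simp add: mult_ac)
      finally show ?thesis using mult_nonneg_nonneg[OF mult_nonneg_nonneg[OF X(1) ln_ge_zero] rp[OF q], of "real P + 1"]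
        by linarith
    next
      case False
      have "\<bar>r q * ln (real (N q) + 1) * x (N q)\<bar> = r q * ln (real (N q) + 1) * \<bar>x (N q)\<bar>"
        using rp[OF q] by (simp add: abs_mult)
      also have "\<dots> \<le> r q * ln (real P + 1) * X"
        using rp[OF q] False X(2)[of "N q"] by (intro mult_mono mult_left_mono mult_nonneg_nonneg) auto
      also have "\<dots> \<le> K * L * Y * r q + X * ln (real P + 1) * r q"
        using rp[OF q] K(1) L(1) Y(1) by (simp add: mult_ac)
      finally show ?thesis .
    qed
    have "\<bar>\<Sum>q\<in>A. r q * ln (real (N q) + 1) * x (N q)\<bar> \<le> (\<Sum>q\<in>A. K * L * Y * r q + X * ln (real P + 1) * r q)"
      by (rule order_trans[OF sum_abs sum_mono]) (rule summand)
    also have "\<dots> = (K * L * Y + X * ln (real P + 1)) * (\<Sum>q\<in>A. r q)"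
      by (simp add: sum.distrib sum_distrib_left distrib_right)
    also have "\<dots> \<le> (K * L * Y + X * ln (real P + 1)) * (K * L ^ k)"
      using K(3)[OF n] K(1) L(1) Y(1) X(1) by (intro mult_left_mono) (auto simp: A_def L_def)
    also have "\<dots> = K * K * L ^ (k + 1) * Y + K * L ^ k * (X * ln (real P + 1))" by (simp add: algebra_simps)
    also have "\<dots> \<le> K * K * (3 * l) ^ (k + 1) * Y + K * (3 * l) ^ k * (X * ln (real P + 1))"
      using K(1) L Y(1) X(1) by (intro add_mono mult_right_mono mult_left_mono power_mono) auto
    also have "\<dots> = (K * K * 3 ^ (k + 1)) * (Y * l ^ (k + 1)) + (K * 3 ^ k) * (X * ln (real P + 1) * l ^ k)"
      by (simp add: power_mult_distrib mult_ac)
    also have "\<dots> \<le> M * (Y * l ^ (k + 1)) + M * (X * ln (real P + 1) * l ^ k)"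
      using l Y(1) X(1) by (intro add_mono mult_right_mono) (auto simp: M_def)
    also have "\<dots> = (M * Y + M * X * ln (real P + 1) / l) * l ^ (k + 1)" using l by (simp add: field_simps)
    finally have "\<bar>\<Sum>q\<in>A. r q * ln (real (N q) + 1) * x (N q)\<bar> / l ^ (k + 1) \<le> M * Y + M * X * ln (real P + 1) / l"
      using l by (simp add: pos_divide_le_eq)
    then show "\<bar>log_average k J r x n\<bar> \<le> M * Y + M * X * ln (real P + 1) / ln (real n + 1)"
      using l by (simp add: log_average_def A_def N_def l_def abs_divide)
  qed
qed

lemma log_average_Bseq:
  assumes J: "log_growth k J r" and x: "Bseq x"
  shows "Bseq (log_average k J r x)"
proof -
  obtain X where X: "X > 0" "\<And>n. \<bar>x n\<bar> \<le> X" using x by (auto elim: BseqE)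
  obtain K where K: "K \<ge> 0"
    "\<And>x X Y P n. n \<ge> 1 \<Longrightarrow> X \<ge> 0 \<Longrightarrow> Y \<ge> 0 \<Longrightarrow> (\<And>p. \<bar>x p\<bar> \<le> X) \<Longrightarrow> (\<And>p. p \<ge> P \<Longrightarrow> \<bar>x p\<bar> \<le> Y) \<Longrightarrow>
       \<bar>log_average k J r x n\<bar> \<le> K * Y + K * X * ln (real P + 1) / ln (real n + 1)"
    using log_average_estimate[OF J] by blast
  have "\<bar>log_average k J r x n\<bar> \<le> K * X" for n
  proof (cases "n = 0")
    case False
    then show ?thesis using K(2)[of n X X x 0] X by simp
  qed (use K(1) X(1) in \<open>simp add: log_average_0\<close>)
  then show ?thesis by (intro BseqI'[of _ "K * X"]) simp
qed

lemma ln_Suc_at_top: "filterlim (\<lambda>n. ln (real n + 1)) at_top sequentially"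
proof -
  have "filterlim (\<lambda>n. ln (1 + real n)) at_top sequentially"
    by (intro filterlim_compose[OF ln_at_top] filterlim_tendsto_add_at_top[OF tendsto_const] filterlim_real_sequentially)
  then show ?thesis by (simp add: add.commute)
qed

lemma log_average_null:
  assumes J: "log_growth k J r" and x: "x \<longlonglongrightarrow> 0"
  shows "log_average k J r x \<longlonglongrightarrow> 0"
proof (rule LIMSEQ_I)
  fix \<delta> :: real assume \<delta>: "\<delta> > 0"
  have "Bseq x" using x by (meson convergentI convergent_imp_Bseq)
  then obtain X where X: "X > 0" "\<And>n. \<bar>x n\<bar> \<le> X" by (auto elim: BseqE)
  obtain K where K: "K \<ge> 0"
    "\<And>x X Y P n. n \<ge> 1 \<Longrightarrow> X \<ge> 0 \<Longrightarrow> Y \<ge> 0 \<Longrightarrow> (\<And>p. \<bar>x p\<bar> \<le> X) \<Longrightarrow> (\<And>p. p \<ge> P \<Longrightarrow> \<bar>x p\<bar> \<le> Y) \<Longrightarrow>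
       \<bar>log_average k J r x n\<bar> \<le> K * Y + K * X * ln (real P + 1) / ln (real n + 1)"
    using log_average_estimate[OF J] by blast
  have K1: "K + 1 \<noteq> 0" using K(1) by linarith
  define Y where "Y = \<delta> / 2 / (K + 1)"
  have Y: "Y > 0" using \<delta> K(1) by (simp add: Y_def)
  have KY: "K * Y < \<delta> / 2"
  proof -
    have "K * Y < (K + 1) * Y" using Y by simp
    also have "\<dots> = \<delta> / 2"
      unfolding Y_def times_divide_eq_right[of "K + 1" "\<delta> / 2" "K + 1"] by (rule nonzero_mult_div_cancel_left[OF K1])
    finally show ?thesis .
  qed
  obtain P where P: "\<And>p. p \<ge> P \<Longrightarrow> \<bar>x p\<bar> \<le> Y" using LIMSEQ_D[OF x Y] by (force intro: less_imp_le)
  have "(\<lambda>n. K * X * ln (real P + 1) / ln (real n + 1)) \<longlonglongrightarrow> 0"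
    by (rule real_tendsto_divide_at_top[OF tendsto_const ln_Suc_at_top])
  then obtain N where N: "\<And>n. n \<ge> N \<Longrightarrow> \<bar>K * X * ln (real P + 1) / ln (real n + 1)\<bar> < \<delta> / 2"
    using LIMSEQ_D[of _ 0 "\<delta>/2"] \<delta> by fastforce
  have "norm (log_average k J r x n - 0) < \<delta>" if "n \<ge> max N 1" for n
  proof -
    have "\<bar>log_average k J r x n\<bar> \<le> K * Y + K * X * ln (real P + 1) / ln (real n + 1)"
      using that X Y by (intro K(2)) (auto intro: P)
    moreover have "\<bar>K * X * ln (real P + 1) / ln (real n + 1)\<bar> < \<delta> / 2" using N that by simp
    ultimately show ?thesis unfolding real_norm_def diff_0_right using KY by linarith
  qed
  then show "\<exists>no. \<forall>n\<ge>no. norm (log_average k J r x n - 0) < \<delta>" by blast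
qed

text \<open>
  Put \<open>N = n r\<^sub>q\<close>. For \<open>N \<ge> 1\<close> the sum of the \<open>s\<^sub>p > 1/N\<close> differs by a bounded amount from the sum of
  the first \<open>N\<close> terms of \<open>\<mu>\<close>, and for \<open>N < 1\<close> it is bounded. In total the error is at most a
  constant times the sum of the \<open>r\<^sub>q > 1/(c n)\<close>, which is \<open>O(ln\<^sup>k n)\<close>.
\<close>

lemma product_upper_sum_log_average:
  assumes J: "log_growth k J r" and I: "log_count 0 I s" and m: "same_level_counts I s \<mu>"
  shows "(\<lambda>n. upper_sum (J \<times> I) (\<lambda>(q, p). r q * s p) (1 / real n) / ln (real n + 1) ^ (k + 1)
     - log_average k J r (\<lambda>n. (\<Sum>j\<le>n. \<mu> j) / ln (real n + 1)) n) \<longlonglongrightarrow> 0"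
proof -
  have s: "vanishing_on I s" using I by (simp add: log_count_def)
  obtain K1 where K1: "K1 \<ge> 0" "\<And>x. x \<ge> 1 \<Longrightarrow> \<bar>upper_sum I s (1 / x) - (\<Sum>j\<le>nat \<lfloor>x\<rfloor>. \<mu> j)\<bar> \<le> K1"
    using partial_sum_upper_sum_bounded[OF I m] by blast
  obtain K where r: "vanishing_on J r" and K: "K \<ge> 0" "\<And>x. x > 0 \<Longrightarrow> upper_sum J r (1 / x) \<le> K * log_weight x ^ k"
    using J by (auto simp: log_growth_def)
  obtain c0 where c0: "c0 > 0" "\<And>i. i \<in> I \<Longrightarrow> s i \<le> c0" using vanishing_on_bounded[OF s] by blast
  \<comment> \<open>the bound is enlarged beyond \<open>1\<close> so that the index set of the average lies in that of the product formula\<close>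
  define c where "c = c0 + 1"
  have c: "c > 1" "\<And>i. i \<in> I \<Longrightarrow> s i \<le> c" using c0 by (force simp: c_def)+
  have rp: "r q > 0" if "q \<in> J" for q using r that by (simp add: vanishing_on_def)
  define S where "S n = (\<Sum>j\<le>n. \<mu> j) / ln (real n + 1)" for n
  define K0 where "K0 = K1 + upper_sum I s 1"
  have U1: "upper_sum I s 1 \<ge> 0" by (simp add: upper_sum_nonneg)
  have K0: "K0 \<ge> 0" using U1 K1(1) by (simp add: K0_def)
  define K2 where "K2 = K0 * K * log_weight c ^ k"
  have bound: "\<bar>upper_sum (J \<times> I) (\<lambda>(q, p). r q * s p) (1 / real n) / ln (real n + 1) ^ (k + 1) - log_average k J r S n\<bar>
      \<le> K2 * (log_weight (real n) / ln (real n + 1)) ^ k / ln (real n + 1)" if n: "n \<ge> 1" for n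
  proof -
    define l where "l = ln (real n + 1)"
    have l: "l > 0" using n by (simp add: l_def)
    define A where "A = {q\<in>J. 1 / real n \<le> r q}"
    define B where "B = {q\<in>J. 1 / real n / c < r q}"
    have B: "finite B" using vanishing_on_finite[OF r, of "1 / real n / c"] n c(1) by (simp add: B_def)
    have AB: "A \<subseteq> B"
    proof
      fix q assume q: "q \<in> A"
      have "1 / real n / c < 1 / real n" using n c(1) by (simp add: field_simps)
      then show "q \<in> B" using q by (auto simp: A_def B_def)
    qed
    define F where "F q = (if q \<in> A then \<Sum>j\<le>nat \<lfloor>real n * r q\<rfloor>. \<mu> j else 0)" for q
    have U: "upper_sum (J \<times> I) (\<lambda>(q, p). r q * s p) (1 / real n) = (\<Sum>q\<in>B. r q * upper_sum I s (1 / real n / r q))"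
      unfolding B_def by (rule product_upper(2)[OF r s c(2)]) (use c(1) n in auto)
    have close: "\<bar>upper_sum I s (1 / real n / r q) - F q\<bar> \<le> K0" if q: "q \<in> B" for q
    proof (cases "q \<in> A")
      case True
      have "r q > 0" using q rp by (auto simp: B_def)
      then have "1 \<le> real n * r q" using True n by (simp add: A_def pos_divide_le_eq mult.commute)
      then have "\<bar>upper_sum I s (1 / (real n * r q)) - F q\<bar> \<le> K1"
        using K1(2) True by (simp add: F_def)
      then show ?thesis using U1 by (simp add: K0_def)
    next
      case False
      have "r q > 0" using q rp by (auto simp: B_def)
      then have pos: "0 < real n * r q" using n by simp
      have "r q < 1 / real n" using False q by (auto simp: A_def B_def)
      then have "real n * r q < 1" using n by (simp add: pos_less_divide_eq mult.commute)
      then have "1 \<le> 1 / (real n * r q)" using pos by (simp add: pos_le_divide_eq)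
      then have "1 \<le> 1 / real n / r q" by simp
      then have "upper_sum I s (1 / real n / r q) \<le> upper_sum I s 1" "0 \<le> upper_sum I s (1 / real n / r q)"
        using upper_sum_antimono[OF s, of 1] pos n \<open>r q > 0\<close> by (auto intro!: upper_sum_nonneg)
      then show ?thesis using False K1(1) by (simp add: K0_def F_def add_increasing)
    qed
    have "\<bar>(\<Sum>q\<in>B. r q * upper_sum I s (1 / real n / r q)) - (\<Sum>q\<in>B. r q * F q)\<bar>
        \<le> (\<Sum>q\<in>B. \<bar>r q * (upper_sum I s (1 / real n / r q) - F q)\<bar>)"
      unfolding sum_subtractf[symmetric] right_diff_distrib[symmetric] by (rule sum_abs)
    also have "\<dots> \<le> (\<Sum>q\<in>B. K0 * r q)"
    proof (rule sum_mono)
      fix q assume q: "q \<in> B"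
      then have "r q > 0" using rp by (simp add: B_def)
      then show "\<bar>r q * (upper_sum I s (1 / real n / r q) - F q)\<bar> \<le> K0 * r q"
        using mult_left_mono[OF close[OF q], of "r q"] by (simp add: abs_mult mult.commute)
    qed
    also have "\<dots> = K0 * upper_sum J r (1 / (c * real n))"
      by (simp add: upper_sum_def B_def sum_distrib_left mult.commute)
    also have "\<dots> \<le> K0 * (K * log_weight (c * real n) ^ k)"
      using K0 c(1) n by (intro mult_left_mono K(2)) auto
    also have "\<dots> \<le> K0 * (K * (log_weight c ^ k * log_weight (real n) ^ k))"
      using K0 K(1) c(1) by (intro mult_left_mono log_weight_power_mult) auto
    finally have main: "\<bar>upper_sum (J \<times> I) (\<lambda>(q, p). r q * s p) (1 / real n) - (\<Sum>q\<in>B. r q * F q)\<bar>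
        \<le> K2 * log_weight (real n) ^ k" unfolding U by (simp add: K2_def mult_ac)
    have "(\<Sum>q\<in>B. r q * F q) = (\<Sum>q\<in>A. r q * F q)"
      by (rule sum.mono_neutral_right[OF B AB]) (auto simp: F_def)
    also have "\<dots> = (\<Sum>q\<in>A. r q * ln (real (nat \<lfloor>real n * r q\<rfloor>) + 1) * S (nat \<lfloor>real n * r q\<rfloor>))"
    proof (rule sum.cong)
      fix q assume q: "q \<in> A"
      then have "1 \<le> real n * r q" using n by (simp add: A_def pos_divide_le_eq mult.commute)
      define m where "m = nat \<lfloor>real n * r q\<rfloor>"
      have "1 \<le> m" unfolding m_def using le_nat_floor[of 1 "real n * r q"] \<open>1 \<le> real n * r q\<close> by simp
      then have "ln (real m + 1) \<noteq> 0" by simp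
      moreover have "F q = (\<Sum>j\<le>m. \<mu> j)" using q by (simp add: F_def m_def)
      ultimately show "r q * F q = r q * ln (real (nat \<lfloor>real n * r q\<rfloor>) + 1) * S (nat \<lfloor>real n * r q\<rfloor>)"
        unfolding m_def[symmetric] by (simp add: S_def)
    qed simp
    finally have mean: "(\<Sum>q\<in>B. r q * F q) / l ^ (k + 1) = log_average k J r S n" by (simp add: log_average_def A_def l_def)
    have "\<bar>upper_sum (J \<times> I) (\<lambda>(q, p). r q * s p) (1 / real n) / l ^ (k + 1) - log_average k J r S n\<bar> =
      \<bar>upper_sum (J \<times> I) (\<lambda>(q, p). r q * s p) (1 / real n) - (\<Sum>q\<in>B. r q * F q)\<bar> / l ^ (k + 1)"
      unfolding mean[symmetric] diff_divide_distrib[symmetric] using l by (simp add: abs_divide)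
    also have "\<dots> \<le> K2 * log_weight (real n) ^ k / l ^ (k + 1)" using main l by (intro divide_right_mono) auto
    also have "\<dots> = K2 * (log_weight (real n) / l) ^ k / l" by (simp add: power_divide)
    finally show ?thesis by (simp add: l_def)
  qed
  have "(\<lambda>n. K2 * (log_weight (real n) / ln (real n + 1)) ^ k / ln (real n + 1)) \<longlonglongrightarrow> 0"
    by (rule real_tendsto_divide_at_top[OF tendsto_mult[OF tendsto_const tendsto_power[OF log_weight_over_ln]] ln_Suc_at_top])
  then have "(\<lambda>n. upper_sum (J \<times> I) (\<lambda>(q, p). r q * s p) (1 / real n) / ln (real n + 1) ^ (k + 1) - log_average k J r S n) \<longlonglongrightarrow> 0"
    by (rule Lim_null_comparison[rotated]) (rule eventually_sequentiallyI[of 1], use bound in simp)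
  then show ?thesis unfolding S_def .
qed

section \<open>Dixmier traces of tensor products\<close>

lemma extended_limits_add:
  "\<omega> \<in> extended_limits \<Longrightarrow> Bseq x \<Longrightarrow> Bseq y \<Longrightarrow> \<omega> (\<lambda>n. x n + y n) = \<omega> x + \<omega> y"
  by (simp add: extended_limits_def)

lemma extended_limits_scale: "\<omega> \<in> extended_limits \<Longrightarrow> Bseq x \<Longrightarrow> \<omega> (\<lambda>n. c * x n) = c * \<omega> x"
  by (simp add: extended_limits_def)

lemma extended_limits_nonneg: "\<omega> \<in> extended_limits \<Longrightarrow> Bseq x \<Longrightarrow> (\<And>n. 0 \<le> x n) \<Longrightarrow> 0 \<le> \<omega> x"
  by (simp add: extended_limits_def)

lemma extended_limits_lim: "\<omega> \<in> extended_limits \<Longrightarrow> x \<longlonglongrightarrow> l \<Longrightarrow> \<omega> x = l"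
  by (simp add: extended_limits_def)

lemma extended_limits_cong:
  assumes \<omega>: "\<omega> \<in> extended_limits" and y: "Bseq y" and d: "(\<lambda>n. x n - y n) \<longlonglongrightarrow> 0"
  shows "\<omega> x = \<omega> y"
proof -
  have "Bseq (\<lambda>n. x n - y n)" using d by (meson convergentI convergent_imp_Bseq)
  then have "\<omega> (\<lambda>n. y n + (x n - y n)) = \<omega> y + \<omega> (\<lambda>n. x n - y n)" by (rule extended_limits_add[OF \<omega> y])
  then show ?thesis using extended_limits_lim[OF \<omega> d] by simp
qed

definition log_mean :: "('a::complex_hilbert_space \<Rightarrow> 'a) \<Rightarrow> nat \<Rightarrow> real" where
  "log_mean T n = (\<Sum>j\<le>n. singular_value j T) / ln (real n + 1)"

lemma Tr_fun_0: "Tr_fun 0 \<omega> T = \<omega> (log_mean T)"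
  by (simp add: Tr_fun_def G_fun_def log_mean_def[abs_def] atMost_atLeast0)

lemma log_mean_Bseq:
  assumes T: "T \<in> weak_trace_class" shows "Bseq (log_mean T)"
proof -
  have Tc: "compact_op T" using T by (simp add: weak_trace_class_def)
  then obtain I :: "'a set" and e f s where S: "singular_system T I e f s"
    using compact_op_has_singular_system by blast
  obtain C where C: "C \<ge> 0" "\<And>n. singular_value n T \<le> C / (real n + 1)"
    using log_count_sequence[OF weak_trace_class_log_count[OF T S] singular_system_singular_value[OF S]] by auto
  have "\<bar>log_mean T n\<bar> \<le> 3 * C" for n
  proof (cases "n = 0")
    case False
    then have l: "ln (real n + 1) > 0" by simp
    have "(\<Sum>j\<le>n. singular_value j T) \<le> (\<Sum>j<Suc n. C * (1 / (real j + 1)))"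
      unfolding lessThan_Suc_atMost using C(2) by (intro sum_mono) simp
    also have "\<dots> = C * (\<Sum>j<Suc n. 1 / (real j + 1))" by (rule sum_distrib_left[symmetric])
    also have "(\<Sum>j<Suc n. 1 / (real j + 1)) = 1 + (\<Sum>j\<in>{1..<Suc n}. 1 / (real j + 1))"
      by (simp add: lessThan_atLeast0 sum.atLeast_Suc_lessThan)
    also have "C * \<dots> \<le> C * (1 + ln (real (Suc n) / real 1))"
      using C(1) by (intro mult_left_mono add_left_mono sum_inverse_le_ln) auto
    also have "\<dots> = C * log_weight (real n)" by (simp add: log_weight_def)
    also have "\<dots> \<le> C * (3 * ln (real n + 1))" using C(1) log_weight_le_ln[of n] False by (intro mult_left_mono) auto
    finally have "log_mean T n \<le> 3 * C" using l by (simp add: log_mean_def pos_divide_le_eq mult_ac)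
    moreover have "0 \<le> log_mean T n" using l singular_value_nonneg[OF Tc] by (simp add: log_mean_def sum_nonneg)
    ultimately show ?thesis by simp
  qed (use C(1) in \<open>simp add: log_mean_def\<close>)
  then show ?thesis by (intro BseqI'[of _ "3 * C"]) simp
qed

text \<open>
  Reduces the evaluation of \<open>Tr\<^sub>\<omega>\<close> to the sums of large singular values, which can be computed from
  any singular system. The factor \<open>k + 1\<close> comes from the normalisation \<open>G\<^sub>k\<close>.
\<close>

lemma Tr_fun_asymptotic:
  assumes \<omega>: "\<omega> \<in> extended_limits" and y: "Bseq y"
    and S: "singular_system T I e f s" and c: "log_count k I s"
    and lim: "(\<lambda>n. upper_sum I s (1 / real n) / ln (real n + 1) ^ (k + 1) - y n) \<longlonglongrightarrow> 0"
  shows "Tr_fun k \<omega> T = (real k + 1) * \<omega> y"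
proof -
  have "(\<lambda>n. ((\<Sum>j\<le>n. singular_value j T) - upper_sum I s (1 / real n)) / ln (real n + 1) ^ (k + 1)
     + (upper_sum I s (1 / real n) / ln (real n + 1) ^ (k + 1) - y n)) \<longlonglongrightarrow> 0 + 0"
    by (intro tendsto_add lim partial_sum_upper_sum_asymptotic[OF c singular_system_singular_value[OF S]])
  then have "(\<lambda>n. (real k + 1) * ((\<Sum>j\<le>n. singular_value j T) / ln (real n + 1) ^ (k + 1) - y n)) \<longlonglongrightarrow> (real k + 1) * 0"
    by (intro tendsto_mult tendsto_const) (simp add: diff_divide_distrib)
  then have "(\<lambda>n. 1 / G_fun k (real n + 1) * (\<Sum>j=0..n. singular_value j T) - (real k + 1) * y n) \<longlonglongrightarrow> 0"
    by (simp add: G_fun_def atMost_atLeast0 right_diff_distrib)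
  then have "\<omega> (\<lambda>n. 1 / G_fun k (real n + 1) * (\<Sum>j=0..n. singular_value j T)) = \<omega> (\<lambda>n. (real k + 1) * y n)"
    using \<omega> y by (intro extended_limits_cong) (auto simp: Bseq_cmult_iff intro: Bseq_mult)
  then show ?thesis using extended_limits_scale[OF \<omega> y] by (simp add: Tr_fun_def)
qed

lemma dixmier_trace_of_limit:
  assumes \<phi>: "\<phi> \<in> dixmier_traces k" and S: "singular_system T I e e s" and c: "log_count k I s"
    and lim: "(\<lambda>n. upper_sum I s (1 / real n) / ln (real n + 1) ^ (k + 1)) \<longlonglongrightarrow> l"
  shows "\<phi> T = complex_of_real ((real k + 1) * l)"
proof -
  obtain \<omega> where \<omega>: "\<omega> \<in> extended_limits"
    and tr: "\<And>T. T \<in> I_ideal k \<Longrightarrow> positive_op T \<Longrightarrow> \<phi> T = complex_of_real (Tr_fun k \<omega> T)"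
    using \<phi> by (auto simp: dixmier_traces_def)
  have "(\<lambda>n. upper_sum I s (1 / real n) / ln (real n + 1) ^ (k + 1) - l) \<longlonglongrightarrow> 0"
    using tendsto_diff[OF lim tendsto_const[of l]] by simp
  then have "Tr_fun k \<omega> T = (real k + 1) * \<omega> (\<lambda>_. l)" by (intro Tr_fun_asymptotic[OF \<omega> _ S c]) auto
  then show ?thesis
    using tr[OF log_count_I_ideal[OF S c] singular_system_positive[OF S]] extended_limits_lim[OF \<omega> tendsto_const] by simp
qed

lemma linear_functional_on_sum:
  fixes c :: "nat \<Rightarrow> complex" and P :: "nat \<Rightarrow> 'a \<Rightarrow> 'a::complex_hilbert_space"
  assumes \<theta>: "linear_functional_on weak_trace_class \<theta>" and P: "\<And>q. q < n \<Longrightarrow> P q \<in> weak_trace_class" and n: "n > 0"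
  shows "(\<lambda>x. \<Sum>q<n. c q *\<^sub>C P q x) \<in> weak_trace_class \<and>
    \<theta> (\<lambda>x. \<Sum>q<n. c q *\<^sub>C P q x) = (\<Sum>q<n. c q * \<theta> (P q))"
  using P n
proof (induction n)
  case (Suc n)
  have s: "(\<lambda>x. c n *\<^sub>C P n x) \<in> weak_trace_class" using Suc.prems by (intro weak_trace_class_scale) simp
  have sc: "\<theta> (\<lambda>x. c n *\<^sub>C P n x) = c n * \<theta> (P n)"
    using \<theta> Suc.prems by (simp add: linear_functional_on_def)
  show ?case
  proof (cases "n = 0")
    case True
    then show ?thesis using s sc by simp
  next
    case False
    then have IH: "(\<lambda>x. \<Sum>q<n. c q *\<^sub>C P q x) \<in> weak_trace_class"
      "\<theta> (\<lambda>x. \<Sum>q<n. c q *\<^sub>C P q x) = (\<Sum>q<n. c q * \<theta> (P q))" using Suc by auto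
    have "(\<lambda>x. (\<Sum>q<n. c q *\<^sub>C P q x) + c n *\<^sub>C P n x) \<in> weak_trace_class"
      by (rule weak_trace_class_add[OF IH(1) s])
    moreover have "\<theta> (\<lambda>x. (\<Sum>q<n. c q *\<^sub>C P q x) + c n *\<^sub>C P n x) =
        \<theta> (\<lambda>x. \<Sum>q<n. c q *\<^sub>C P q x) + \<theta> (\<lambda>x. c n *\<^sub>C P n x)"
      by (rule \<theta>[unfolded linear_functional_on_def, THEN conjunct1, rule_format, OF IH(1) s])
    ultimately show ?thesis using IH(2) sc by simp
  qed
qed simp

text \<open>
  Positive operators span the weak trace class.
\<close>

lemma linear_functional_eqI:
  assumes \<theta>: "linear_functional_on weak_trace_class \<theta>" and \<psi>: "linear_functional_on weak_trace_class \<psi>"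
    and eq: "\<And>P. P \<in> weak_trace_class \<Longrightarrow> positive_op P \<Longrightarrow> \<theta> P = \<psi> P" and A: "A \<in> weak_trace_class"
  shows "\<theta> A = \<psi> A"
proof -
  obtain P where P: "\<And>q. q < 4 \<Longrightarrow> P q \<in> weak_trace_class \<and> positive_op (P q)"
    "\<And>x. A x = (\<Sum>q<4::nat. (\<i> ^ q / 4) *\<^sub>C P q x)"
    using weak_trace_class_positive_parts[OF A] by blast
  have A': "A = (\<lambda>x. \<Sum>q<4::nat. (\<i> ^ q / 4) *\<^sub>C P q x)" using P(2) by (simp add: fun_eq_iff)
  have "\<theta> A = (\<Sum>q<4. \<i> ^ q / 4 * \<theta> (P q))"
    unfolding A' using linear_functional_on_sum[OF \<theta>, of 4 P "\<lambda>q. \<i> ^ q / 4"] P(1) by simp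
  also have "\<dots> = (\<Sum>q<4. \<i> ^ q / 4 * \<psi> (P q))" by (rule sum.cong) (use P(1) eq in auto)
  also have "\<dots> = \<psi> A"
    unfolding A' using linear_functional_on_sum[OF \<psi>, of 4 P "\<lambda>q. \<i> ^ q / 4"] P(1) by simp
  finally show ?thesis .
qed

context tensor_power

begin

text \<open>
  The averages do not depend on \<open>A\<close>: all singular systems are taken in sorted form, so the index
  set and the weights of the other slots are determined by \<open>B\<close>.
\<close>

lemma slot_Tr_fun:
  assumes i: "i \<le> k" and B: "\<And>j. j \<le> k \<Longrightarrow> j \<noteq> i \<Longrightarrow> B j \<in> weak_trace_class"
  obtains J :: "(nat \<Rightarrow> nat) set" and r where "log_growth k J r"
    "\<And>A \<omega>. A \<in> weak_trace_class \<Longrightarrow> \<omega> \<in> extended_limits \<Longrightarrow>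
       Tr_fun k \<omega> (tensor_op t (B(i := A))) = (real k + 1) * \<omega> (log_average k J r (log_mean A))"
proof -
  define S where "S = {..k} - {i}"
  have S: "finite S" "i \<notin> S" "{..k} = insert i S" using i by (auto simp: S_def)
  define I where "I C j = {n. 0 < singular_value n (C j)}" for C :: "nat \<Rightarrow> 'a \<Rightarrow> 'a" and j
  define s where "s C j n = singular_value n (C j)" for C :: "nat \<Rightarrow> 'a \<Rightarrow> 'a" and j n
  have sys: "\<exists>e f. singular_system T {n. 0 < singular_value n T} e f (\<lambda>n. singular_value n T)"
    if "T \<in> weak_trace_class" for T :: "'a \<Rightarrow> 'a"
    using that by (intro compact_op_sorted_system) (simp add: weak_trace_class_def)
  have cnt: "log_count 0 {n. 0 < singular_value n T} (\<lambda>n. singular_value n T)"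
    if "T \<in> weak_trace_class" for T :: "'a \<Rightarrow> 'a"
    using sys[OF that] weak_trace_class_log_count[OF that] by blast
  define J where "J = PiE S (I B)"
  define r where "r = prod_weight S (s B)"
  have J: "log_growth k J r"
    unfolding J_def r_def S_def by (rule log_growth_slots[OF i]) (simp add: I_def s_def[abs_def] cnt B)
  show thesis
  proof (rule that[OF J])
    fix A :: "'a \<Rightarrow> 'a" and \<omega> assume A: "A \<in> weak_trace_class" and \<omega>: "\<omega> \<in> extended_limits"
    define C where "C = B(i := A)"
    have C: "C j \<in> weak_trace_class" if "j \<le> k" for j using that A B by (simp add: C_def)
    obtain e f where "\<And>j. j \<le> k \<Longrightarrow> singular_system (C j) (I C j) (e j) (f j) (s C j)"
      using sys[OF C] unfolding I_def s_def[abs_def] by metis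
    then have T: "singular_system (tensor_op t C) (PiE {..k} (I C)) (tensor_vec t e) (tensor_vec t f) (prod_weight {..k} (s C))"
      by (rule tensor_op_singular_system(1))
    have lc: "log_count k (PiE {..k} (I C)) (prod_weight {..k} (s C))"
      by (rule log_count_slots) (simp add: I_def s_def[abs_def] cnt C)
    obtain e' f' where SA: "singular_system A {n. 0 < singular_value n A} e' f' (\<lambda>n. singular_value n A)"
      using sys[OF A] by blast
    \<comment> \<open>the slots in \<open>S\<close> do not see the operator in slot \<open>i\<close>\<close>
    have JC: "PiE S (I C) = J" unfolding J_def by (rule PiE_cong) (use S(2) in \<open>auto simp: I_def C_def\<close>)
    have rC: "prod_weight S (s C) = r" unfolding r_def
      by (rule ext) (unfold prod_weight_def, rule prod.cong, use S(2) in \<open>auto simp: s_def C_def\<close>)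
    have U: "upper_sum (PiE {..k} (I C)) (prod_weight {..k} (s C)) \<epsilon> =
        upper_sum (J \<times> {n. 0 < singular_value n A}) (\<lambda>(q, p). r q * singular_value p A) \<epsilon>" for \<epsilon>
      unfolding S(3) slot_split(2)[OF S(1,2)] JC rC by (simp add: I_def s_def C_def)
    have "(\<lambda>n. upper_sum (PiE {..k} (I C)) (prod_weight {..k} (s C)) (1 / real n) / ln (real n + 1) ^ (k + 1)
        - log_average k J r (log_mean A) n) \<longlonglongrightarrow> 0"
      unfolding U log_mean_def[abs_def]
      by (rule product_upper_sum_log_average[OF J cnt[OF A] singular_system_singular_value[OF SA]])
    then show "Tr_fun k \<omega> (tensor_op t (B(i := A))) = (real k + 1) * \<omega> (log_average k J r (log_mean A))"
      using Tr_fun_asymptotic[OF \<omega> log_average_Bseq[OF J log_mean_Bseq[OF A]] T lc] by (simp add: C_def)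
  qed
qed

lemma slot_linear_functional:
  assumes i: "i \<le> k" and B: "\<And>j. j \<le> k \<Longrightarrow> j \<noteq> i \<Longrightarrow> B j \<in> weak_trace_class"
    and \<phi>: "linear_functional_on (I_ideal k) \<phi>"
  shows "linear_functional_on weak_trace_class (\<lambda>A. \<phi> (tensor_op t (B(i := A))))"
proof -
  have c: "compact_op T" if "T \<in> weak_trace_class" for T :: "'a \<Rightarrow> 'a" using that by (simp add: weak_trace_class_def)
  have I: "tensor_op t (B(i := A)) \<in> I_ideal k" if "A \<in> weak_trace_class" for A
    by (rule tensor_op_I_ideal) (use that B in simp)
  show ?thesis
    unfolding linear_functional_on_def
  proof (intro conjI ballI allI)
    fix P Q :: "'a \<Rightarrow> 'a" assume PQ: "P \<in> weak_trace_class" "Q \<in> weak_trace_class"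
    have "tensor_op t (B(i := (\<lambda>x. P x + Q x))) = (\<lambda>x. tensor_op t (B(i := P)) x + tensor_op t (B(i := Q)) x)"
      by (rule tensor_op_slot_sum[OF i]) (use c B PQ in auto)
    then show "\<phi> (tensor_op t (B(i := (\<lambda>x. P x + Q x)))) = \<phi> (tensor_op t (B(i := P))) + \<phi> (tensor_op t (B(i := Q)))"
      using \<phi> I[OF PQ(1)] I[OF PQ(2)] by (simp add: linear_functional_on_def)
  next
    fix a and P :: "'a \<Rightarrow> 'a" assume P: "P \<in> weak_trace_class"
    have "tensor_op t (B(i := (\<lambda>x. a *\<^sub>C P x))) = (\<lambda>x. a *\<^sub>C tensor_op t (B(i := P)) x)"
      by (rule tensor_op_slot_scale[OF i]) (use c B P in auto)
    then show "\<phi> (tensor_op t (B(i := (\<lambda>x. a *\<^sub>C P x)))) = a * \<phi> (tensor_op t (B(i := P)))"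
      using \<phi> I[OF P] by (simp add: linear_functional_on_def)
  qed
qed

text \<open>
  The new extended limit is \<open>\<omega>' x = \<omega> (log_average x) / m\<close>, where \<open>m\<close> is the value of \<open>\<omega>\<close> on the averages of
  the constant sequence \<open>1\<close>. If \<open>m = 0\<close>, positivity of \<open>\<omega>\<close> makes it vanish on the averages of every
  bounded sequence, and the functional is zero.
\<close>

lemma (in tensor_power) slot_dixmier_trace:
  assumes i: "i \<le> k" and B: "\<And>j. j \<le> k \<Longrightarrow> j \<noteq> i \<Longrightarrow> B j \<in> weak_trace_class \<and> positive_op (B j)"
    and \<phi>: "\<phi> \<in> dixmier_traces k"
  shows "\<exists>c. (\<forall>A\<in>weak_trace_class. \<phi> (tensor_op t (B(i := A))) = 0) \<or>
     c \<noteq> 0 \<and> (\<lambda>A. \<phi> (tensor_op t (B(i := A))) / c) \<in> dixmier_traces 0"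
proof -
  obtain \<omega> where lin: "linear_functional_on (I_ideal k) \<phi>" and \<omega>: "\<omega> \<in> extended_limits"
    and tr: "\<And>T. T \<in> I_ideal k \<Longrightarrow> positive_op T \<Longrightarrow> \<phi> T = complex_of_real (Tr_fun k \<omega> T)"
    using \<phi> by (auto simp: dixmier_traces_def)
  have Bw: "\<And>j. j \<le> k \<Longrightarrow> j \<noteq> i \<Longrightarrow> B j \<in> weak_trace_class" using B by blast
  obtain J :: "(nat \<Rightarrow> nat) set" and r where J: "log_growth k J r"
    and TrB: "\<And>A \<omega>. A \<in> weak_trace_class \<Longrightarrow> \<omega> \<in> extended_limits \<Longrightarrow>
       Tr_fun k \<omega> (tensor_op t (B(i := A))) = (real k + 1) * \<omega> (log_average k J r (log_mean A))"
    using slot_Tr_fun[of i B] i Bw by blast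
  have Jv: "vanishing_on J r" using J by (simp add: log_growth_def)
  define \<theta> where "\<theta> A = \<phi> (tensor_op t (B(i := A)))" for A
  have \<theta>: "linear_functional_on weak_trace_class \<theta>"
    unfolding \<theta>_def by (rule slot_linear_functional[OF i Bw lin])
  have pos: "\<theta> A = complex_of_real ((real k + 1) * \<omega> (log_average k J r (log_mean A)))"
    if A: "A \<in> weak_trace_class" "positive_op A" for A
  proof -
    have "tensor_op t (B(i := A)) \<in> I_ideal k" by (rule tensor_op_I_ideal) (use A Bw in simp)
    moreover have "positive_op (tensor_op t (B(i := A)))"
      by (rule tensor_op_positive) (use A B in \<open>auto simp: weak_trace_class_def\<close>)
    ultimately show ?thesis using tr TrB[OF A(1) \<omega>] by (simp add: \<theta>_def)
  qed
  define m where "m = \<omega> (log_average k J r (\<lambda>_. 1))"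
  have b1: "Bseq (log_average k J r (\<lambda>_. 1))" by (rule log_average_Bseq[OF J]) simp
  have m0: "m \<ge> 0" unfolding m_def by (rule extended_limits_nonneg[OF \<omega> b1]) (simp add: log_average_nonneg[OF Jv])
  show ?thesis
  proof (cases "m = 0")
    case True
    have "\<omega> (log_average k J r (log_mean A)) = 0" if A: "A \<in> weak_trace_class" for A :: "'a \<Rightarrow> 'a"
    proof -
      have bA: "Bseq (log_average k J r (log_mean A))" by (rule log_average_Bseq[OF J log_mean_Bseq[OF A]])
      obtain X where X: "X > 0" "\<And>n. \<bar>log_mean A n\<bar> \<le> X" using log_mean_Bseq[OF A] by (auto elim: BseqE)
      \<comment> \<open>positivity applied to \<open>X \<plusminus> x\<close>, where \<open>X\<close> bounds the sequence \<open>x\<close>\<close>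
      have *: "0 \<le> \<omega> (log_average k J r (\<lambda>n. X * 1 + c * log_mean A n))" if "c = 1 \<or> c = -1" for c
      proof (rule extended_limits_nonneg[OF \<omega>])
        show "Bseq (log_average k J r (\<lambda>n. X * 1 + c * log_mean A n))"
        proof (rule log_average_Bseq[OF J], rule BseqI')
          show "norm (X * 1 + c * log_mean A n) \<le> 2 * X" for n
            using X(2)[of n] that by (auto simp: abs_le_iff)
        qed
        show "0 \<le> log_average k J r (\<lambda>n. X * 1 + c * log_mean A n) n" for n
        proof (rule log_average_nonneg[OF Jv])
          show "0 \<le> X * 1 + c * log_mean A n" for n using X(2)[of n] that by (auto simp: abs_le_iff)
        qed
      qed
      have "log_average k J r (\<lambda>n. X * 1 + c * log_mean A n) = (\<lambda>n. X * log_average k J r (\<lambda>_. 1) n + c * log_average k J r (log_mean A) n)" for c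
        by (rule ext) (simp only: log_average_add log_average_scale)
      then have val: "\<omega> (log_average k J r (\<lambda>n. X * 1 + c * log_mean A n)) = X * m + c * \<omega> (log_average k J r (log_mean A))" for c
        using extended_limits_add[OF \<omega>, of "\<lambda>n. X * log_average k J r (\<lambda>_. 1) n" "\<lambda>n. c * log_average k J r (log_mean A) n"]
          extended_limits_scale[OF \<omega> b1] extended_limits_scale[OF \<omega> bA] b1 bA
        by (simp add: Bseq_cmult_iff m_def Bseq_mult)
      have "0 \<le> \<omega> (log_average k J r (log_mean A))" using *[of 1] unfolding val True by simp
      moreover have "0 \<le> - \<omega> (log_average k J r (log_mean A))" using *[of "-1"] unfolding val True by simp
      ultimately show ?thesis by simp
    qed
    then have zero: "\<theta> P = 0" if "P \<in> weak_trace_class" "positive_op P" for P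
      using pos[OF that] that(1) by simp
    have "linear_functional_on weak_trace_class (\<lambda>_::'a \<Rightarrow> 'a. 0)" by (simp add: linear_functional_on_def)
    then have "\<theta> A = 0" if "A \<in> weak_trace_class" for A
      using linear_functional_eqI[OF \<theta> _ zero that] by blast
    then show ?thesis by (auto simp: \<theta>_def)
  next
    case False
    define c where "c = complex_of_real ((real k + 1) * m)"
    have k1: "real k + 1 \<noteq> 0" by linarith
    have c0: "c \<noteq> 0" unfolding c_def of_real_eq_0_iff using False k1 by simp
    define \<omega>' where "\<omega>' x = \<omega> (log_average k J r x) / m" for x
    have "\<omega>' \<in> extended_limits"
      unfolding extended_limits_def
    proof (intro CollectI conjI allI impI)
      fix x y :: "nat \<Rightarrow> real" assume xy: "Bseq x" "Bseq y"
      have "log_average k J r (\<lambda>n. x n + y n) = (\<lambda>n. log_average k J r x n + log_average k J r y n)" by (rule ext) (rule log_average_add)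
      then show "\<omega>' (\<lambda>n. x n + y n) = \<omega>' x + \<omega>' y"
        using extended_limits_add[OF \<omega> log_average_Bseq[OF J xy(1)] log_average_Bseq[OF J xy(2)]]
        by (simp add: \<omega>'_def add_divide_distrib)
    next
      fix a and x :: "nat \<Rightarrow> real" assume x: "Bseq x"
      have "log_average k J r (\<lambda>n. a * x n) = (\<lambda>n. a * log_average k J r x n)" by (rule ext) (rule log_average_scale)
      then show "\<omega>' (\<lambda>n. a * x n) = a * \<omega>' x"
        using extended_limits_scale[OF \<omega> log_average_Bseq[OF J x]] by (simp add: \<omega>'_def)
    next
      fix x :: "nat \<Rightarrow> real" assume x: "Bseq x" "\<forall>n. 0 \<le> x n"
      then have "0 \<le> \<omega> (log_average k J r x)" by (intro extended_limits_nonneg[OF \<omega> log_average_Bseq[OF J]] log_average_nonneg[OF Jv]) auto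
      then show "0 \<le> \<omega>' x" using m0 by (simp add: \<omega>'_def)
    next
      fix x l assume x: "x \<longlonglongrightarrow> (l::real)"
      have "(\<lambda>n. x n + (- l) * 1) \<longlonglongrightarrow> 0" using tendsto_add[OF x tendsto_const[of "-l"]] by simp
      then have "log_average k J r (\<lambda>n. x n + (- l) * 1) \<longlonglongrightarrow> 0" by (rule log_average_null[OF J])
      moreover have "log_average k J r (\<lambda>n. x n + (- l) * 1) = (\<lambda>n. log_average k J r x n - l * log_average k J r (\<lambda>_. 1) n)"
        unfolding log_average_add[of k J r x "\<lambda>_. - l * 1"] log_average_scale[of k J r "- l" "\<lambda>_. 1"] by simp
      ultimately have "(\<lambda>n. log_average k J r x n - l * log_average k J r (\<lambda>_. 1) n) \<longlonglongrightarrow> 0" by simp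
      then have "\<omega> (log_average k J r x) = \<omega> (\<lambda>n. l * log_average k J r (\<lambda>_. 1) n)"
        by (rule extended_limits_cong[OF \<omega>, rotated]) (use b1 in \<open>auto simp: Bseq_cmult_iff intro: Bseq_mult\<close>)
      then show "\<omega>' x = l" using extended_limits_scale[OF \<omega> b1] False by (simp add: \<omega>'_def m_def)
    qed
    moreover have "linear_functional_on weak_trace_class (\<lambda>A. \<theta> A / c)"
      using \<theta> by (auto simp: linear_functional_on_def add_divide_distrib)
    moreover have "\<theta> A / c = complex_of_real (Tr_fun 0 \<omega>' A)" if "A \<in> weak_trace_class" "positive_op A" for A
      unfolding pos[OF that] c_def of_real_divide[symmetric] Tr_fun_0 \<omega>'_def using k1 False by simp
    ultimately have "(\<lambda>A. \<theta> A / c) \<in> dixmier_traces 0"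
      unfolding dixmier_traces_def I_ideal_0 by blast
    then show ?thesis using c0 unfolding \<theta>_def by blast
  qed
qed

end

section \<open>An operator with convergent partial sums\<close>

text \<open>
  Index set of the reference operator: level \<open>j\<close> consists of \<open>2\<^sup>j\<close> indices of weight \<open>2\<^bsup>-j\<^esup>\<close>, so
  it has total weight \<open>1\<close>, and sums of weights reduce to counting levels.
\<close>

definition dyadic :: "(nat \<times> nat) set" where "dyadic = {(j, r). r < 2 ^ j}"

definition dyadic_weight :: "nat \<times> nat \<Rightarrow> real" where "dyadic_weight p = 1 / 2 ^ fst p"

text \<open>
  The level sets of the product weights, which are powers of \<open>2\<close>.
\<close>

definition dyadic_simplex :: "nat set \<Rightarrow> nat \<Rightarrow> (nat \<Rightarrow> nat \<times> nat) set" where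
  "dyadic_simplex S M = {m\<in>PiE S (\<lambda>_. dyadic). (\<Sum>i\<in>S. fst (m i)) \<le> M}"

lemma prod_dyadic_weight: "prod_weight S (\<lambda>_. dyadic_weight) m = 1 / 2 ^ (\<Sum>i\<in>S. fst (m i))"
  unfolding prod_weight_def dyadic_weight_def by (simp add: prod_dividef power_sum)

lemma finite_dyadic_level: "finite {p\<in>dyadic. fst p \<le> M}"
proof (rule finite_subset)
  show "{p\<in>dyadic. fst p \<le> M} \<subseteq> {..M} \<times> {..<2 ^ M}"
  proof
    fix p assume "p \<in> {p\<in>dyadic. fst p \<le> M}"
    then have "snd p < 2 ^ fst p" "fst p \<le> M" by (auto simp: dyadic_def)
    moreover have "(2::nat) ^ fst p \<le> 2 ^ M" using \<open>fst p \<le> M\<close> by (intro power_increasing) auto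
    ultimately have "snd p < 2 ^ M" "fst p \<le> M" by linarith+
    then show "p \<in> {..M} \<times> {..<2 ^ M}" by (cases p) auto
  qed
qed simp

lemma finite_dyadic_simplex:
  assumes "finite S" shows "finite (dyadic_simplex S M)"
proof (rule finite_subset)
  show "dyadic_simplex S M \<subseteq> PiE S (\<lambda>_. {p\<in>dyadic. fst p \<le> M})"
  proof
    fix m assume m: "m \<in> dyadic_simplex S M"
    have "fst (m i) \<le> M" if "i \<in> S" for i
      using m member_le_sum[of i S "\<lambda>i. fst (m i)"] that assms by (auto simp: dyadic_simplex_def)
    then show "m \<in> PiE S (\<lambda>_. {p\<in>dyadic. fst p \<le> M})" using m by (auto simp: dyadic_simplex_def PiE_iff)
  qed
  show "finite (PiE S (\<lambda>_. {p\<in>dyadic. fst p \<le> M}))" using assms finite_dyadic_level by (intro finite_PiE) auto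
qed

lemma sum_dyadic_level: "(\<Sum>p\<in>{p\<in>dyadic. fst p \<le> M}. dyadic_weight p * g (fst p)) = (\<Sum>j\<le>M. g j)"
proof -
  have "{p\<in>dyadic. fst p \<le> M} = (SIGMA j:{..M}. {..<2 ^ j})" by (auto simp: dyadic_def)
  then have "(\<Sum>p\<in>{p\<in>dyadic. fst p \<le> M}. dyadic_weight p * g (fst p)) = (\<Sum>j\<le>M. \<Sum>r<2 ^ j. dyadic_weight (j, r) * g j)"
    by (simp add: sum.Sigma case_prod_unfold)
  then show ?thesis by (simp add: dyadic_weight_def)
qed

text \<open>
  As every level has total weight \<open>1\<close>, this counts the tuples of \<open>card S\<close> natural numbers whose sum
  is at most \<open>M\<close>. Adding one element to \<open>S\<close> is the hockey-stick identity.
\<close>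

lemma dyadic_simplex_sum:
  assumes "finite S"
  shows "(\<Sum>m\<in>dyadic_simplex S M. prod_weight S (\<lambda>_. dyadic_weight) m) = real ((M + card S) choose card S)"
  using assms
proof (induction S arbitrary: M)
  case empty
  have "dyadic_simplex {} M = {\<lambda>_. undefined}" by (auto simp: dyadic_simplex_def)
  then show ?case by (simp add: prod_weight_def)
next
  case (insert i S)
  let ?h = "\<lambda>(p, q). q(i := p)"
  let ?D = "SIGMA p:{p\<in>dyadic. fst p \<le> M}. dyadic_simplex S (M - fst p)"
  have inj: "inj_on ?h ?D"
    by (rule inj_on_subset[OF inj_combinator[OF insert.hyps(2), of "\<lambda>_. dyadic"]])
      (auto simp: dyadic_simplex_def)
  have sum_upd: "(\<Sum>j\<in>S. fst ((q(i := p)) j)) = (\<Sum>j\<in>S. fst (q j))" for p :: "nat \<times> nat" and q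
    by (rule sum.cong) (use insert.hyps(2) in auto)
  have im: "?h ` ?D = dyadic_simplex (insert i S) M"
  proof (intro equalityI subsetI)
    fix m assume "m \<in> ?h ` ?D"
    then obtain p q where m: "m = q(i := p)" "p \<in> dyadic" "fst p \<le> M" "q \<in> dyadic_simplex S (M - fst p)" by auto
    then have "m \<in> PiE (insert i S) (\<lambda>_. dyadic)"
      unfolding m(1) by (intro PiE_fun_upd) (auto simp: dyadic_simplex_def)
    moreover have "(\<Sum>j\<in>insert i S. fst (m j)) \<le> M"
      using insert.hyps sum_upd[of q p] m by (auto simp: dyadic_simplex_def)
    ultimately show "m \<in> dyadic_simplex (insert i S) M" by (simp add: dyadic_simplex_def)
  next
    fix m assume m: "m \<in> dyadic_simplex (insert i S) M"
    then have "m \<in> ?h ` (dyadic \<times> PiE S (\<lambda>_. dyadic))"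
      unfolding dyadic_simplex_def PiE_insert_eq by simp
    then obtain p q where pq: "m = q(i := p)" "p \<in> dyadic" "q \<in> PiE S (\<lambda>_. dyadic)" by auto
    then have "fst p + (\<Sum>j\<in>S. fst (q j)) \<le> M" using m insert.hyps sum_upd[of q p] by (simp add: dyadic_simplex_def)
    then show "m \<in> ?h ` ?D" using pq by (auto simp: dyadic_simplex_def intro!: image_eqI[of _ _ "(p, q)"])
  qed
  have w: "prod_weight (insert i S) (\<lambda>_. dyadic_weight) (q(i := p)) = dyadic_weight p * prod_weight S (\<lambda>_. dyadic_weight) q" for p q
  proof -
    have "(\<Prod>j\<in>S. dyadic_weight ((q(i := p)) j)) = (\<Prod>j\<in>S. dyadic_weight (q j))" by (rule prod.cong) (use insert.hyps(2) in auto)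
    then show ?thesis using insert.hyps by (simp add: prod_weight_def)
  qed
  have "(\<Sum>m\<in>dyadic_simplex (insert i S) M. prod_weight (insert i S) (\<lambda>_. dyadic_weight) m) =
     (\<Sum>(p, q)\<in>?D. dyadic_weight p * prod_weight S (\<lambda>_. dyadic_weight) q)"
    unfolding im[symmetric] sum.reindex[OF inj] by (rule sum.cong) (auto simp: w simp del: fun_upd_apply)
  also have "\<dots> = (\<Sum>p\<in>{p\<in>dyadic. fst p \<le> M}. \<Sum>q\<in>dyadic_simplex S (M - fst p). dyadic_weight p * prod_weight S (\<lambda>_. dyadic_weight) q)"
    by (rule sum.Sigma[symmetric]) (use finite_dyadic_level finite_dyadic_simplex[OF insert.hyps(1)] in auto)
  also have "\<dots> = (\<Sum>p\<in>{p\<in>dyadic. fst p \<le> M}. dyadic_weight p * real ((M - fst p + card S) choose card S))"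
    by (simp add: sum_distrib_left[symmetric] insert.IH)
  also have "\<dots> = (\<Sum>j\<le>M. real ((M - j + card S) choose card S))"
    by (rule sum_dyadic_level[where g="\<lambda>j. real ((M - j + card S) choose card S)"])
  also have "\<dots> = (\<Sum>j\<le>M. real ((card S + j) choose card S))"
    by (rule sum.reindex_bij_witness[of _ "\<lambda>j. M - j" "\<lambda>j. M - j"]) (auto simp: add.commute)
  also have "\<dots> = real ((card S + M + 1) choose (card S + 1))"
    unfolding of_nat_sum[symmetric] choose_rising_sum(1) ..
  finally show ?case using insert.hyps by (simp add: add_ac)
qed

lemma dyadic_log:
  obtains M :: "nat \<Rightarrow> nat" where "\<And>n j. n \<ge> 2 \<Longrightarrow> 2 ^ j < n \<longleftrightarrow> j \<le> M n"
    "(\<lambda>n. real (M n) / ln (real n + 1)) \<longlonglongrightarrow> 1 / ln 2"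
proof -
  have "\<exists>M. 2 ^ M < n \<and> n \<le> 2 ^ (M + 1)" if "n \<ge> 2" for n :: nat
    using ex_power_ivl2[of 2 n] that by auto
  then obtain M where M: "\<And>n::nat. n \<ge> 2 \<Longrightarrow> 2 ^ M n < n \<and> n \<le> 2 ^ (M n + 1)" by metis
  show thesis
  proof (rule that[of M])
    fix n j :: nat assume n: "n \<ge> 2"
    show "2 ^ j < n \<longleftrightarrow> j \<le> M n"
    proof
      assume "2 ^ j < n"
      then have "(2::nat) ^ j < 2 ^ (M n + 1)" using M[OF n] by linarith
      then show "j \<le> M n" by (simp add: power_strict_increasing_iff del: power_Suc)
    next
      assume "j \<le> M n"
      then have "(2::nat) ^ j \<le> 2 ^ M n" by (rule power_increasing) simp
      then show "2 ^ j < n" using M[OF n] by linarith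
    qed
  next
    have l2: "ln (2::real) > 0" by simp
    show "(\<lambda>n. real (M n) / ln (real n + 1)) \<longlonglongrightarrow> 1 / ln 2"
    proof (rule tendsto_sandwich[of "\<lambda>n. 1 / ln 2 - 2 / ln (real n + 1)" _ _ "\<lambda>_. 1 / ln 2"])
      have "(\<lambda>n. 1 / ln 2 - 2 / ln (real n + 1)) \<longlonglongrightarrow> 1 / ln 2 - 0"
        by (intro tendsto_diff tendsto_const real_tendsto_divide_at_top[OF tendsto_const ln_Suc_at_top])
      then show "(\<lambda>n. 1 / ln 2 - 2 / ln (real n + 1)) \<longlonglongrightarrow> 1 / ln (2::real)" by simp
      \<comment> \<open>\<open>2\<^sup>M < n \<le> 2\<^sup>M\<^sup>+\<^sup>1\<close> squeezes \<open>M ln 2\<close> between \<open>ln (n + 1) - 2 ln 2\<close> and \<open>ln (n + 1)\<close>\<close>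
      have both: "1 / ln 2 - 2 / ln (real n + 1) \<le> real (M n) / ln (real n + 1) \<and> real (M n) / ln (real n + 1) \<le> 1 / ln 2"
        if n: "n \<ge> 2" for n
      proof -
        define l where "l = ln (real n + 1)"
        have l: "l > 0" using n by (simp add: l_def)
        have "real (2 ^ M n) \<le> real n + 1" using M[OF n] by linarith
        then have "ln (2 ^ M n) \<le> l" unfolding l_def by (subst ln_le_cancel_iff) auto
        then have up: "real (M n) * ln 2 \<le> l" by (simp add: ln_realpow)
        have "real n + 1 \<le> 2 * 2 ^ (M n + 1)"
        proof -
          have "real n \<le> real (2 ^ (M n + 1))" using M[OF n] by (intro of_nat_mono) simp
          moreover have "real n + 1 \<le> 2 * real n" using n by simp
          ultimately show ?thesis by simp
        qed
        then have "l \<le> ln (2 ^ (M n + 2))" unfolding l_def by (subst ln_le_cancel_iff) auto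
        then have "l \<le> (real (M n) + 2) * ln 2" by (subst (asm) ln_realpow) (auto simp: algebra_simps)
        then have "l / ln 2 \<le> real (M n) + 2" using l2 by (simp add: pos_divide_le_eq)
        then have "(l / ln 2 - 2) / l \<le> real (M n) / l" using l by (intro divide_right_mono) auto
        moreover have "(l / ln 2 - 2) / l = 1 / ln 2 - 2 / l" using l by (simp add: diff_divide_distrib)
        moreover have "real (M n) / l \<le> 1 / ln 2" using up l l2 by (simp add: divide_simps)
        ultimately show ?thesis by (simp add: l_def)
      qed
      then show "\<forall>\<^sub>F n in sequentially. 1 / ln 2 - 2 / ln (real n + 1) \<le> real (M n) / ln (real n + 1)"
        "\<forall>\<^sub>F n in sequentially. real (M n) / ln (real n + 1) \<le> 1 / ln 2"
        by (intro eventually_sequentiallyI[of 2]; blast)+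
    qed simp
  qed
qed

text \<open>
  The sum is a binomial coefficient, that is, a polynomial of degree \<open>d = card S\<close>, with leading coefficient
  \<open>1 / d!\<close>, in the largest \<open>M\<close> with \<open>2\<^sup>M < n\<close>, which is asymptotic to \<open>ln n / ln 2\<close>.
\<close>

lemma dyadic_upper_sum_limit:
  assumes S: "finite S"
  shows "(\<lambda>n. upper_sum (PiE S (\<lambda>_. dyadic)) (prod_weight S (\<lambda>_. dyadic_weight)) (1 / real n) / ln (real n + 1) ^ card S)
     \<longlonglongrightarrow> (1 / ln 2) ^ card S / fact (card S)"
proof -
  obtain M where M: "\<And>n j. n \<ge> 2 \<Longrightarrow> 2 ^ j < n \<longleftrightarrow> j \<le> M n" and lim: "(\<lambda>n. real (M n) / ln (real n + 1)) \<longlonglongrightarrow> 1 / ln 2"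
    using dyadic_log by blast
  define d where "d = card S"
  have U: "upper_sum (PiE S (\<lambda>_. dyadic)) (prod_weight S (\<lambda>_. dyadic_weight)) (1 / real n) = real ((M n + d) choose d)"
    if n: "n \<ge> 2" for n
  proof -
    have "1 / real n < 1 / 2 ^ j \<longleftrightarrow> j \<le> M n" for j
    proof -
      have "1 / real n < 1 / 2 ^ j \<longleftrightarrow> (2::real) ^ j < real n" using n by (simp add: field_simps)
      also have "\<dots> \<longleftrightarrow> 2 ^ j < n" by (metis of_nat_less_iff of_nat_numeral of_nat_power)
      finally show ?thesis using M[OF n] by simp
    qed
    then have "{m\<in>PiE S (\<lambda>_. dyadic). 1 / real n < prod_weight S (\<lambda>_. dyadic_weight) m} = dyadic_simplex S (M n)"
      unfolding prod_dyadic_weight dyadic_simplex_def by blast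
    then show ?thesis unfolding upper_sum_def using dyadic_simplex_sum[OF S] by (simp add: d_def)
  qed
  have "(\<lambda>n. \<Prod>i<d. (real (M n) / ln (real n + 1) + real (d - i) / ln (real n + 1)) / real (d - i)) \<longlonglongrightarrow>
      (\<Prod>i<d. (1 / ln 2 + 0) / real (d - i))"
    by (intro tendsto_prod tendsto_divide tendsto_add lim tendsto_const real_tendsto_divide_at_top[OF tendsto_const ln_Suc_at_top]) auto
  moreover have "(\<Prod>i<d. (1 / ln 2 + 0) / real (d - i)) = (1 / ln 2) ^ d / fact d"
  proof -
    have "(\<Prod>i<d. real (d - i)) = fact d"
      unfolding fact_prod_rev by (simp add: lessThan_atLeast0)
    then show ?thesis by (simp only: prod_dividef add_0_right prod_constant card_lessThan power_divide power_one)
  qed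
  moreover have "\<forall>\<^sub>F n in sequentially. (\<Prod>i<d. (real (M n) / ln (real n + 1) + real (d - i) / ln (real n + 1)) / real (d - i)) =
     upper_sum (PiE S (\<lambda>_. dyadic)) (prod_weight S (\<lambda>_. dyadic_weight)) (1 / real n) / ln (real n + 1) ^ d"
  proof (rule eventually_sequentiallyI[of 2])
    fix n :: nat assume n: "n \<ge> 2"
    have binom: "real ((M n + d) choose d) = (\<Prod>i<d. real (M n + d - i) / real (d - i))"
      by (subst binomial_altdef_of_nat) (auto simp: lessThan_atLeast0)
    have fac: "(\<Prod>i<d. (real (M n) / ln (real n + 1) + real (d - i) / ln (real n + 1)) / real (d - i)) =
        (\<Prod>i<d. (real (M n + d - i) / real (d - i)) / ln (real n + 1))"
      by (rule prod.cong) (auto simp: of_nat_diff add_divide_distrib[symmetric] mult.commute)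
    have const: "(\<Prod>i<d. g i / ln (real n + 1)) = (\<Prod>i<d. g i) / ln (real n + 1) ^ d" for g :: "nat \<Rightarrow> real"
      by (simp add: prod_dividef)
    show "(\<Prod>i<d. (real (M n) / ln (real n + 1) + real (d - i) / ln (real n + 1)) / real (d - i)) =
     upper_sum (PiE S (\<lambda>_. dyadic)) (prod_weight S (\<lambda>_. dyadic_weight)) (1 / real n) / ln (real n + 1) ^ d"
      unfolding U[OF n] fac const binom ..
  qed
  ultimately show ?thesis by (simp add: d_def tendsto_cong)
qed

lemma dyadic_log_count: "log_count 0 dyadic dyadic_weight"
proof -
  have lev: "\<exists>M. {p\<in>dyadic. \<epsilon> < dyadic_weight p} \<subseteq> {p\<in>dyadic. fst p \<le> M} \<and> (2::real) ^ M \<le> 1 / \<epsilon>"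
    if \<epsilon>: "0 < \<epsilon>" "\<epsilon> < 1" for \<epsilon>
  proof -
    define M where "M = nat \<lfloor>log 2 (1 / \<epsilon>)\<rfloor>"
    have l: "0 \<le> log 2 (1 / \<epsilon>)" using \<epsilon> by simp
    have "fst p \<le> M" if "\<epsilon> < dyadic_weight p" for p
    proof -
      have "2 ^ fst p < 1 / \<epsilon>" using that \<epsilon> by (simp add: dyadic_weight_def field_simps)
      then have "log 2 (2 ^ fst p) \<le> log 2 (1 / \<epsilon>)" using \<epsilon> by (subst log_le_cancel_iff) auto
      then have "real (fst p) \<le> log 2 (1 / \<epsilon>)" by (simp add: log_nat_power)
      then show ?thesis unfolding M_def by (rule le_nat_floor)
    qed
    moreover have "(2::real) ^ M \<le> 1 / \<epsilon>"
    proof -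
      have "real M \<le> log 2 (1 / \<epsilon>)" using l by (simp add: M_def)
      then have "2 powr real M \<le> 2 powr log 2 (1 / \<epsilon>)" by simp
      then show ?thesis using \<epsilon> by (simp add: powr_realpow)
    qed
    ultimately show ?thesis by blast
  qed
  have le1: "{p\<in>dyadic. \<epsilon> < dyadic_weight p} = {}" if "\<epsilon> \<ge> 1" for \<epsilon>
  proof -
    have "dyadic_weight p \<le> 1" for p by (simp add: dyadic_weight_def)
    then have "\<not> \<epsilon> < dyadic_weight p" for p using that order_trans[of "dyadic_weight p" 1 \<epsilon>] by (simp add: not_less)
    then show ?thesis by simp
  qed
  have fin: "finite {p\<in>dyadic. \<epsilon> < dyadic_weight p}" if "\<epsilon> > 0" for \<epsilon>
  proof (cases "\<epsilon> < 1")
    case True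
    then show ?thesis using lev[OF that True] finite_dyadic_level finite_subset by blast
  next
    case False
    then have "{p\<in>dyadic. \<epsilon> < dyadic_weight p} = {}" by (intro le1) simp
    then show ?thesis by (simp only: finite.emptyI)
  qed
  have "real (upper_count dyadic dyadic_weight \<epsilon>) \<le> 2 / \<epsilon>" if \<epsilon>: "\<epsilon> > 0" for \<epsilon>
  proof (cases "\<epsilon> < 1")
    case True
    obtain M where M: "{p\<in>dyadic. \<epsilon> < dyadic_weight p} \<subseteq> {p\<in>dyadic. fst p \<le> M}" "(2::real) ^ M \<le> 1 / \<epsilon>"
      using lev[OF \<epsilon> True] by blast
    have "real (card {p\<in>dyadic. fst p \<le> M}) = (\<Sum>p\<in>{p\<in>dyadic. fst p \<le> M}. dyadic_weight p * 2 ^ fst p)"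
      by (simp add: dyadic_weight_def)
    also have "\<dots> = (\<Sum>j\<le>M. 2 ^ j)" by (rule sum_dyadic_level)
    also have "\<dots> \<le> 2 * 2 ^ M" using sum_power2[of "Suc M"] by (induction M) auto
    also have "\<dots> \<le> 2 / \<epsilon>" using M(2) by simp
    finally have "real (card {p\<in>dyadic. fst p \<le> M}) \<le> 2 / \<epsilon>" .
    moreover have "upper_count dyadic dyadic_weight \<epsilon> \<le> card {p\<in>dyadic. fst p \<le> M}"
      unfolding upper_count_def by (rule card_mono[OF finite_dyadic_level M(1)])
    ultimately show ?thesis by linarith
  next
    case False
    then have "{p\<in>dyadic. \<epsilon> < dyadic_weight p} = {}" by (intro le1) simp
    then show ?thesis using \<epsilon> by (simp only: upper_count_def card.empty) simp
  qed
  moreover have "vanishing_on dyadic dyadic_weight" using fin by (simp add: vanishing_on_def dyadic_weight_def)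
  ultimately show ?thesis unfolding log_count_def by (intro conjI exI[of _ 2]) auto
qed

text \<open>
  Gram-Schmidt: the span of finitely many vectors is not the whole space.
\<close>

lemma orthonormal_sequence_exists:
  assumes "separable_infinite_dim TYPE('a::complex_hilbert_space)"
  shows "\<exists>e :: nat \<Rightarrow> 'a. orthonormal_on UNIV e"
proof -
  have step: "\<exists>x::'a. norm x = 1 \<and> (\<forall>y\<in>F. cinner y x = 0)"
    if F: "finite F" "orthonormal_on F (\<lambda>y. y)" for F :: "'a set"
  proof -
    have "cspan F \<noteq> UNIV" using assms F(1) unfolding separable_infinite_dim_def by blast
    then obtain z where z: "z \<notin> cspan F" by blast
    define p where "p = (\<Sum>y\<in>F. cinner y z *\<^sub>C y)"
    have "p \<in> cspan F" unfolding p_def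
      by (intro complex_vector.span_sum complex_vector.span_scale complex_vector.span_base)
    then have ne: "z - p \<noteq> 0" using z by auto
    define x where "x = complex_of_real (1 / norm (z - p)) *\<^sub>C (z - p)"
    have "cinner y (z - p) = 0" if "y \<in> F" for y
      using orthonormal_cinner_sum[OF F(2) subset_refl F(1) that, of "\<lambda>y. cinner y z"] that
      by (simp add: p_def cinner.diff_right)
    then have "\<forall>y\<in>F. cinner y x = 0" by (simp add: x_def cinner_scaleC_right)
    moreover have "norm x = 1" using ne by (simp add: x_def norm_scaleC norm_divide)
    ultimately show ?thesis by blast
  qed
  define P where "P F x \<longleftrightarrow> norm x = 1 \<and> (\<forall>y\<in>F. cinner y x = 0)" for F and x :: 'a
  \<comment> \<open>\<open>E n\<close> is the set of the first \<open>n\<close> vectors of the sequence\<close>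
  define E where "E = rec_nat {} (\<lambda>_ F. insert (SOME x :: 'a. P F x) F)"
  define e where "e n = (SOME x. P (E n) x)" for n
  have E0: "E 0 = {}" and ES: "E (Suc n) = insert (e n) (E n)" for n by (simp_all add: E_def e_def)
  have inv: "finite (E n) \<and> orthonormal_on (E n) (\<lambda>y. y) \<and> P (E n) (e n)" for n
  proof (induction n)
    case 0
    show ?case using step[of "{}"] someI_ex[of "P {}"] by (simp add: E0 e_def orthonormal_on_def P_def)
  next
    case (Suc n)
    have en: "cinner (e n) (e n) = 1" "\<And>y. y \<in> E n \<Longrightarrow> cinner y (e n) = 0"
      using Suc by (auto simp: P_def cinner_self)
    have "cinner (e n) y = 0" if "y \<in> E n" for y using en(2)[OF that] cinner_commute[of "e n" y] by simp
    then have "orthonormal_on (E (Suc n)) (\<lambda>y. y)" "finite (E (Suc n))"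
      using Suc en by (auto simp: ES orthonormal_on_def)
    moreover from this have "P (E (Suc n)) (e (Suc n))"
      using step[of "E (Suc n)"] someI_ex[of "P (E (Suc n))"] by (simp add: e_def P_def)
    ultimately show ?case by simp
  qed
  have mem: "e m \<in> E n" if "m < n" for m n using that by (induction n) (auto simp: ES less_Suc_eq)
  have lt: "cinner (e m) (e n) = 0" if "m < n" for m n using inv[of n] mem[OF that] by (simp add: P_def)
  have "cinner (e m) (e n) = (if m = n then 1 else 0)" for m n
  proof (cases m n rule: linorder_cases)
    case less
    then show ?thesis using lt by simp
  next
    case equal
    then show ?thesis using inv[of n] by (simp add: P_def cinner_self)
  next
    case greater
    then show ?thesis using lt[OF greater] cinner_commute[of "e m" "e n"] by simp
  qed
  then show ?thesis by (intro exI[of _ e]) (simp add: orthonormal_on_def)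
qed

lemma (in tensor_power) reference_operator:
  assumes inf: "separable_infinite_dim TYPE('a)"
  obtains R :: "'a \<Rightarrow> 'a" and \<tau> \<rho> :: complex where "R \<in> weak_trace_class" "positive_op R" "\<tau> \<noteq> 0"
    "\<And>\<theta>. \<theta> \<in> dixmier_traces 0 \<Longrightarrow> \<theta> R = \<tau>" "\<And>\<phi>. \<phi> \<in> dixmier_traces k \<Longrightarrow> \<phi> (tensor_op t (\<lambda>_. R)) = \<rho>"
proof -
  obtain e :: "nat \<Rightarrow> 'a" where e: "orthonormal_on UNIV e" using orthonormal_sequence_exists[OF inf] by blast
  define b where "b = e \<circ> prod_encode"
  have b: "orthonormal_on dyadic b"
    using e by (auto simp: orthonormal_on_def b_def prod_encode_eq)
  have v: "vanishing_on dyadic dyadic_weight" using dyadic_log_count by (simp add: log_count_def)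
  obtain R where R: "singular_system R dyadic b b dyadic_weight" using singular_system_exists[OF v b b] by blast
  have Rw: "R \<in> weak_trace_class"
    by (rule weak_trace_classI[OF R dyadic_log_count])
  have Rp: "positive_op R" by (rule singular_system_positive[OF R])
  have R\<theta>: "\<theta> R = complex_of_real (1 / ln 2)" if "\<theta> \<in> dixmier_traces 0" for \<theta>
  proof -
    have bij: "bij_betw (\<lambda>m. m (0::nat)) (PiE {0} (\<lambda>_. dyadic)) dyadic"
    proof (rule bij_betw_imageI)
      show "inj_on (\<lambda>m. m (0::nat)) (PiE {0} (\<lambda>_. dyadic))"
        by (rule inj_onI, rule PiE_ext) auto
      show "(\<lambda>m. m (0::nat)) ` PiE {0} (\<lambda>_. dyadic) = dyadic"
      proof (intro equalityI subsetI)
        fix p assume "p \<in> dyadic"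
        then have "restrict (\<lambda>_. p) {0} \<in> PiE {0::nat} (\<lambda>_. dyadic)" by (simp add: restrict_PiE_iff)
        then show "p \<in> (\<lambda>m. m (0::nat)) ` PiE {0} (\<lambda>_. dyadic)" by (rule rev_image_eqI) simp
      next
        fix p assume "p \<in> (\<lambda>m. m (0::nat)) ` PiE {0} (\<lambda>_. dyadic)"
        then obtain m where "m \<in> PiE {0::nat} (\<lambda>_. dyadic)" "p = m 0" by (rule imageE)
        then show "p \<in> dyadic" using PiE_mem[of m "{0}" "\<lambda>_. dyadic" 0] by simp
      qed
    qed
    have "upper_sum dyadic dyadic_weight \<epsilon> = upper_sum (PiE {0} (\<lambda>_. dyadic)) (prod_weight {0} (\<lambda>_. dyadic_weight)) \<epsilon>" for \<epsilon>
      by (rule upper_reindex(2)[OF bij]) (simp add: prod_weight_def)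
    then have "(\<lambda>n. upper_sum dyadic dyadic_weight (1 / real n) / ln (real n + 1) ^ (0 + 1)) \<longlonglongrightarrow> 1 / ln 2"
      using dyadic_upper_sum_limit[of "{0}"] by simp
    from dixmier_trace_of_limit[OF that R dyadic_log_count this] show ?thesis by simp
  qed
  have R\<phi>: "\<phi> (tensor_op t (\<lambda>_. R)) = complex_of_real ((real k + 1) * ((1 / ln 2) ^ (k + 1) / fact (k + 1)))"
    if "\<phi> \<in> dixmier_traces k" for \<phi>
  proof (rule dixmier_trace_of_limit[OF that])
    show "singular_system (tensor_op t (\<lambda>_. R)) (PiE {..k} (\<lambda>_. dyadic)) (tensor_vec t (\<lambda>_. b)) (tensor_vec t (\<lambda>_. b))
        (prod_weight {..k} (\<lambda>_. dyadic_weight))"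
      by (rule tensor_op_singular_system(1)) (rule R)
    show "log_count k (PiE {..k} (\<lambda>_. dyadic)) (prod_weight {..k} (\<lambda>_. dyadic_weight))"
      by (rule log_count_slots) (rule dyadic_log_count)
    show "(\<lambda>n. upper_sum (PiE {..k} (\<lambda>_. dyadic)) (prod_weight {..k} (\<lambda>_. dyadic_weight)) (1 / real n) / ln (real n + 1) ^ (k + 1))
       \<longlonglongrightarrow> (1 / ln 2) ^ (k + 1) / fact (k + 1)"
      using dyadic_upper_sum_limit[of "{..k}"] by simp
  qed
  have ne: "complex_of_real (1 / ln 2) \<noteq> 0" by simp
  show thesis by (rule that[OF Rw Rp ne], rule R\<theta>, assumption, rule R\<phi>, assumption)
qed

section \<open>Exchanging the factors\<close>

context tensor_power

begin

lemma slot_replacement_positive: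
  assumes i: "i \<le> k" and B: "\<And>j. j \<le> k \<Longrightarrow> j \<noteq> i \<Longrightarrow> B j \<in> weak_trace_class \<and> positive_op (B j)"
    and \<phi>: "\<phi> \<in> dixmier_traces k" and A: "A \<in> weak_trace_class" "\<And>\<theta>. \<theta> \<in> dixmier_traces 0 \<Longrightarrow> \<theta> A = a"
    and R: "R \<in> weak_trace_class" "\<And>\<theta>. \<theta> \<in> dixmier_traces 0 \<Longrightarrow> \<theta> R = \<tau>" "\<tau> \<noteq> 0"
  shows "\<phi> (tensor_op t (B(i := A))) = a / \<tau> * \<phi> (tensor_op t (B(i := R)))"
proof -
  obtain c where "(\<forall>A\<in>weak_trace_class. \<phi> (tensor_op t (B(i := A))) = 0) \<or>
     c \<noteq> 0 \<and> (\<lambda>A. \<phi> (tensor_op t (B(i := A))) / c) \<in> dixmier_traces 0"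
    using slot_dixmier_trace[of i B \<phi>] i B \<phi> by blast
  then show ?thesis
  proof
    assume "c \<noteq> 0 \<and> (\<lambda>A. \<phi> (tensor_op t (B(i := A))) / c) \<in> dixmier_traces 0"
    then have "c \<noteq> 0" "\<phi> (tensor_op t (B(i := A))) / c = a" "\<phi> (tensor_op t (B(i := R))) / c = \<tau>"
      using A(2) R(2) by auto
    then show ?thesis using R(3) by (auto simp: field_simps)
  qed (use A(1) R(1) in simp)
qed

text \<open>
  Induction over a finite set \<open>D\<close> that contains the slots whose operator need not be positive. Both sides
  are linear in the operator of such a slot, and positive operators span.
\<close>

lemma slot_replacement:
  assumes i: "i \<le> k" and \<phi>: "\<phi> \<in> dixmier_traces k"
    and A: "A \<in> weak_trace_class" "\<And>\<theta>. \<theta> \<in> dixmier_traces 0 \<Longrightarrow> \<theta> A = a"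
    and R: "R \<in> weak_trace_class" "\<And>\<theta>. \<theta> \<in> dixmier_traces 0 \<Longrightarrow> \<theta> R = \<tau>" "\<tau> \<noteq> 0"
    and B: "\<And>j. j \<le> k \<Longrightarrow> j \<noteq> i \<Longrightarrow> B j \<in> weak_trace_class"
  shows "\<phi> (tensor_op t (B(i := A))) = a / \<tau> * \<phi> (tensor_op t (B(i := R)))"
proof -
  have lin: "linear_functional_on (I_ideal k) \<phi>" using \<phi> by (simp add: dixmier_traces_def)
  have "\<phi> (tensor_op t (B(i := A))) = a / \<tau> * \<phi> (tensor_op t (B(i := R)))"
    if "finite D" "\<And>j. j \<le> k \<Longrightarrow> j \<noteq> i \<Longrightarrow> B j \<in> weak_trace_class" "\<And>j. j \<le> k \<Longrightarrow> j \<noteq> i \<Longrightarrow> j \<notin> D \<Longrightarrow> positive_op (B j)" for B D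
    using that
  proof (induction D arbitrary: B)
    case empty
    show ?case
      by (rule slot_replacement_positive[of i B \<phi> A a R \<tau>]) (use i \<phi> A R empty in auto)
  next
    case (insert j D)
    show ?case
    proof (cases "j \<le> k \<and> j \<noteq> i")
      case False
      show ?thesis by (rule insert.IH) (use insert.prems False in auto)
    next
      case True
      define \<theta> where "\<theta> X P = \<phi> (tensor_op t ((B(i := X))(j := P)))" for X P
      have lin\<theta>: "linear_functional_on weak_trace_class (\<theta> X)" if "X \<in> weak_trace_class" for X
        unfolding \<theta>_def by (rule slot_linear_functional[OF _ _ lin]) (use True insert.prems that in auto)
      have swap: "(B(i := X))(j := P) = (B(j := P))(i := X)" for X P using True by (simp add: fun_upd_twist)
      have "\<theta> A P = a / \<tau> * \<theta> R P" if P: "P \<in> weak_trace_class" "positive_op P" for P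
        unfolding \<theta>_def swap by (rule insert.IH) (use insert.prems P in auto)
      moreover have "linear_functional_on weak_trace_class (\<lambda>P. a / \<tau> * \<theta> R P)"
        using lin\<theta>[OF R(1)] by (simp add: linear_functional_on_def distrib_left add_divide_distrib)
      ultimately have eq: "\<theta> A (B j) = a / \<tau> * \<theta> R (B j)"
        using linear_functional_eqI[OF lin\<theta>[OF A(1)]] insert.prems(1)[of j] True by blast
      have restore: "(B(i := X))(j := B j) = B(i := X)" for X using True by auto
      show ?thesis using eq unfolding \<theta>_def restore .
    qed
  qed
  from this[of "{..k}" B] show ?thesis using B by simp
qed

text \<open>
  Exchanging the factors one after another gives the value
  \<open>\<Prod>\<^sub>i (a\<^sub>i / \<tau>) \<cdot> \<rho>\<close> for every Dixmier trace, where \<open>a\<^sub>i\<close> and \<open>\<tau>\<close> are the common values of the Dixmier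
  traces at \<open>A\<^sub>i\<close> and \<open>R\<close>, and \<open>\<rho>\<close> the common value at the tensor power of \<open>R\<close>.
\<close>

lemma tensor_op_measurable:
  assumes inf: "separable_infinite_dim TYPE('a)"
    and A: "\<And>i. i \<le> k \<Longrightarrow> dixmier_measurable 0 (A i)"
  shows "dixmier_measurable k (tensor_op t A)"
proof -
  have w: "A i \<in> weak_trace_class" if "i \<le> k" for i using A[OF that] by (simp add: dixmier_measurable_def I_ideal_0)
  obtain R :: "'a \<Rightarrow> 'a" and \<tau> \<rho> :: complex where R: "R \<in> weak_trace_class" "positive_op R" "\<tau> \<noteq> 0"
    "\<And>\<theta>. \<theta> \<in> dixmier_traces 0 \<Longrightarrow> \<theta> R = \<tau>" "\<And>\<phi>. \<phi> \<in> dixmier_traces k \<Longrightarrow> \<phi> (tensor_op t (\<lambda>_. R)) = \<rho>"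
    using reference_operator[OF inf] by blast
  have "\<exists>a. \<forall>\<theta>\<in>dixmier_traces 0. \<theta> (A i) = a" if "i \<le> k" for i
    using A[OF that] unfolding dixmier_measurable_def by blast
  then obtain a where a: "\<And>i \<theta>. i \<le> k \<Longrightarrow> \<theta> \<in> dixmier_traces 0 \<Longrightarrow> \<theta> (A i) = a i" by metis
  have trace_value: "\<phi> (tensor_op t A) = (\<Prod>i\<le>k. a i / \<tau>) * \<rho>" if \<phi>: "\<phi> \<in> dixmier_traces k" for \<phi>
  proof -
    have "\<phi> (tensor_op t A) = (\<Prod>i<n. a i / \<tau>) * \<phi> (tensor_op t (\<lambda>i. if i < n then R else A i))" if "n \<le> Suc k" for n
      using that
    proof (induction n)
      case (Suc n)
      let ?B = "\<lambda>i. if i < n then R else A i"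
      have "?B(n := A n) = ?B" "?B(n := R) = (\<lambda>i. if i < Suc n then R else A i)" by (auto simp: less_Suc_eq)
      moreover have "\<phi> (tensor_op t (?B(n := A n))) = a n / \<tau> * \<phi> (tensor_op t (?B(n := R)))"
        by (rule slot_replacement[of n \<phi> "A n" "a n" R \<tau> ?B]) (use Suc.prems \<phi> w R a in auto)
      ultimately show ?case using Suc by (simp add: mult_ac)
    qed simp
    from this[of "Suc k"] have "\<phi> (tensor_op t A) = (\<Prod>i<Suc k. a i / \<tau>) * \<phi> (tensor_op t (\<lambda>i. if i < Suc k then R else A i))" by simp
    also have "tensor_op t (\<lambda>i. if i < Suc k then R else A i) = tensor_op t (\<lambda>_. R)" by (rule tensor_op_cong) simp
    finally show ?thesis using R(5)[OF \<phi>] by (simp only: lessThan_Suc_atMost)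
  qed
  show ?thesis
    unfolding dixmier_measurable_def
  proof (intro conjI ballI)
    show "tensor_op t A \<in> I_ideal k" by (rule tensor_op_I_ideal) (rule w)
    fix \<phi> \<psi> :: "('b \<Rightarrow> 'b) \<Rightarrow> complex" assume "\<phi> \<in> dixmier_traces k" "\<psi> \<in> dixmier_traces k"
    then show "\<phi> (tensor_op t A) = \<psi> (tensor_op t A)" by (simp only: trace_value)
  qed
qed

end

theorem corollary5p4:
  fixes k :: nat
    and t :: "(nat \<Rightarrow> 'a::complex_hilbert_space) \<Rightarrow> 'b::complex_hilbert_space"
  assumes "separable_infinite_dim TYPE('a)"
    and "hilbert_tensor_power k t"
  shows "(\<forall>V T :: nat \<Rightarrow> 'a \<Rightarrow> 'a.
            (\<forall>i\<le>k. bounded_clinear (V i)) \<longrightarrow>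
            (\<forall>i\<le>k. T i \<in> weak_trace_class \<and> positive_op (T i)) \<longrightarrow>
            (\<forall>i\<le>k. dixmier_measurable 0 (V i \<circ> T i)) \<longrightarrow>
            dixmier_measurable k (tensor_op t (\<lambda>i. V i \<circ> T i)))
       \<and> (\<forall>A :: nat \<Rightarrow> 'a \<Rightarrow> 'a.
            (\<forall>i\<le>k. A i \<in> weak_trace_class \<and> dixmier_measurable 0 (A i)) \<longrightarrow>
            dixmier_measurable k (tensor_op t A))"
proof -
  interpret tensor_power k t by unfold_locales (rule assms(2))
  show ?thesis
  proof (intro conjI allI impI)
    fix V T :: "nat \<Rightarrow> 'a \<Rightarrow> 'a" assume "\<forall>i\<le>k. dixmier_measurable 0 (V i \<circ> T i)"
    then show "dixmier_measurable k (tensor_op t (\<lambda>i. V i \<circ> T i))"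
      by (intro tensor_op_measurable[OF assms(1)]) simp
  next
    fix A :: "nat \<Rightarrow> 'a \<Rightarrow> 'a" assume "\<forall>i\<le>k. A i \<in> weak_trace_class \<and> dixmier_measurable 0 (A i)"
    then show "dixmier_measurable k (tensor_op t A)"
      by (intro tensor_op_measurable[OF assms(1)]) simp
  qed
qed

end
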